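(* Let $I,\tilde I$ be open intervals, let $L:\tilde I\to\mathcal{S}$ be an immersion, set $L_0:=L(v_0)$ for some $v_0\in\tilde I$ and denote by $A:\tilde I\to \mathrm{O}(4,2)$ the spherical evolution map along $L$ based at $v_0$. Let $C:I\to\mathcal{Z}$ be a Legendre curve in $L_0^\perp\cong\mathbb{R}^{3,2}$ such that $(\mathrm{Ad}_A\mathcal{N}^L)|_C$ is nowhere zero. Then $$f:I\times\tilde I\to\mathcal{Z},\qquad f(u,v)=A^{-1}(v)C(u)$$ is a Legendre map parametrised by curvature lines for which the $u$-parameter lines are spherical. Conversely, any surface (Legendre map) with one family of spherical curvature lines may locally be written in this way.
   Context: Let $\mathbb{R}^{4,2}$ be $\mathbb{R}^6$ with a symmetric bilinear form $(\cdot,\cdot)$ of signature $(4,2)$ and $\mathcal{Z}$ the Grassmannian of totally isotropic 2-planes in $\mathbb{R}^{4,2}$. For a manifold $\Sigma$, a smooth map $f:\Sigma\to\mathcal{Z}$ is identified with a rank 2 null subbundle of $\Sigma\times\mathbb{R}^{4,2}$; $f^{(1)}$ is the set of sections of $f$ and derivatives of sections of $f$. With $\dim\Sigma=2$, $f$ is a Legendre map if $f^{(1)}\le f^\perp$ and, for any $x\in\Sigma$, if $X\in T_x\Sigma$ satisfies $d\sigma(X)\in f$ for all $\sigma\in\Gamma f$, then $X=0$. A Legendre curve in $L_0^\perp\cong\mathbb{R}^{3,2}$ is a map $C$ from an interval into the isotropic 2-planes of $L_0^\perp$ satisfying the same two conditions with $\mathbb{R}^{4,2}$ replaced by $L_0^\perp$.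 Curvature lines: let $\beta(X)\in\mathrm{Hom}(f,f^\perp/f)$ be $\sigma\mapsto d_X\sigma\bmod f$ and $\mathcal{B}(X,Y)\,\xi_1\wedge\xi_2=\tfrac12(\beta(X)\xi_1\wedge\beta(Y)\xi_2+\beta(Y)\xi_1\wedge\beta(X)\xi_2)$. The leaves of a rank 1 distribution $T$ are curvature lines if $\mathcal{B}(T,T)=0$; $(u,v)$ are curvature line coordinates if the $u$- and $v$-parameter lines are curvature lines. The leaves of $T$ are spherical curvature lines if there is a spacelike rank 1 subbundle of $f^\perp$ that is constant along the leaves of $T$ (this is the Lie-invariant form of the condition that, in any conformal Riemannian subgeometry, the curvature lines along $T$ lie on spheres meeting the surface transversally). $\mathcal{S}$ is the Grassmannian of 1-dimensional spacelike subspaces of $\mathbb{R}^{4,2}$. Given $L:\tilde I\to\mathcal{S}$, the splitting $\tilde I\times\mathbb{R}^{4,2}=L\oplus L^\perp$ induces a splitting of the trivial connection $d=\mathcal{D}^L+\mathcal{N}^L$, where $\mathcal{D}^L$ is the sum of the induced connections on $L$ and $L^\perp$ and $\mathcal{N}^L\in\Omega^1(L\wedge L^\perp)$ (with $\wedge^2\mathbb{R}^{4,2}\cong\mathfrak{o}(4,2)$ via $(a\wedge b)c=(a,c)b-(b,c)a$). The spherical evolution map along $L$ based at $v_0\in\tilde I$ is the map $A:\tilde I\to\mathrm{O}(4,2)$ with $A\cdot\mathcal{D}^L:=A\circ\mathcal{D}^L\circ A^{-1}=d$ and $A(v_0)=\mathrm{id}$. $\mathrm{Ad}_A\mathcal{N}^L=A\mathcal{N}^LA^{-1}$,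 and $(\mathrm{Ad}_A\mathcal{N}^L)|_C$ nowhere zero means that for all $(u,v)$ the endomorphism $(\mathrm{Ad}_A\mathcal{N}^L)(\partial_v)$ at $v$ does not vanish on $C(u)$. *)

theory Defs
  imports "HOL-Analysis.Analysis"
begin

section \<open>Smooth maps and smooth subbundles of trivial bundles\<close>

fun Ck_on :: "nat \<Rightarrow> 'a::real_normed_vector set \<Rightarrow> ('a \<Rightarrow> 'b::real_normed_vector) \<Rightarrow> bool" where
  "Ck_on 0 S g \<longleftrightarrow> continuous_on S g"
| "Ck_on (Suc k) S g \<longleftrightarrow>
     (\<forall>x\<in>S. g differentiable (at x)) \<and> (\<forall>X. Ck_on k S (\<lambda>x. frechet_derivative g (at x) X))"

text \<open>Only used for open sets \<open>S\<close>.\<close>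

definition smooth_on :: "'a::real_normed_vector set \<Rightarrow> ('a \<Rightarrow> 'b::real_normed_vector) \<Rightarrow> bool" where
  "smooth_on S g \<longleftrightarrow> (\<forall>k. Ck_on k S g)"

definition open_interval :: "real set \<Rightarrow> bool" where
  "open_interval J \<longleftrightarrow> open J \<and> is_interval J \<and> J \<noteq> {}"

text \<open>A smooth map from an open set \<open>S\<close> into a Grassmannian of \<open>k\<close>-planes of a vector space is
  identified with a smooth rank \<open>k\<close> subbundle of the trivial bundle over \<open>S\<close>.\<close>

definition subbundle ::
    "nat \<Rightarrow> 'a::real_normed_vector set \<Rightarrow> ('a \<Rightarrow> 'b::euclidean_space set) \<Rightarrow> bool" where
  "subbundle k S F \<longleftrightarrow>
     (\<forall>x\<in>S. subspace (F x) \<and> dim (F x) = k) \<and>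
     (\<forall>x\<in>S. \<exists>U e. open U \<and> x \<in> U \<and> U \<subseteq> S \<and> (\<forall>i<k. smooth_on U (e i)) \<and>
        (\<forall>y\<in>U. F y = span ((\<lambda>i. e i y) ` {..<k})))"

text \<open>Sections of \<open>F\<close> defined on some neighbourhood of \<open>x\<close>. With a cut-off function such a section
  can be replaced by a global one that agrees with it near \<open>x\<close>.\<close>

definition sections_at ::
    "'a::real_normed_vector set \<Rightarrow> ('a \<Rightarrow> 'b::euclidean_space set) \<Rightarrow> 'a \<Rightarrow> ('a \<Rightarrow> 'b) set" where
  "sections_at S F x =
     {\<sigma>. \<exists>U. open U \<and> x \<in> U \<and> U \<subseteq> S \<and> smooth_on U \<sigma> \<and> (\<forall>y\<in>U. \<sigma> y \<in> F y)}"

text \<open>The derivative of a map into a Grassmannian in direction \<open>X\<close> is the homomorphism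
  \<open>\<sigma> \<mapsto> d\<^sub>X \<sigma> mod F\<close>; the map is immersed if this vanishes for \<open>X = 0\<close> only.\<close>

definition immersed ::
    "'a::real_normed_vector set \<Rightarrow> ('a \<Rightarrow> 'b::euclidean_space set) \<Rightarrow> bool" where
  "immersed S F \<longleftrightarrow>
     (\<forall>x\<in>S. \<forall>X. (\<forall>\<sigma>\<in>sections_at S F x. frechet_derivative \<sigma> (at x) X \<in> F x) \<longrightarrow> X = 0)"


section \<open>Lie sphere geometry\<close>

type_synonym R42 = "real^6"

definition lip :: "R42 \<Rightarrow> R42 \<Rightarrow> real" where
  "lip x y = x$1 * y$1 + x$2 * y$2 + x$3 * y$3 + x$4 * y$4 - x$5 * y$5 - x$6 * y$6"

definition perp :: "R42 set \<Rightarrow> R42 set" where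
  "perp F = {x. \<forall>y\<in>F. lip x y = 0}"

definition O42 :: "(real^6^6) set" where
  "O42 = {A. \<forall>x y. lip (A *v x) (A *v y) = lip x y}"

definition isotropic_planes :: "R42 set set" where
  "isotropic_planes = {W. subspace W \<and> dim W = 2 \<and> (\<forall>x\<in>W. \<forall>y\<in>W. lip x y = 0)}"

definition spacelike_lines :: "R42 set set" where
  "spacelike_lines = {W. subspace W \<and> dim W = 1 \<and> (\<forall>x\<in>W. x \<noteq> 0 \<longrightarrow> lip x x > 0)}"

text \<open>Fibre at \<open>x\<close> of \<open>f\<^sup>(\<^sup>1\<^sup>)\<close>, the sections of \<open>f\<close> together with their derivatives.\<close>

definition derived_bundle ::
    "'a::real_normed_vector set \<Rightarrow> ('a \<Rightarrow> R42 set) \<Rightarrow> 'a \<Rightarrow> R42 set" where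
  "derived_bundle S f x =
     {\<sigma> x |\<sigma>. \<sigma> \<in> sections_at S f x} \<union>
     {frechet_derivative \<sigma> (at x) X |\<sigma> X. \<sigma> \<in> sections_at S f x}"

text \<open>The common definition of Legendre maps (\<open>W = UNIV\<close>, two-dimensional domain) and of Legendre
  curves (\<open>W\<close> of signature \<open>(3,2)\<close>, one-dimensional domain).\<close>

definition legendre_in ::
    "R42 set \<Rightarrow> 'a::real_normed_vector set \<Rightarrow> ('a \<Rightarrow> R42 set) \<Rightarrow> bool" where
  "legendre_in W S f \<longleftrightarrow>
     subbundle 2 S f \<and> (\<forall>x\<in>S. f x \<in> isotropic_planes \<and> f x \<subseteq> W) \<and>
     (\<forall>x\<in>S. derived_bundle S f x \<subseteq> perp (f x) \<inter> W) \<and> immersed S f"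

definition legendre_map :: "(real \<times> real) set \<Rightarrow> (real \<times> real \<Rightarrow> R42 set) \<Rightarrow> bool" where
  "legendre_map S f \<longleftrightarrow> legendre_in UNIV S f"

definition legendre_curve :: "R42 set \<Rightarrow> real set \<Rightarrow> (real \<Rightarrow> R42 set) \<Rightarrow> bool" where
  "legendre_curve W J C \<longleftrightarrow> legendre_in W J C"


section \<open>Curvature lines\<close>

definition wedge :: "R42 \<Rightarrow> R42 \<Rightarrow> R42 \<Rightarrow> R42" where
  "wedge a b c = lip a c *\<^sub>R b - lip b c *\<^sub>R a"

text \<open>\<open>\<B>(X,Y) \<sigma>\<^sub>1 \<and> \<sigma>\<^sub>2\<close> at \<open>x\<close>. As \<open>lip\<close> descends to a nondegenerate form on \<open>f\<^sup>\<bottom>/f\<close>, the map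
  \<open>wedge\<close> identifies the second exterior power of \<open>f\<^sup>\<bottom>/f\<close> with the skew endomorphisms of
  \<open>f\<^sup>\<bottom>/f\<close>. All vectors here are representatives modulo \<open>f x\<close>: the arguments of \<open>wedge\<close>
  represent \<open>\<beta>(X)\<sigma>\<^sub>1\<close> etc., and \<open>c\<close> ranges over \<open>perp (f x)\<close>.\<close>

definition curvature_form ::
    "(real \<times> real) \<Rightarrow> (real \<times> real) \<Rightarrow> (real \<times> real) \<Rightarrow>
     (real \<times> real \<Rightarrow> R42) \<Rightarrow> (real \<times> real \<Rightarrow> R42) \<Rightarrow> R42 \<Rightarrow> R42" where
  "curvature_form x X Y \<sigma>1 \<sigma>2 c =
     (1/2) *\<^sub>R (wedge (frechet_derivative \<sigma>1 (at x) X) (frechet_derivative \<sigma>2 (at x) Y) c +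
               wedge (frechet_derivative \<sigma>1 (at x) Y) (frechet_derivative \<sigma>2 (at x) X) c)"

definition curvature_lines ::
    "(real \<times> real) set \<Rightarrow> (real \<times> real \<Rightarrow> R42 set) \<Rightarrow> (real \<times> real \<Rightarrow> (real \<times> real) set) \<Rightarrow> bool" where
  "curvature_lines S f T \<longleftrightarrow>
     (\<forall>x\<in>S. \<forall>X\<in>T x. \<forall>Y\<in>T x. \<forall>\<sigma>1\<in>sections_at S f x. \<forall>\<sigma>2\<in>sections_at S f x.
        \<forall>c\<in>perp (f x). curvature_form x X Y \<sigma>1 \<sigma>2 c \<in> f x)"

text \<open>The regularly parametrised curves in the leaves of the rank 1 distribution \<open>T\<close>.\<close>

definition integral_curve ::
    "(real \<times> real) set \<Rightarrow> (real \<times> real \<Rightarrow> (real \<times> real) set) \<Rightarrow>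
     real set \<Rightarrow> (real \<Rightarrow> real \<times> real) \<Rightarrow> bool" where
  "integral_curve S T J \<gamma> \<longleftrightarrow>
     open_interval J \<and> \<gamma> ` J \<subseteq> S \<and>
     (\<forall>t\<in>J. \<exists>X. (\<gamma> has_vector_derivative X) (at t) \<and> X \<in> T (\<gamma> t) \<and> X \<noteq> 0)"

definition spherical_bundle ::
    "(real \<times> real) set \<Rightarrow> (real \<times> real \<Rightarrow> R42 set) \<Rightarrow> (real \<times> real \<Rightarrow> (real \<times> real) set) \<Rightarrow>
     (real \<times> real \<Rightarrow> R42 set) \<Rightarrow> bool" where
  "spherical_bundle S f T E \<longleftrightarrow>
     subbundle 1 S E \<and> (\<forall>x\<in>S. E x \<in> spacelike_lines \<and> E x \<subseteq> perp (f x)) \<and>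
     (\<forall>J \<gamma>. integral_curve S T J \<gamma> \<longrightarrow> (\<forall>s\<in>J. \<forall>t\<in>J. E (\<gamma> s) = E (\<gamma> t)))"

definition spherical_curvature_lines ::
    "(real \<times> real) set \<Rightarrow> (real \<times> real \<Rightarrow> R42 set) \<Rightarrow> (real \<times> real \<Rightarrow> (real \<times> real) set) \<Rightarrow> bool" where
  "spherical_curvature_lines S f T \<longleftrightarrow>
     curvature_lines S f T \<and> (\<exists>E. spherical_bundle S f T E)"

definition u_lines :: "real \<times> real \<Rightarrow> (real \<times> real) set" where
  "u_lines x = span {(1, 0)}"

definition v_lines :: "real \<times> real \<Rightarrow> (real \<times> real) set" where
  "v_lines x = span {(0, 1)}"

definition curvature_line_coordinates ::
    "(real \<times> real) set \<Rightarrow> (real \<times> real \<Rightarrow> R42 set) \<Rightarrow> bool" where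
  "curvature_line_coordinates S f \<longleftrightarrow> curvature_lines S f u_lines \<and> curvature_lines S f v_lines"


section \<open>Spherical evolution\<close>

text \<open>Projection onto \<open>F\<close> along the orthogonal complement, for nondegenerate \<open>F\<close>.\<close>

definition lproj :: "R42 set \<Rightarrow> R42 \<Rightarrow> R42" where
  "lproj F x = (THE y. y \<in> F \<and> x - y \<in> perp F)"

text \<open>Covariant derivative in direction \<open>\<partial>\<^sub>v\<close>: the sum of the induced connections on \<open>L\<close> and
  \<open>L\<^sup>\<bottom>\<close>.\<close>

definition conn_D :: "(real \<Rightarrow> R42 set) \<Rightarrow> (real \<Rightarrow> R42) \<Rightarrow> real \<Rightarrow> R42" where
  "conn_D L \<sigma> v =
     (let \<sigma>1 = (\<lambda>t. lproj (L t) (\<sigma> t)); \<sigma>2 = (\<lambda>t. \<sigma> t - lproj (L t) (\<sigma> t));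
          d1 = vector_derivative \<sigma>1 (at v); d2 = vector_derivative \<sigma>2 (at v)
      in lproj (L v) d1 + (d2 - lproj (L v) d2))"

text \<open>The endomorphism \<open>\<N>\<^sup>L(\<partial>\<^sub>v) = (d - \<D>\<^sup>L)(\<partial>\<^sub>v)\<close> at \<open>v\<close>. It is tensorial, so its value on a vector
  \<open>w\<close> can be computed with the constant section \<open>w\<close>, whose flat derivative is zero.\<close>

definition conn_N :: "(real \<Rightarrow> R42 set) \<Rightarrow> real \<Rightarrow> R42 \<Rightarrow> R42" where
  "conn_N L v w = vector_derivative (\<lambda>_. w) (at v) - conn_D L (\<lambda>_. w) v"

text \<open>The gauge condition \<open>A \<circ> \<D>\<^sup>L \<circ> A\<^sup>-\<^sup>1 = d\<close> is tested on all smooth sections of the trivial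
  bundle.\<close>

definition spherical_evolution_map ::
    "real set \<Rightarrow> (real \<Rightarrow> R42 set) \<Rightarrow> real \<Rightarrow> (real \<Rightarrow> real^6^6) \<Rightarrow> bool" where
  "spherical_evolution_map J L v0 A \<longleftrightarrow>
     smooth_on J A \<and> (\<forall>v\<in>J. A v \<in> O42) \<and>
     (\<forall>\<sigma>. smooth_on J \<sigma> \<longrightarrow>
        (\<forall>v\<in>J. A v *v conn_D L (\<lambda>t. matrix_inv (A t) *v \<sigma> t) v = vector_derivative \<sigma> (at v))) \<and>
     A v0 = mat 1"

definition Ad_N_nowhere_zero_on ::
    "real set \<Rightarrow> real set \<Rightarrow> (real \<Rightarrow> R42 set) \<Rightarrow> (real \<Rightarrow> real^6^6) \<Rightarrow> (real \<Rightarrow> R42 set) \<Rightarrow> bool" where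
  "Ad_N_nowhere_zero_on I J L A C \<longleftrightarrow>
     (\<forall>u\<in>I. \<forall>v\<in>J. \<exists>c\<in>C u. A v *v conn_N L v (matrix_inv (A v) *v c) \<noteq> 0)"

definition immersion_into_spacelike_lines :: "real set \<Rightarrow> (real \<Rightarrow> R42 set) \<Rightarrow> bool" where
  "immersion_into_spacelike_lines J L \<longleftrightarrow>
     subbundle 1 J L \<and> (\<forall>v\<in>J. L v \<in> spacelike_lines) \<and> immersed J L"

definition evolution_data ::
    "real set \<Rightarrow> real set \<Rightarrow> (real \<Rightarrow> R42 set) \<Rightarrow> real \<Rightarrow> (real \<Rightarrow> real^6^6) \<Rightarrow>
     (real \<Rightarrow> R42 set) \<Rightarrow> bool" where
  "evolution_data I J L v0 A C \<longleftrightarrow>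
     open_interval I \<and> open_interval J \<and> immersion_into_spacelike_lines J L \<and> v0 \<in> J \<and>
     spherical_evolution_map J L v0 A \<and> legendre_curve (perp (L v0)) I C \<and>
     Ad_N_nowhere_zero_on I J L A C"

definition evolved :: "(real \<Rightarrow> real^6^6) \<Rightarrow> (real \<Rightarrow> R42 set) \<Rightarrow> real \<times> real \<Rightarrow> R42 set" where
  "evolved A C = (\<lambda>(u, v). (\<lambda>c. matrix_inv (A v) *v c) ` C u)"


section \<open>Surfaces\<close>

text \<open>A local parametrisation of a surface is given as a pair \<open>(V, \<psi>)\<close> with \<open>V\<close> open in the plane; it
  is the inverse of a chart.\<close>

type_synonym 'a param = "(real \<times> real) set \<times> (real \<times> real \<Rightarrow> 'a)"

definition parametrises :: "'a topology \<Rightarrow> 'a param \<Rightarrow> bool" where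
  "parametrises M = (\<lambda>(V, \<psi>). open V \<and> openin M (\<psi> ` V) \<and> embedding_map (top_of_set V) M \<psi>)"

definition overlap :: "'a param \<Rightarrow> 'a param \<Rightarrow> (real \<times> real) set" where
  "overlap c c' = {x \<in> fst c. snd c x \<in> snd c' ` fst c'}"

definition transition :: "'a param \<Rightarrow> 'a param \<Rightarrow> real \<times> real \<Rightarrow> real \<times> real" where
  "transition c c' = (\<lambda>x. inv_into (fst c') (snd c') (snd c x))"

definition compatible :: "'a param \<Rightarrow> 'a param \<Rightarrow> bool" where
  "compatible c c' \<longleftrightarrow>
     smooth_on (overlap c c') (transition c c') \<and> smooth_on (overlap c' c) (transition c' c)"

definition surface :: "'a topology \<Rightarrow> 'a param set \<Rightarrow> bool" where
  "surface M P \<longleftrightarrow>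
     Hausdorff_space M \<and> second_countable M \<and> (\<forall>c\<in>P. parametrises M c) \<and>
     (\<Union>c\<in>P. snd c ` fst c) = topspace M \<and> (\<forall>c\<in>P. \<forall>c'\<in>P. compatible c c')"

definition legendre_surface :: "'a param set \<Rightarrow> ('a \<Rightarrow> R42 set) \<Rightarrow> bool" where
  "legendre_surface P f \<longleftrightarrow> (\<forall>(V, \<psi>)\<in>P. legendre_map V (f \<circ> \<psi>))"

text \<open>A rank 1 distribution on a surface, given by its coordinate expressions \<open>T c\<close>.\<close>

definition distribution ::
    "'a param set \<Rightarrow> ('a param \<Rightarrow> real \<times> real \<Rightarrow> (real \<times> real) set) \<Rightarrow> bool" where
  "distribution P T \<longleftrightarrow>
     (\<forall>c\<in>P. subbundle 1 (fst c) (T c)) \<and>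
     (\<forall>c\<in>P. \<forall>c'\<in>P. \<forall>x\<in>overlap c c'.
        T c' (transition c c' x) = frechet_derivative (transition c c') (at x) ` T c x)"

text \<open>Leaves are connected, so a bundle is constant along the leaves of \<open>T\<close> iff it is constant along
  them within every parametrisation.\<close>

definition spherical_curvature_lines_surface ::
    "'a param set \<Rightarrow> ('a \<Rightarrow> R42 set) \<Rightarrow>
     ('a param \<Rightarrow> real \<times> real \<Rightarrow> (real \<times> real) set) \<Rightarrow> bool" where
  "spherical_curvature_lines_surface P f T \<longleftrightarrow>
     (\<forall>c\<in>P. curvature_lines (fst c) (f \<circ> snd c) (T c)) \<and>
     (\<exists>E. \<forall>c\<in>P. spherical_bundle (fst c) (f \<circ> snd c) (T c) (E \<circ> snd c))"

text \<open>Smoothly compatible local parametrisations whose \<open>u\<close>-parameter lines lie in the leaves of \<open>T\<close>.\<close>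

definition adapted_param ::
    "'a topology \<Rightarrow> 'a param set \<Rightarrow>
     ('a param \<Rightarrow> real \<times> real \<Rightarrow> (real \<times> real) set) \<Rightarrow> 'a param \<Rightarrow> bool" where
  "adapted_param M P T h \<longleftrightarrow>
     parametrises M h \<and> (\<forall>c\<in>P. compatible h c) \<and>
     (\<forall>c\<in>P. \<forall>x\<in>overlap h c.
        frechet_derivative (transition h c) (at x) (1, 0) \<in> T c (transition h c x))"

end

theory Submission
  imports Defs
begin

text \<open>
  Let \<open>e\<close> be a local unit section of \<open>L\<close>. Then \<open>\<N>\<^sup>L = e \<and> e'\<close> (\<open>conn_D_unit\<close>, \<open>conn_N_unit\<close>), so the
  gauge condition says that \<open>B = A\<^sup>-\<^sup>1\<close> solves the linear equation \<open>B' = \<N>\<^sup>L B\<close>, and that \<open>B(v)\<close> maps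
  \<open>L\<^sub>0\<^sup>\<bottom>\<close> into \<open>L(v)\<^sup>\<bottom>\<close> (\<open>B_perp\<close>).

  Direct part. For a section \<open>\<sigma>\<close> of \<open>f = B C\<close> the derivative \<open>\<sigma>\<^sub>u\<close> is \<open>B\<close> applied to the derivative of a
  section of \<open>C\<close>, hence in \<open>f\<^sup>\<bottom> \<inter> L\<^sup>\<bottom>\<close>, while \<open>\<sigma>\<^sub>v\<close> lies in \<open>f + L\<close>, its part in \<open>L\<close> being \<open>\<N>\<^sup>L \<sigma>\<close>
  (\<open>section_derivatives\<close>). This gives the contact condition. As \<open>L \<inter> L\<^sup>\<bottom> = 0\<close>, immersivity of \<open>f\<close> splits
  into that of \<open>C\<close> and the hypothesis that \<open>\<N>\<^sup>L\<close> does not vanish on \<open>f\<close>. The plane \<open>f\<^sup>\<bottom>/f\<close> is definite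
  and contains the line of \<open>L\<close>, so the derivatives along the \<open>u\<close>-lines, and those along the \<open>v\<close>-lines,
  each lie in a single line of \<open>f\<^sup>\<bottom>/f\<close>; this is the vanishing of \<open>\<B>\<close> on these lines.

  Converse. Let \<open>e\<close> be a local unit section of the given bundle \<open>E\<close>. It satisfies \<open>de(T) = 0\<close> because
  integral curves of \<open>T\<close> exist (\<open>integral_curve_exists\<close>, \<open>spherical_bundle_constant\<close>). Moreover \<open>de\<close>
  vanishes nowhere (\<open>spherical_bundle_immersed\<close>): where \<open>de = 0\<close>, all derivatives of sections of \<open>f\<close> are
  orthogonal to \<open>e\<close>, so \<open>df\<close> takes its values in one line of \<open>f\<^sup>\<bottom>/f\<close>; by the contact condition
  \<open>(d\<sigma>\<^sub>1(X), d\<sigma>\<^sub>2(Y))\<close> is symmetric in \<open>X\<close> and \<open>Y\<close> (\<open>contact_symmetric\<close>), so the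
  components of \<open>d\<sigma>\<^sub>1\<close> and \<open>d\<sigma>\<^sub>2\<close> in this line are proportional covectors with a nonzero common zero, contrary
  to immersivity. Hence a suitable component \<open>\<phi>\<close> of \<open>e\<close> has the
  leaves of \<open>T\<close> as level lines, and \<open>e\<close> is a function of \<open>v = \<phi>\<close> (\<open>factor_through\<close>), which defines \<open>L\<close>.
  Let \<open>A\<close> be the spherical evolution map along \<open>L\<close> (\<open>linear_transport_exists\<close>) and \<open>G = A f\<close>. This map
  into the isotropic planes of \<open>L\<^sub>0\<^sup>\<bottom>\<close> satisfies the contact condition there (\<open>G_contact\<close>), so the same
  symmetry argument shows that it has rank one. Therefore \<open>G\<close> is a function of one scalar \<open>u\<close>
  (\<open>profile_curve\<close>). In the coordinates \<open>(u, v)\<close> this reads \<open>A(v) f = C(u)\<close> (\<open>normal_form\<close>), and no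
  further choice of coordinates is needed for the second family of curvature lines.

  Isotropic planes are handled through the canonical frame whose two timelike coordinates form the
  identity matrix; derivatives of this frame lie in the positive definite coordinate subspace.
\<close>

section \<open>Calculus of smooth maps\<close>

text \<open>The derivative of \<open>f\<close> at \<open>x\<close> in direction \<open>X\<close> is written \<open>Der f x X\<close>.\<close>

abbreviation Der :: "('a::real_normed_vector \<Rightarrow> 'b::real_normed_vector) \<Rightarrow> 'a \<Rightarrow> 'a \<Rightarrow> 'b" where
  "Der f x \<equiv> frechet_derivative f (at x)"

lemma Ck_on_cong:
  assumes "open S" "\<And>x. x \<in> S \<Longrightarrow> f x = g x" "Ck_on k S f"
  shows "Ck_on k S g"
  using assms(2,3)
proof (induction k arbitrary: f g)
  case 0
  then show ?case by (simp cong: continuous_on_cong)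
next
  case (Suc k)
  have D: "(g has_derivative Der f x) (at x)" if "x \<in> S" for x
    using Suc.prems that assms(1)
    by (auto intro!: has_derivative_transform_within_open[of f _ x UNIV S g]
        simp: frechet_derivative_works[symmetric])
  have eq: "Der f x = Der g x" if "x \<in> S" for x
    using D[OF that] by (rule frechet_derivative_at)
  have "Ck_on k S (\<lambda>x. Der g x X)" for X
  proof (rule Suc.IH)
    show "Ck_on k S (\<lambda>x. Der f x X)" using Suc.prems(2) by simp
  qed (simp add: eq)
  moreover have "\<forall>x\<in>S. g differentiable (at x)" using D unfolding differentiable_def by blast
  ultimately show ?case by simp
qed

lemma Ck_on_subset: "Ck_on k S f \<Longrightarrow> T \<subseteq> S \<Longrightarrow> Ck_on k T f"
  by (induction k arbitrary: f) (auto intro: continuous_on_subset)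

lemma Ck_on_local:
  assumes "\<And>x. x \<in> S \<Longrightarrow> \<exists>U. open U \<and> x \<in> U \<and> Ck_on k U f"
  shows "Ck_on k S f"
  using assms
proof (induction k arbitrary: f)
  case 0
  have "isCont f x" if "x \<in> S" for x
    using 0[OF that] by (auto simp: continuous_on_eq_continuous_at)
  then show ?case by (simp add: continuous_at_imp_continuous_on)
next
  case (Suc k)
  have "Ck_on k S (\<lambda>x. Der f x X)" for X
    using Suc.prems by (intro Suc.IH) fastforce
  then show ?case using Suc.prems by fastforce
qed

lemma Ck_on_SucI:
  assumes "open S" "\<And>x. x \<in> S \<Longrightarrow> (f has_derivative f' x) (at x)"
    "\<And>X. Ck_on k S (\<lambda>x. f' x X)"
  shows "Ck_on (Suc k) S f"
proof -
  have "f' x = Der f x" if "x \<in> S" for x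
    using assms(2)[OF that] by (rule frechet_derivative_at)
  then have "Ck_on k S (\<lambda>x. Der f x X)" for X
    by (intro Ck_on_cong[OF assms(1) _ assms(3)[of X]]) auto
  then show ?thesis using assms(2) by (auto simp: differentiable_def)
qed

lemma Ck_on_Suc_imp: "Ck_on (Suc k) S f \<Longrightarrow> Ck_on k S f"
proof (induction k arbitrary: f)
  case 0
  then show ?case
    by (auto intro!: continuous_at_imp_continuous_on differentiable_imp_continuous_within)
next
  case (Suc k)
  have "Ck_on k S (\<lambda>x. Der f x X)" for X
    by (rule Suc.IH) (use Suc.prems Ck_on.simps(2)[of "Suc k" S f] in blast)
  moreover have "\<forall>x\<in>S. f differentiable (at x)"
    using Suc.prems Ck_on.simps(2)[of "Suc k" S f] by blast
  ultimately show ?case by (simp only: Ck_on.simps) blast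
qed

lemma Ck_on_SucD: "Ck_on (Suc k) S f \<Longrightarrow> Ck_on k S (\<lambda>x. Der f x X)"
  by simp

lemma Ck_on_has_derivative:
  "Ck_on (Suc k) S f \<Longrightarrow> x \<in> S \<Longrightarrow> (f has_derivative Der f x) (at x)"
  by (simp add: frechet_derivative_works)

lemma Ck_on_const: "Ck_on k S (\<lambda>x. c)"
  by (induction k arbitrary: c) auto

lemma Ck_on_linear:
  assumes "open S" "bounded_linear L" "Ck_on k S f"
  shows "Ck_on k S (\<lambda>x. L (f x))"
  using assms(3)
proof (induction k arbitrary: f)
  case 0
  then show ?case using assms(2) by (simp add: bounded_linear.continuous_on)
next
  case (Suc k)
  show ?case
  proof (rule Ck_on_SucI[OF assms(1)])
    show "((\<lambda>x. L (f x)) has_derivative (\<lambda>X. L (Der f x X))) (at x)"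
      if "x \<in> S" for x
      by (rule bounded_linear.has_derivative[OF assms(2) Ck_on_has_derivative[OF Suc.prems that]])
    show "Ck_on k S (\<lambda>x. L (Der f x X))" for X
      using Suc.prems by (intro Suc.IH) auto
  qed
qed

lemma Ck_on_bounded_linear: 
  assumes "open S" "bounded_linear L" shows "Ck_on k S L"
proof (cases k)
  case 0
  then show ?thesis using assms by (simp add: linear_continuous_on)
next
  case (Suc m)
  then show ?thesis
    using assms unfolding Suc
    by (intro Ck_on_SucI[where f' = "\<lambda>_. L"] Ck_on_const bounded_linear_imp_has_derivative)
qed

lemma Ck_on_add:
  assumes "open S" "Ck_on k S f" "Ck_on k S g"
  shows "Ck_on k S (\<lambda>x. f x + g x)"
  using assms(2,3)
proof (induction k arbitrary: f g)
  case 0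
  then show ?case by (simp add: continuous_on_add)
next
  case (Suc k)
  show ?case
  proof (rule Ck_on_SucI[OF assms(1)])
    show "((\<lambda>x. f x + g x) has_derivative
        (\<lambda>X. Der f x X + Der g x X)) (at x)"
      if "x \<in> S" for x
      using Suc.prems that by (intro has_derivative_add Ck_on_has_derivative)
    show "Ck_on k S (\<lambda>x. Der f x X + Der g x X)" for X
      using Suc.prems by (intro Suc.IH) auto
  qed
qed

lemma Ck_on_sum:
  assumes "open S" "\<And>i. i \<in> I \<Longrightarrow> Ck_on k S (f i)"
  shows "Ck_on k S (\<lambda>x. \<Sum>i\<in>I. f i x)"
  using assms(2)
  by (induction I rule: infinite_finite_induct) (auto intro: Ck_on_const Ck_on_add[OF assms(1)])

lemma Ck_on_bilinear:
  assumes "open S" "bounded_bilinear pr" "Ck_on k S f" "Ck_on k S g"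
  shows "Ck_on k S (\<lambda>x. pr (f x) (g x))"
  using assms(3,4)
proof (induction k arbitrary: f g)
  case 0
  then show ?case using assms(2) by (simp add: bounded_bilinear.continuous_on)
next
  case (Suc k)
  show ?case
  proof (rule Ck_on_SucI[OF assms(1)])
    show "((\<lambda>x. pr (f x) (g x)) has_derivative
        (\<lambda>X. pr (f x) (Der g x X) + pr (Der f x X) (g x))) (at x)"
      if "x \<in> S" for x
      using Suc.prems that by (intro bounded_bilinear.FDERIV[OF assms(2)] Ck_on_has_derivative)
    show "Ck_on k S (\<lambda>x. pr (f x) (Der g x X) +
            pr (Der f x X) (g x))" for X
      by (intro Ck_on_add[OF assms(1)] Suc.IH Ck_on_SucD Suc.prems
          Ck_on_Suc_imp[OF Suc.prems(1)] Ck_on_Suc_imp[OF Suc.prems(2)])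
  qed
qed

lemma linear_basis_expansion:
  fixes L :: "'a::euclidean_space \<Rightarrow> 'b::real_vector"
  assumes "linear L" shows "L y = (\<Sum>b\<in>Basis. (y \<bullet> b) *\<^sub>R L b)"
proof -
  have "L y = L (\<Sum>b\<in>Basis. (y \<bullet> b) *\<^sub>R b)" by (simp only: euclidean_representation)
  then show ?thesis by (simp only: linear_sum[OF assms] linear_cmul[OF assms])
qed

text \<open>The chain rule is expanded over a basis of the middle space, because the induction hypothesis
  only concerns derivatives of \<open>\<phi>\<close> in constant directions.\<close>

lemma Ck_on_compose:
  fixes g :: "'a::real_normed_vector \<Rightarrow> 'b::euclidean_space"
    and \<phi> :: "'b \<Rightarrow> 'c::real_normed_vector"
  assumes "open S" "open T" "g ` S \<subseteq> T" "Ck_on k S g" "Ck_on k T \<phi>"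
  shows "Ck_on k S (\<lambda>x. \<phi> (g x))"
  using assms(4,5)
proof (induction k arbitrary: \<phi>)
  case 0
  then show ?case using assms(3) by (auto intro: continuous_on_compose2)
next
  case (Suc k)
  let ?g = "\<lambda>x. Der g x" and ?\<phi> = "\<lambda>y. Der \<phi> y"
  show ?case
  proof (rule Ck_on_SucI[OF assms(1)])
    fix x assume x: "x \<in> S"
    then have gx: "g x \<in> T" using assms(3) by auto
    have "((\<lambda>x. \<phi> (g x)) has_derivative (\<lambda>X. ?\<phi> (g x) (?g x X))) (at x)"
      using diff_chain_at[OF Ck_on_has_derivative[OF Suc.prems(1) x] Ck_on_has_derivative[OF Suc.prems(2) gx]]
      by (simp add: o_def)
    moreover have "linear (?\<phi> (g x))"
      using Suc.prems(2) gx by (simp add: linear_frechet_derivative)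
    ultimately show "((\<lambda>x. \<phi> (g x)) has_derivative
        (\<lambda>X. \<Sum>b\<in>Basis. (?g x X \<bullet> b) *\<^sub>R ?\<phi> (g x) b)) (at x)"
      by (simp only: linear_basis_expansion[symmetric])
  next
    fix X
    show "Ck_on k S (\<lambda>x. \<Sum>b\<in>Basis. (?g x X \<bullet> b) *\<^sub>R ?\<phi> (g x) b)"
      by (intro Ck_on_sum Ck_on_bilinear[OF _ bounded_bilinear_scaleR] Suc.IH assms(1)
          Ck_on_linear[OF _ bounded_linear_inner_left] Ck_on_SucD Ck_on_Suc_imp[OF Suc.prems(1)] Suc.prems)
  qed
qed

lemma smooth_on_cong:
  "open S \<Longrightarrow> smooth_on S f \<Longrightarrow> (\<And>x. x \<in> S \<Longrightarrow> f x = g x) \<Longrightarrow> smooth_on S g"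
  using Ck_on_cong[of S f g] by (simp add: smooth_on_def)

lemma smooth_on_subset: "smooth_on S f \<Longrightarrow> T \<subseteq> S \<Longrightarrow> smooth_on T f"
  using Ck_on_subset[of _ S f T] by (simp add: smooth_on_def)

lemma smooth_on_local:
  "(\<And>x. x \<in> S \<Longrightarrow> \<exists>U. open U \<and> x \<in> U \<and> smooth_on U f) \<Longrightarrow> smooth_on S f"
  unfolding smooth_on_def by (intro allI Ck_on_local) blast

lemma smooth_on_const: "smooth_on S (\<lambda>x. c)"
  unfolding smooth_on_def by (simp add: Ck_on_const)

lemma smooth_on_linear:
  "open S \<Longrightarrow> bounded_linear L \<Longrightarrow> smooth_on S f \<Longrightarrow> smooth_on S (\<lambda>x. L (f x))"
  by (simp add: smooth_on_def Ck_on_linear)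

lemma smooth_on_bounded_linear: "open S \<Longrightarrow> bounded_linear L \<Longrightarrow> smooth_on S L"
  by (simp add: smooth_on_def Ck_on_bounded_linear)

lemma smooth_on_add:
  "open S \<Longrightarrow> smooth_on S f \<Longrightarrow> smooth_on S g \<Longrightarrow> smooth_on S (\<lambda>x. f x + g x)"
  by (simp add: smooth_on_def Ck_on_add)

lemma smooth_on_bilinear:
  "open S \<Longrightarrow> bounded_bilinear pr \<Longrightarrow> smooth_on S f \<Longrightarrow> smooth_on S g \<Longrightarrow>
    smooth_on S (\<lambda>x. pr (f x) (g x))"
  by (simp add: smooth_on_def Ck_on_bilinear)

lemmas smooth_on_scaleR = smooth_on_bilinear[OF _ bounded_bilinear_scaleR]
lemmas smooth_on_mult = smooth_on_bilinear[OF _ bounded_bilinear_mult]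

lemma smooth_on_minus: "open S \<Longrightarrow> smooth_on S f \<Longrightarrow> smooth_on S (\<lambda>x. - f x)"
  by (rule smooth_on_linear[where L = uminus]) (auto intro: bounded_linear_intros bounded_linear_minus bounded_linear_ident)

lemma smooth_on_diff:
  "open S \<Longrightarrow> smooth_on S f \<Longrightarrow> smooth_on S g \<Longrightarrow> smooth_on S (\<lambda>x. f x - g x)"
  using smooth_on_add[of S f "\<lambda>x. - g x"] by (simp add: smooth_on_minus)

lemma smooth_on_compose:
  fixes g :: "'a::real_normed_vector \<Rightarrow> 'b::euclidean_space"
  assumes "open S" "open T" "smooth_on S g" "smooth_on T \<phi>" "g ` S \<subseteq> T"
  shows "smooth_on S (\<lambda>x. \<phi> (g x))"
  using assms(3,4) Ck_on_compose[OF assms(1,2,5), of _ \<phi>] by (simp add: smooth_on_def)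

lemma smooth_on_continuous_on: "smooth_on S f \<Longrightarrow> continuous_on S f"
  unfolding smooth_on_def using Ck_on.simps(1) by blast

lemma smooth_on_has_derivative:
  "smooth_on S f \<Longrightarrow> x \<in> S \<Longrightarrow> (f has_derivative Der f x) (at x)"
  by (rule Ck_on_has_derivative[of 0 S]) (simp_all only: smooth_on_def)

lemma smooth_on_linear_deriv: "smooth_on S f \<Longrightarrow> x \<in> S \<Longrightarrow> linear (Der f x)"
  using smooth_on_has_derivative has_derivative_linear by blast

lemma smooth_on_deriv: "smooth_on S f \<Longrightarrow> smooth_on S (\<lambda>x. Der f x X)"
  unfolding smooth_on_def using Ck_on_SucD by blast

lemma smooth_on_has_vector_derivative:
  fixes f :: "real \<Rightarrow> 'b::real_normed_vector"
  assumes "smooth_on S f" "t \<in> S"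
  shows "(f has_vector_derivative vector_derivative f (at t)) (at t)"
  using smooth_on_has_derivative[OF assms] by (metis differentiableI vector_derivative_works)

lemma Der_eq_vector_derivative:
  fixes f :: "real \<Rightarrow> 'b::real_normed_vector"
  assumes "smooth_on S f" "t \<in> S"
  shows "Der f t X = X *\<^sub>R vector_derivative f (at t)"
  using frechet_derivative_eq_vector_derivative[OF differentiableI[OF smooth_on_has_derivative[OF assms]]]
  by simp

lemma smooth_on_vector_derivative:
  fixes f :: "real \<Rightarrow> 'b::real_normed_vector"
  assumes "open S" "smooth_on S f"
  shows "smooth_on S (\<lambda>t. vector_derivative f (at t))"
  by (rule smooth_on_cong[OF assms(1) smooth_on_deriv[OF assms(2), of 1]])
    (simp add: Der_eq_vector_derivative[OF assms(2)])

lemma Ck_on_inverse: "Ck_on k (-{0::real}) inverse"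
proof (induction k)
  case 0
  show ?case by (auto intro!: continuous_intros)
next
  case (Suc k)
  show ?case
  proof (rule Ck_on_SucI[where f' = "\<lambda>x X. - ((inverse x * inverse x) * X)"])
    show "open (- {0::real})" by auto
    show "(inverse has_derivative (\<lambda>X. - (inverse x * inverse x * X))) (at x)"
      if "x \<in> - {0}" for x :: real
      using that has_derivative_inverse'[of x UNIV] by (simp add: mult.commute mult.left_commute)
    show "Ck_on k (- {0}) (\<lambda>x::real. - (inverse x * inverse x * X))" for X
      by (rule Ck_on_linear[of _ "\<lambda>y. - (y * X)", OF _ _ Ck_on_bilinear[OF _ bounded_bilinear_mult Suc Suc]])
        (auto intro!: bounded_linear_minus bounded_linear_mult_left)
  qed
qed

lemma smooth_on_inverse:
  fixes f :: "'a::real_normed_vector \<Rightarrow> real"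
  assumes "open S" "smooth_on S f" "\<And>x. x \<in> S \<Longrightarrow> f x \<noteq> 0"
  shows "smooth_on S (\<lambda>x. inverse (f x))"
  using Ck_on_inverse assms by (intro smooth_on_compose[of S "-{0}" f inverse]) (auto simp: smooth_on_def)

lemma Ck_on_sqrt: "Ck_on k {0::real<..} sqrt"
proof (induction k)
  case 0
  show ?case by (auto intro!: continuous_intros)
next
  case (Suc k)
  show ?case
  proof (rule Ck_on_SucI[where f' = "\<lambda>x X. inverse (sqrt x) * (X / 2)"])
    show "open {0::real<..}" by auto
    show "(sqrt has_derivative (\<lambda>X. inverse (sqrt x) * (X / 2))) (at x)"
      if "x \<in> {0<..}" for x :: real
      using that DERIV_real_sqrt[of x]
      by (auto simp: has_field_derivative_def fun_eq_iff elim!: has_derivative_eq_rhs)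
    have "Ck_on k {0::real<..} (\<lambda>x. inverse (sqrt x))"
      by (rule Ck_on_compose[of _ "-{0}"]) (auto simp: Suc Ck_on_inverse)
    then show "Ck_on k {0<..} (\<lambda>x::real. inverse (sqrt x) * (X / 2))" for X
      using bounded_linear_mult_left[of "X / 2"]
      by (intro Ck_on_linear[where L = "\<lambda>y. y * (X / 2)"]) auto
  qed
qed

lemma smooth_on_rsqrt:
  fixes f :: "'a::real_normed_vector \<Rightarrow> real"
  assumes "open S" "smooth_on S f" "\<And>x. x \<in> S \<Longrightarrow> f x > 0"
  shows "smooth_on S (\<lambda>x. inverse (sqrt (f x)))"
proof (rule smooth_on_inverse[OF assms(1)])
  show "smooth_on S (\<lambda>x. sqrt (f x))"
    using Ck_on_sqrt assms by (intro smooth_on_compose[of S "{0<..}" f sqrt]) (auto simp: smooth_on_def)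
  show "sqrt (f x) \<noteq> 0" if "x \<in> S" for x using assms(3)[OF that] by simp
qed

lemma smooth_on_Pair:
  fixes f :: "'a::real_normed_vector \<Rightarrow> 'b::real_normed_vector" and g :: "'a \<Rightarrow> 'c::real_normed_vector"
  assumes "open S" "smooth_on S f" "smooth_on S g"
  shows "smooth_on S (\<lambda>x. (f x, g x))"
proof -
  have "smooth_on S (\<lambda>x. (f x, 0) + (0, g x))"
    using assms by (intro smooth_on_add smooth_on_linear[where L = "\<lambda>y. (y, 0)"]
        smooth_on_linear[where L = "\<lambda>y. (0, y)"])
      (auto intro!: bounded_linear_Pair bounded_linear_ident bounded_linear_zero)
  then show ?thesis by simp
qed

lemma Der_cong:
  assumes "open S" "smooth_on S f" "\<And>y. y \<in> S \<Longrightarrow> f y = g y" "x \<in> S"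
  shows "Der g x = Der f x"
proof -
  have "(g has_derivative Der f x) (at x)"
    by (rule has_derivative_transform_within_open[OF smooth_on_has_derivative[OF assms(2,4)] assms(1,4)])
      (simp add: assms(3))
  then show ?thesis by (rule frechet_derivative_at[symmetric])
qed

lemma Der_const_on:
  assumes "open S" "\<And>y. y \<in> S \<Longrightarrow> f y = c" "x \<in> S"
  shows "Der f x X = 0"
  using Der_cong[OF assms(1) smooth_on_const[of S c] _ assms(3), of f] assms(2) by simp

lemma has_vector_derivative_const_on:
  assumes "open S" "t \<in> S" "\<And>s. s \<in> S \<Longrightarrow> g s = c"
  shows "(g has_vector_derivative 0) (at t)"
  by (rule has_vector_derivative_transform_within_open[OF has_vector_derivative_const[of c] assms(1,2)])
    (simp add: assms(3))

lemma has_vector_derivative_id_on: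
  assumes "open S" "t \<in> S" "\<And>s. s \<in> S \<Longrightarrow> g s = s"
  shows "(g has_vector_derivative 1) (at t)"
  by (rule has_vector_derivative_transform_within_open[OF has_vector_derivative_id assms(1,2)])
    (simp add: assms(3))

lemma smooth_on_open_vimage: "open S \<Longrightarrow> smooth_on S f \<Longrightarrow> open U \<Longrightarrow> open (S \<inter> f -` U)"
  using continuous_on_open_vimage[of S f] smooth_on_continuous_on[of S f] by (simp add: Int_commute)

lemma linear_plane_expand:
  fixes g :: "real \<times> real \<Rightarrow> 'b::real_vector"
  assumes lin: "linear g"
  shows "g X = fst X *\<^sub>R g (1, 0) + snd X *\<^sub>R g (0, 1)"
proof -
  have "g X = g (fst X *\<^sub>R (1, 0) + snd X *\<^sub>R (0, 1))" by simp
  then show ?thesis by (simp only: linear_add[OF lin] linear_cmul[OF lin])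
qed

lemma Der_linear:
  assumes "bounded_linear L" "smooth_on S f" "x \<in> S"
  shows "Der (\<lambda>y. L (f y)) x X = L (Der f x X)"
  using frechet_derivative_at[OF bounded_linear.has_derivative[OF assms(1) smooth_on_has_derivative[OF assms(2,3)]]]
  by (simp add: fun_eq_iff)

lemma Der_bilinear:
  assumes "bounded_bilinear pr" "smooth_on S f" "smooth_on S g" "x \<in> S"
  shows "Der (\<lambda>y. pr (f y) (g y)) x X =
    pr (f x) (Der g x X) + pr (Der f x X) (g x)"
  using frechet_derivative_at[OF bounded_bilinear.FDERIV[OF assms(1)
        smooth_on_has_derivative[OF assms(2,4)] smooth_on_has_derivative[OF assms(3,4)]]]
  by (simp add: fun_eq_iff)

lemma Der_chain:
  assumes "smooth_on T f" "g x \<in> T" "smooth_on S g" "x \<in> S"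
  shows "Der (\<lambda>y. f (g y)) x X =
    Der f (g x) (Der g x X)"
  using frechet_derivative_at[OF diff_chain_at[OF smooth_on_has_derivative[OF assms(3,4)]
        smooth_on_has_derivative[OF assms(1,2)]]]
  by (simp add: fun_eq_iff o_def)

lemma has_vector_derivative_chain:
  assumes "smooth_on T f" "\<gamma> t \<in> T" "(\<gamma> has_vector_derivative X) (at t)"
  shows "((\<lambda>s. f (\<gamma> s)) has_vector_derivative Der f (\<gamma> t) X) (at t)"
proof -
  have "linear (Der f (\<gamma> t))" by (rule smooth_on_linear_deriv[OF assms(1,2)])
  then show ?thesis
    using diff_chain_at[OF assms(3)[unfolded has_vector_derivative_def] smooth_on_has_derivative[OF assms(1,2)]]
    by (simp add: has_vector_derivative_def o_def linear_cmul)
qed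

lemma line_derivative:
  assumes "smooth_on S f" "x + s *\<^sub>R X \<in> S"
  shows "((\<lambda>s. f (x + s *\<^sub>R X)) has_vector_derivative Der f (x + s *\<^sub>R X) X) (at s)"
  by (rule has_vector_derivative_chain[where \<gamma> = "\<lambda>s. x + s *\<^sub>R X", OF assms]) (auto intro!: derivative_eq_intros)

text \<open>The second difference quotient of \<open>f\<close> over a parallelogram is a mixed second derivative at an
  inner point, by two applications of the mean value theorem.\<close>

lemma mean_value_mixed:
  fixes f :: "'a::real_normed_vector \<Rightarrow> real"
  assumes sm: "smooth_on S f" and h: "0 < h"
    and S: "\<And>s t. s \<in> {0..h} \<Longrightarrow> t \<in> {0..h} \<Longrightarrow> x + s *\<^sub>R X + t *\<^sub>R Y \<in> S"
  obtains a b where "a \<in> {0<..<h}" "b \<in> {0<..<h}"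
    "f (x + h *\<^sub>R X + h *\<^sub>R Y) - f (x + h *\<^sub>R X) - f (x + h *\<^sub>R Y) + f x =
      h * h * Der (\<lambda>y. Der f y X) (x + a *\<^sub>R X + b *\<^sub>R Y) Y"
proof -
  let ?DX = "\<lambda>y. Der f y X"
  define \<phi> where "\<phi> s = f ((x + h *\<^sub>R Y) + s *\<^sub>R X) - f (x + s *\<^sub>R X)" for s
  have 1: "(\<phi> has_real_derivative ?DX ((x + h *\<^sub>R Y) + s *\<^sub>R X) - ?DX (x + s *\<^sub>R X)) (at s)"
    if "0 \<le> s" "s \<le> h" for s
    unfolding \<phi>_def has_real_derivative_iff_has_vector_derivative
    using S[of s h] S[of s 0] that h
    by (intro has_vector_derivative_diff line_derivative[OF sm]) (auto simp: add_ac)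
  obtain a where a: "0 < a" "a < h"
    and a_eq: "\<phi> h - \<phi> 0 = (h - 0) * (?DX ((x + h *\<^sub>R Y) + a *\<^sub>R X) - ?DX (x + a *\<^sub>R X))"
    using MVT2[of 0 h \<phi> "\<lambda>s. ?DX ((x + h *\<^sub>R Y) + s *\<^sub>R X) - ?DX (x + s *\<^sub>R X)"] h 1 by blast
  let ?\<psi> = "\<lambda>t. ?DX ((x + a *\<^sub>R X) + t *\<^sub>R Y)"
  have 2: "(?\<psi> has_real_derivative Der ?DX ((x + a *\<^sub>R X) + t *\<^sub>R Y) Y) (at t)"
    if "0 \<le> t" "t \<le> h" for t
    unfolding has_real_derivative_iff_has_vector_derivative
    using S[of a t] that a by (intro line_derivative[OF smooth_on_deriv[OF sm]]) auto
  obtain b where b: "0 < b" "b < h"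
    and b_eq: "?\<psi> h - ?\<psi> 0 = (h - 0) * Der ?DX ((x + a *\<^sub>R X) + b *\<^sub>R Y) Y"
    using MVT2[of 0 h ?\<psi> "\<lambda>t. Der ?DX ((x + a *\<^sub>R X) + t *\<^sub>R Y) Y"] h 2 by blast
  have "?DX ((x + h *\<^sub>R Y) + a *\<^sub>R X) - ?DX (x + a *\<^sub>R X) = ?\<psi> h - ?\<psi> 0"
    by (simp add: add_ac)
  then have "\<phi> h - \<phi> 0 = h * (h * Der ?DX ((x + a *\<^sub>R X) + b *\<^sub>R Y) Y)"
    using a_eq b_eq by simp
  moreover have "\<phi> h - \<phi> 0 =
      f (x + h *\<^sub>R X + h *\<^sub>R Y) - f (x + h *\<^sub>R X) - f (x + h *\<^sub>R Y) + f x"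
    by (simp add: \<phi>_def add_ac)
  ultimately show ?thesis using a b that[of a b] by (simp add: mult.assoc)
qed

lemma second_derivative_symmetric_real:
  fixes f :: "'a::real_normed_vector \<Rightarrow> real"
  assumes "open S" "smooth_on S f" "x \<in> S"
  shows "Der (\<lambda>y. Der f y X) x Y =
    Der (\<lambda>y. Der f y Y) x X"
proof (rule ccontr)
  define P where "P y = Der (\<lambda>y. Der f y X) y Y" for y
  define Q where "Q y = Der (\<lambda>y. Der f y Y) y X" for y
  assume "\<not> ?thesis"
  then have e: "\<bar>P x - Q x\<bar> / 2 > 0" (is "?e > 0") by (simp add: P_def Q_def)
  have "continuous_on S P" "continuous_on S Q"
    unfolding P_def Q_def by (intro smooth_on_continuous_on smooth_on_deriv assms)+
  then have "isCont P x" "isCont Q x"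
    using assms by (auto simp: continuous_on_eq_continuous_at)
  then obtain d1 d2 where d1: "d1 > 0" "\<And>y. dist y x < d1 \<Longrightarrow> dist (P y) (P x) < ?e"
    and d2: "d2 > 0" "\<And>y. dist y x < d2 \<Longrightarrow> dist (Q y) (Q x) < ?e"
    using e unfolding continuous_at_eps_delta dist_norm by (metis (no_types, lifting) e)
  obtain d3 where d3: "d3 > 0" "ball x d3 \<subseteq> S" using assms open_contains_ball by blast
  define d where "d = min d1 (min d2 d3)"
  define m where "m = norm X + norm Y + 1"
  define h where "h = d / (2 * m)"
  have pos: "m > 0" unfolding m_def by (smt (verit) norm_ge_zero)
  have dpos: "d > 0" using d1 d2 d3 by (simp add: d_def)
  have hpos: "h > 0" using dpos pos by (simp add: h_def)
  have close: "dist (x + s *\<^sub>R X + t *\<^sub>R Y) x < d" if "s \<in> {0..h}" "t \<in> {0..h}" for s t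
  proof -
    have "dist (x + s *\<^sub>R X + t *\<^sub>R Y) x \<le> s * norm X + t * norm Y"
      using that norm_triangle_ineq[of "s *\<^sub>R X" "t *\<^sub>R Y"] by (simp add: dist_norm add.assoc)
    also have "\<dots> \<le> h * norm X + h * norm Y"
      using that by (intro add_mono mult_right_mono) auto
    also have "\<dots> \<le> h * m" using hpos by (simp add: m_def algebra_simps)
    also have "\<dots> = d / 2" using pos by (simp add: h_def)
    also have "\<dots> < d" using dpos by simp
    finally show ?thesis .
  qed
  have inS: "x + s *\<^sub>R X + t *\<^sub>R Y \<in> S" if "s \<in> {0..h}" "t \<in> {0..h}" for s t
    using close[OF that] d3 by (auto simp: d_def dist_commute subset_iff)
  have inS': "x + s *\<^sub>R Y + t *\<^sub>R X \<in> S" if "s \<in> {0..h}" "t \<in> {0..h}" for s t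
    using inS[OF that(2,1)] by (simp add: add_ac)
  obtain a b where ab: "a \<in> {0<..<h}" "b \<in> {0<..<h}"
    "f (x + h *\<^sub>R X + h *\<^sub>R Y) - f (x + h *\<^sub>R X) - f (x + h *\<^sub>R Y) + f x =
      h * h * P (x + a *\<^sub>R X + b *\<^sub>R Y)"
    using mean_value_mixed[OF assms(2) hpos inS, folded P_def] by blast
  obtain b' a' where ab': "b' \<in> {0<..<h}" "a' \<in> {0<..<h}"
    "f (x + h *\<^sub>R Y + h *\<^sub>R X) - f (x + h *\<^sub>R Y) - f (x + h *\<^sub>R X) + f x =
      h * h * Q (x + b' *\<^sub>R Y + a' *\<^sub>R X)"
    using mean_value_mixed[OF assms(2) hpos inS', folded Q_def] by blast
  have "x + b' *\<^sub>R Y + a' *\<^sub>R X = x + a' *\<^sub>R X + b' *\<^sub>R Y"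
    "x + h *\<^sub>R Y + h *\<^sub>R X = x + h *\<^sub>R X + h *\<^sub>R Y" by (simp_all add: add_ac)
  note swap = this
  have "h * h * P (x + a *\<^sub>R X + b *\<^sub>R Y) = h * h * Q (x + a' *\<^sub>R X + b' *\<^sub>R Y)"
    using ab(3) ab'(3)[unfolded swap] by linarith
  then have "P (x + a *\<^sub>R X + b *\<^sub>R Y) = Q (x + a' *\<^sub>R X + b' *\<^sub>R Y)"
    using hpos by simp
  moreover have "dist (P (x + a *\<^sub>R X + b *\<^sub>R Y)) (P x) < ?e"
    using close[of a b] ab by (intro d1) (auto simp: d_def)
  moreover have "dist (Q (x + a' *\<^sub>R X + b' *\<^sub>R Y)) (Q x) < ?e"
    using close[of a' b'] ab' by (intro d2) (auto simp: d_def)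
  ultimately show False
    unfolding dist_real_def by (smt (verit) field_sum_of_halves)
qed

lemma second_derivative_symmetric:
  fixes f :: "'a::real_normed_vector \<Rightarrow> 'b::euclidean_space"
  assumes "open S" "smooth_on S f" "x \<in> S"
  shows "Der (\<lambda>y. Der f y X) x Y =
    Der (\<lambda>y. Der f y Y) x X"
proof (rule euclidean_eqI)
  fix b :: 'b
  have comp: "Der (\<lambda>y. Der (\<lambda>z. f z \<bullet> b) y U) x V =
      Der (\<lambda>y. Der f y U) x V \<bullet> b" for U V
  proof -
    have "Der (\<lambda>y. Der (\<lambda>z. f z \<bullet> b) y U) x =
        Der (\<lambda>y. Der f y U \<bullet> b) x"
      by (rule Der_cong[OF assms(1) _ _ assms(3)])
        (auto intro!: smooth_on_linear[OF assms(1) bounded_linear_inner_left] smooth_on_deriv assms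
          simp: Der_linear[OF bounded_linear_inner_left assms(2)])
    then show ?thesis
      by (simp add: Der_linear[OF bounded_linear_inner_left smooth_on_deriv[OF assms(2)] assms(3)])
  qed
  have "smooth_on S (\<lambda>z. f z \<bullet> b)"
    by (rule smooth_on_linear[OF assms(1) bounded_linear_inner_left assms(2)])
  from second_derivative_symmetric_real[OF assms(1) this assms(3)]
  show "Der (\<lambda>y. Der f y X) x Y \<bullet> b =
    Der (\<lambda>y. Der f y Y) x X \<bullet> b"
    by (simp add: comp)
qed

subsection \<open>Integral curves\<close>

lemma smooth_on_imp_lipschitz_on_cball:
  fixes F :: "'a::euclidean_space \<Rightarrow> 'b::real_normed_vector"
  assumes "smooth_on S F" "cball x0 r \<subseteq> S"
  obtains K where "K > 0" "\<And>x y. x \<in> cball x0 r \<Longrightarrow> y \<in> cball x0 r \<Longrightarrow> norm (F x - F y) \<le> K * norm (x - y)"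
proof -
  let ?k = "\<lambda>x. \<Sum>b\<in>Basis. norm (Der F x b)"
  have "continuous_on (cball x0 r) ?k"
    using continuous_on_subset[OF smooth_on_continuous_on[OF smooth_on_deriv[OF assms(1)]] assms(2)]
    by (intro continuous_intros)
  then have "bounded (?k ` cball x0 r)"
    by (intro compact_imp_bounded compact_continuous_image compact_cball)
  then obtain K where K: "K > 0" "\<And>x. x \<in> cball x0 r \<Longrightarrow> norm (?k x) \<le> K"
    by (auto simp: bounded_pos)
  have der: "(F has_derivative Der F x) (at x)" if "x \<in> cball x0 r" for x
    using smooth_on_has_derivative[OF assms(1)] assms(2) that by blast
  have "onorm (Der F x) \<le> K" if x: "x \<in> cball x0 r" for x
  proof (rule onorm_le)
    fix y
    have lin: "linear (Der F x)" using der[OF x] has_derivative_linear by blast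
    have "norm (Der F x y) =
        norm (\<Sum>b\<in>Basis. (y \<bullet> b) *\<^sub>R Der F x b)"
      by (simp add: linear_basis_expansion[OF lin, of y])
    also have "\<dots> \<le> (\<Sum>b\<in>Basis. norm y * norm (Der F x b))"
      by (rule sum_norm_le) (simp add: Basis_le_norm mult_right_mono)
    also have "\<dots> = ?k x * norm y" by (simp add: sum_distrib_left mult.commute)
    also have "\<dots> \<le> K * norm y" using K(2)[OF x] by (intro mult_right_mono) auto
    finally show "norm (Der F x y) \<le> K * norm y" .
  qed
  then have "norm (F x - F y) \<le> K * norm (x - y)" if "x \<in> cball x0 r" "y \<in> cball x0 r" for x y
    using der that by (intro differentiable_bound[of "cball x0 r" F "\<lambda>x. Der F x"])
      (auto intro: has_derivative_at_withinI)
  then show ?thesis using K(1) that by blast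
qed

text \<open>Local existence of integral curves. The vector field is composed with the nearest point
  projection onto a closed ball, which makes it globally Lipschitz and bounded, so that Picard's
  operator is a contraction of the whole space of bounded continuous functions.\<close>

lemma integral_curve_exists:
  fixes F :: "'a::euclidean_space \<Rightarrow> 'a"
  assumes "open S" "smooth_on S F" "x0 \<in> S"
  obtains d \<gamma> where "d > 0" "\<gamma> (0::real) = x0"
    "\<And>t. t \<in> {-d<..<d} \<Longrightarrow> \<gamma> t \<in> S \<and> (\<gamma> has_vector_derivative F (\<gamma> t)) (at t)"
proof -
  obtain r where r: "r > 0" "cball x0 r \<subseteq> S" using assms open_contains_cball by blast
  obtain K where K: "K > 0"
    "\<And>x y. x \<in> cball x0 r \<Longrightarrow> y \<in> cball x0 r \<Longrightarrow> norm (F x - F y) \<le> K * norm (x - y)"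
    using smooth_on_imp_lipschitz_on_cball[OF assms(2) r(2)] by blast
  define P where "P = closest_point (cball x0 r)"
  define G where "G x = F (P x)" for x
  have ne: "cball x0 r \<noteq> {}" using r(1) by simp
  have P_in: "P x \<in> cball x0 r" for x
    unfolding P_def by (rule closest_point_in_set[OF closed_cball ne])
  have P_lip: "norm (P x - P y) \<le> norm (x - y)" for x y
    using closest_point_lipschitz[OF convex_cball closed_cball ne] by (simp add: P_def dist_norm)
  have G_lip: "norm (G x - G y) \<le> K * norm (x - y)" for x y
    using K(2)[OF P_in P_in, of x y] P_lip[of x y] K(1)
    by (smt (verit, best) G_def mult_left_mono)
  have G_cont: "continuous_on UNIV G"
  proof (rule continuous_on_iff[THEN iffD2], intro ballI allI impI)
    fix x and e :: real assume "e > 0"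
    then show "\<exists>d>0. \<forall>x'\<in>UNIV. dist x' x < d \<longrightarrow> dist (G x') (G x) < e"
      using K(1) G_lip by (intro exI[of _ "e / K"])
        (auto simp: dist_norm pos_less_divide_eq mult.commute intro: le_less_trans)
  qed
  have "compact (F ` cball x0 r)"
    by (intro compact_continuous_image compact_cball
        continuous_on_subset[OF smooth_on_continuous_on[OF assms(2)] r(2)])
  then obtain M where M: "M > 0" "\<And>x. x \<in> cball x0 r \<Longrightarrow> norm (F x) \<le> M"
    using compact_imp_bounded bounded_pos by (metis imageI)
  have G_bound: "norm (G x) \<le> M" for x using M(2) P_in by (simp add: G_def)
  \<comment> \<open>The operator takes the difference of two integrals, over intervals of lengths at most \<open>2d\<close> and
    \<open>d\<close>; the factor 3 below is their sum.\<close>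
  define d where "d = min (r / (3 * M)) (1 / (6 * K))"
  have d: "d > 0" "3 * d * M \<le> r" "3 * d * K \<le> 1 / 2"
  proof -
    show "d > 0" using r M K by (simp add: d_def)
    have "d \<le> r / (3 * M)" "d \<le> 1 / (6 * K)" by (simp_all add: d_def)
    then show "3 * d * M \<le> r" "3 * d * K \<le> 1 / 2" using M(1) K(1) by (simp_all add: field_simps)
  qed
  define c where "c t = max (-d) (min d t)" for t
  have c: "c t \<in> {-d..d}" for t using d(1) by (auto simp: c_def)
  have c_cont: "continuous_on UNIV c" unfolding c_def by (intro continuous_intros)
  have z: "0 \<in> {-d..d}" using d(1) by simp
  \<comment> \<open>Integrals start at \<open>-d\<close> so that no orientation is needed for negative times.\<close>
  define In where "In w t = integral {-d..t} w" for w :: "real \<Rightarrow> 'a" and t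
  define \<Phi> where "\<Phi> w t = x0 + (In (\<lambda>s. G (w s)) (c t) - In (\<lambda>s. G (w s)) 0)" for w t
  have In_bound: "norm (In w t - In w 0) \<le> 3 * d * b"
    if "continuous_on UNIV w" "\<And>s. norm (w s) \<le> b" "t \<in> {-d..d}" for w t b
  proof -
    have *: "norm (In w s) \<le> b * (s + d)" if "s \<in> {-d..d}" for s
      using integral_bound[of "-d" s w b] that \<open>continuous_on UNIV w\<close> \<open>\<And>s. norm (w s) \<le> b\<close>
      by (auto simp: In_def intro: continuous_on_subset)
    have "b \<ge> 0" using that(2)[of 0] norm_ge_zero order_trans by blast
    have "norm (In w t - In w 0) \<le> b * (t + d) + b * (0 + d)"
      using *[OF that(3)] *[OF z] norm_triangle_ineq4[of "In w t" "In w 0"] by linarith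
    also have "\<dots> \<le> b * (2 * d) + b * (0 + d)"
      using that(3) \<open>b \<ge> 0\<close> by (intro add_mono mult_left_mono) auto
    finally show ?thesis by (simp add: algebra_simps)
  qed
  have Gw_cont: "continuous_on UNIV (\<lambda>s. G (w s))" if "continuous_on UNIV w" for w
    using continuous_on_compose2[OF G_cont that] by simp
  have \<Phi>_bound: "norm (\<Phi> w t - x0) \<le> r" if "continuous_on UNIV w" for w t
    using In_bound[OF Gw_cont[OF that], of M "c t"] G_bound c d(2) by (auto simp: \<Phi>_def)
  have \<Phi>_bcont: "\<Phi> w \<in> bcontfun" if w: "continuous_on UNIV w" for w
  proof (rule bcontfun_normI)
    have "continuous_on {-d..d} (In (\<lambda>s. G (w s)))"
      unfolding In_def
      by (intro indefinite_integral_continuous_1 integrable_continuous_real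
          continuous_on_subset[OF Gw_cont[OF w]]) auto
    then have "continuous_on UNIV (\<lambda>t. In (\<lambda>s. G (w s)) (c t))"
      by (rule continuous_on_compose2) (use c c_cont in auto)
    then show "continuous_on UNIV (\<Phi> w)" unfolding \<Phi>_def by (intro continuous_intros)
    show "norm (\<Phi> w t) \<le> r + norm x0" for t
      using \<Phi>_bound[OF w, of t] norm_triangle_sub[of "\<Phi> w t" x0] by linarith
  qed
  define \<Psi> where "\<Psi> w = Bcontfun (\<Phi> (apply_bcontfun w))" for w :: "real \<Rightarrow>\<^sub>C 'a"
  have \<Psi>: "apply_bcontfun (\<Psi> w) = \<Phi> (apply_bcontfun w)" for w
    unfolding \<Psi>_def by (rule Bcontfun_inverse) (simp add: \<Phi>_bcont)
  have "dist (\<Psi> w1) (\<Psi> w2) \<le> 1 / 2 * dist w1 w2" for w1 w2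
  proof (rule dist_bound)
    fix t
    let ?w1 = "\<lambda>s. G (apply_bcontfun w1 s)" and ?w2 = "\<lambda>s. G (apply_bcontfun w2 s)"
    have cont: "continuous_on UNIV ?w1" "continuous_on UNIV ?w2" by (simp_all add: Gw_cont)
    have In_diff: "In ?w1 s - In ?w2 s = In (\<lambda>s. ?w1 s - ?w2 s) s" for s
      unfolding In_def
      by (rule Henstock_Kurzweil_Integration.integral_diff[symmetric])
        (auto intro!: integrable_continuous_real intro: continuous_on_subset[OF cont(1)] continuous_on_subset[OF cont(2)])
    have "dist (\<Psi> w1 t) (\<Psi> w2 t) =
        norm (In (\<lambda>s. ?w1 s - ?w2 s) (c t) - In (\<lambda>s. ?w1 s - ?w2 s) 0)"
      by (simp add: \<Psi> \<Phi>_def dist_norm In_diff[symmetric] algebra_simps)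
    also have "\<dots> \<le> 3 * d * (K * dist w1 w2)"
    proof (rule In_bound[OF _ _ c])
      show "continuous_on UNIV (\<lambda>s. ?w1 s - ?w2 s)" using cont by (intro continuous_intros)
      show "norm (?w1 s - ?w2 s) \<le> K * dist w1 w2" for s
        using G_lip[of "w1 s" "w2 s"] dist_bounded[of w1 s w2] K(1)
        by (smt (verit, best) dist_norm mult_left_mono)
    qed
    also have "\<dots> \<le> 1 / 2 * dist w1 w2"
      using mult_right_mono[OF d(3), of "dist w1 w2"] by (simp add: mult.assoc)
    finally show "dist (\<Psi> w1 t) (\<Psi> w2 t) \<le> 1 / 2 * dist w1 w2" .
  qed
  then obtain w where w: "\<Psi> w = w"
    using banach_fix_type[of "1/2" \<Psi>] by auto
  define \<gamma> where "\<gamma> = apply_bcontfun w"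
  have \<gamma>: "\<gamma> t = \<Phi> \<gamma> t" for t using \<Psi>[of w] by (simp add: w \<gamma>_def)
  have \<gamma>_cont: "continuous_on UNIV \<gamma>" by (simp add: \<gamma>_def)
  have \<gamma>_in: "\<gamma> t \<in> cball x0 r" for t
    using \<Phi>_bound[OF \<gamma>_cont, of t] by (simp add: \<gamma>[symmetric] dist_norm norm_minus_commute)
  have "(\<gamma> has_vector_derivative F (\<gamma> t)) (at t)" if t: "t \<in> {-d<..<d}" for t
  proof -
    have "(In (\<lambda>s. G (\<gamma> s)) has_vector_derivative G (\<gamma> t)) (at t within {-d..d})"
      unfolding In_def
      by (rule integral_has_vector_derivative) (use t continuous_on_subset[OF Gw_cont[OF \<gamma>_cont]] in auto)
    moreover have "at t within {-d..d} = at t" by (rule at_within_interior) (use t in auto)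
    ultimately have "((\<lambda>t. x0 + (In (\<lambda>s. G (\<gamma> s)) t - In (\<lambda>s. G (\<gamma> s)) 0))
        has_vector_derivative G (\<gamma> t)) (at t)"
      by (auto intro!: derivative_eq_intros)
    moreover have "x0 + (In (\<lambda>s. G (\<gamma> s)) u - In (\<lambda>s. G (\<gamma> s)) 0) = \<gamma> u" if "u \<in> {-d<..<d}" for u
      using that \<gamma>[of u] by (simp add: \<Phi>_def c_def)
    ultimately have "(\<gamma> has_vector_derivative G (\<gamma> t)) (at t)"
      using has_vector_derivative_transform_within_open[OF _ open_greaterThanLessThan t] by blast
    then show ?thesis
      using \<gamma>_in[of t] by (simp add: G_def P_def closest_point_self)
  qed
  moreover have "\<gamma> 0 = x0" using \<gamma>[of 0] d(1) by (simp add: \<Phi>_def c_def)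
  moreover have "\<gamma> t \<in> S" for t using \<gamma>_in r(2) by blast
  ultimately show ?thesis using that[of d \<gamma>] d(1) by simp
qed

subsection \<open>Inverse functions\<close>

lemma open_real_prod_contains_box:
  fixes V :: "(real \<times> real) set"
  assumes "open V" "(s, t) \<in> V"
  obtains I J where "open_interval I" "open_interval J" "s \<in> I" "t \<in> J" "I \<times> J \<subseteq> V"
proof -
  obtain A B where AB: "open A" "open B" "(s, t) \<in> A \<times> B" "A \<times> B \<subseteq> V"
    using assms by (rule open_prod_elim)
  obtain e1 where e1: "e1 > 0" "ball s e1 \<subseteq> A" using AB open_contains_ball by blast
  obtain e2 where e2: "e2 > 0" "ball t e2 \<subseteq> B" using AB open_contains_ball by blast
  show ?thesis
    by (rule that[of "ball s e1" "ball t e2"])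
      (use e1 e2 AB in \<open>auto simp: open_interval_def is_interval_ball_real\<close>)
qed

text \<open>Two functions with independent differentials are local coordinates: the inverse is as smooth
  as they are because its derivative is given by Cramer's rule.\<close>

lemma local_coordinates:
  fixes a b :: "real \<times> real \<Rightarrow> real"
  assumes W: "open W" and sm: "smooth_on W a" "smooth_on W b" and q: "q \<in> W"
    and det: "Der a q (1, 0) * Der b q (0, 1) -
      Der a q (0, 1) * Der b q (1, 0) \<noteq> 0"
  obtains I J h where "open_interval I" "open_interval J" "a q \<in> I" "b q \<in> J"
    "smooth_on (I \<times> J) h" "h ` (I \<times> J) \<subseteq> W" "open (h ` (I \<times> J))" "h (a q, b q) = q"
    "\<And>s t. s \<in> I \<Longrightarrow> t \<in> J \<Longrightarrow> a (h (s, t)) = s"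
    "\<And>s t. s \<in> I \<Longrightarrow> t \<in> J \<Longrightarrow> b (h (s, t)) = t"
proof -
  define a1 where "a1 x = Der a x (1, 0)" for x
  define a2 where "a2 x = Der a x (0, 1)" for x
  define b1 where "b1 x = Der b x (1, 0)" for x
  define b2 where "b2 x = Der b x (0, 1)" for x
  define D where "D x = a1 x * b2 x - a2 x * b1 x" for x
  define W1 where "W1 = W \<inter> D -` (- {0})"
  have sm1: "smooth_on W a1" "smooth_on W a2" "smooth_on W b1" "smooth_on W b2"
    unfolding a1_def a2_def b1_def b2_def by (intro smooth_on_deriv sm)+
  have smD: "smooth_on W D" unfolding D_def by (intro smooth_on_diff smooth_on_mult W sm1)
  have W1: "open W1" unfolding W1_def by (rule smooth_on_open_vimage[OF W smD]) (simp add: open_Compl)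
  have qW1: "q \<in> W1" using q det by (simp add: W1_def D_def a1_def a2_def b1_def b2_def)
  have smW1: "smooth_on W1 g" if "smooth_on W g" for g :: "real \<times> real \<Rightarrow> real"
    using that by (rule smooth_on_subset) (auto simp: W1_def)
  define f where "f x = (a x, b x)" for x
  define f' where "f' x = Blinfun (\<lambda>X. (a1 x * fst X + a2 x * snd X, b1 x * fst X + b2 x * snd X))" for x
  define f'' where "f'' x = Blinfun (\<lambda>Y. ((b2 x * fst Y - a2 x * snd Y) / D x, (a1 x * snd Y - b1 x * fst Y) / D x))" for x
  have f': "blinfun_apply (f' x) = (\<lambda>X. (a1 x * fst X + a2 x * snd X, b1 x * fst X + b2 x * snd X))" for x
  proof -
    have "linear (\<lambda>X. (a1 x * fst X + a2 x * snd X, b1 x * fst X + b2 x * snd X))"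
      by (rule linearI) (auto simp: algebra_simps)
    then show ?thesis
      unfolding f'_def by (intro bounded_linear_Blinfun_apply) (simp add: linear_conv_bounded_linear)
  qed
  have f'': "blinfun_apply (f'' x) =
      (\<lambda>Y. ((b2 x * fst Y - a2 x * snd Y) / D x, (a1 x * snd Y - b1 x * fst Y) / D x))" for x
  proof -
    have "linear (\<lambda>Y. ((b2 x * fst Y - a2 x * snd Y) / D x, (a1 x * snd Y - b1 x * fst Y) / D x))"
      by (rule linearI) (auto simp: algebra_simps add_divide_distrib diff_divide_distrib)
    then show ?thesis
      unfolding f''_def by (intro bounded_linear_Blinfun_apply) (simp add: linear_conv_bounded_linear)
  qed
  have derf: "(f has_derivative blinfun_apply (f' x)) (at x)" if "x \<in> W1" for x
  proof -
    have x: "x \<in> W" using that by (simp add: W1_def)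
    have "(f has_derivative (\<lambda>X. (Der a x X, Der b x X))) (at x)"
      unfolding f_def by (intro has_derivative_Pair smooth_on_has_derivative[OF sm(1) x]
          smooth_on_has_derivative[OF sm(2) x])
    moreover have "(\<lambda>X. (Der a x X, Der b x X)) = blinfun_apply (f' x)"
    proof
      fix X show "(Der a x X, Der b x X) = blinfun_apply (f' x) X"
        using linear_plane_expand[OF smooth_on_linear_deriv[OF sm(1) x], of X]
          linear_plane_expand[OF smooth_on_linear_deriv[OF sm(2) x], of X]
        by (simp add: f' a1_def a2_def b1_def b2_def mult.commute)
    qed
    ultimately show ?thesis by simp
  qed
  have contf: "continuous_on W1 f'"
    by (rule continuous_on_blinfun_componentwise)
      (unfold f', intro continuous_intros smooth_on_continuous_on smW1 sm1)
  have inv: "f'' x o\<^sub>L f' x = id_blinfun" if "x \<in> W1" for x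
  proof (rule blinfun_eqI)
    fix X
    have "D x \<noteq> 0" using that by (simp add: W1_def)
    then show "blinfun_apply (f'' x o\<^sub>L f' x) X = blinfun_apply id_blinfun X"
      by (simp add: f' f'' prod_eq_iff field_simps) (simp add: D_def algebra_simps)
  qed
  have inv': "blinfun_apply (f' x) (blinfun_apply (f'' x) Y) = Y" if "x \<in> W1" for x Y
  proof -
    have "D x \<noteq> 0" using that by (simp add: W1_def)
    then show ?thesis
      by (simp add: f' f'' prod_eq_iff field_simps) (simp add: D_def algebra_simps)
  qed
  \<comment> \<open>\<open>f''\<close> is the inverse of the Jacobian \<open>f'\<close>.\<close>
  obtain U' V g g' where U': "open U'" "U' \<subseteq> W1" "q \<in> U'" and V: "open V" "f q \<in> V"
    and hom: "homeomorphism U' V f g"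
    and derg: "\<And>y. y \<in> V \<Longrightarrow> (g has_derivative (g' y)) (at y)"
    and g': "\<And>y. y \<in> V \<Longrightarrow> g' y = Hilbert_Choice.inv (blinfun_apply (f' (g y)))"
    and bij: "\<And>y. y \<in> V \<Longrightarrow> bij (blinfun_apply (f' (g y)))"
    using inverse_function_theorem[OF W1 derf contf qW1 inv[OF qW1]] by blast
  have gV: "g y \<in> U'" "f (g y) = y" if "y \<in> V" for y
    using hom that by (auto simp: homeomorphism_def)
  have gU: "g (f x) = x" if "x \<in> U'" for x
    using hom that by (auto simp: homeomorphism_def)
  have gW1: "g ` V \<subseteq> W1" using gV U'(2) by auto
  have derg': "(g has_derivative blinfun_apply (f'' (g y))) (at y)" if "y \<in> V" for y
  proof -
    have "g' y Y = blinfun_apply (f'' (g y)) Y" for Y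
    proof -
      have "g y \<in> W1" using gW1 that by auto
      from inv'[OF this, of Y] show ?thesis
        unfolding g'[OF that] using bij[OF that] by (intro inv_f_eq) (auto simp: bij_def)
    qed
    then have "g' y = blinfun_apply (f'' (g y))" by (rule ext)
    then show ?thesis using derg[OF that] by simp
  qed
  have "smooth_on W1 (\<lambda>x. blinfun_apply (f'' x) Y)" for Y
    unfolding f'' divide_inverse
    by (intro smooth_on_Pair smooth_on_mult smooth_on_diff smooth_on_inverse smooth_on_const W1 smW1 sm1 smD)
      (simp_all add: W1_def)
  then have smf'': "Ck_on k W1 (\<lambda>x. blinfun_apply (f'' x) Y)" for k Y by (simp add: smooth_on_def)
  have smg: "Ck_on k V g" for k
  proof (induction k)
    case 0
    then show ?case using hom by (simp add: homeomorphism_def)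
  next
    case (Suc k)
    show ?case
      by (rule Ck_on_SucI[OF V(1) derg'])
        (auto intro!: Ck_on_compose[OF V(1) W1 gW1 Suc smf''])
  qed
  obtain I J where IJ: "open_interval I" "open_interval J" "a q \<in> I" "b q \<in> J" "I \<times> J \<subseteq> V"
    using open_real_prod_contains_box[OF V(1), of "a q" "b q"] V(2) by (auto simp: f_def)
  have smh: "smooth_on (I \<times> J) g" using smg IJ(5) by (auto simp: smooth_on_def intro: Ck_on_subset)
  have im: "g ` (I \<times> J) = U' \<inter> f -` (I \<times> J)"
  proof (intro equalityI subsetI)
    fix x assume "x \<in> g ` (I \<times> J)"
    then obtain y where y: "x = g y" "y \<in> I \<times> J" by blast
    then have "y \<in> V" using IJ(5) by blast
    then show "x \<in> U' \<inter> f -` (I \<times> J)" using gV[of y] y by simp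
  next
    fix x assume "x \<in> U' \<inter> f -` (I \<times> J)"
    then show "x \<in> g ` (I \<times> J)" using gU[of x] by (metis IntD1 IntD2 image_eqI vimageD)
  qed
  have "continuous_on U' f" using hom by (simp add: homeomorphism_def)
  moreover have "open (I \<times> J)" using IJ by (auto simp: open_interval_def open_Times)
  ultimately have op: "open (g ` (I \<times> J))"
    unfolding im using continuous_on_open_vimage[OF U'(1)] by (metis Int_commute)
  have comp: "a (g (s, t)) = s" "b (g (s, t)) = t" if "s \<in> I" "t \<in> J" for s t
    using gV(2)[of "(s, t)"] that IJ(5) by (auto simp: f_def)
  show ?thesis
  proof (rule that[OF IJ(1-4) smh _ op])
    show "g ` (I \<times> J) \<subseteq> W" using gW1 IJ(5) by (auto simp: W1_def)
    show "g (a q, b q) = q" using gU[OF U'(3)] by (simp add: f_def)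
  qed (use comp in auto)
qed

lemma constant_on_open_interval:
  fixes g :: "real \<Rightarrow> 'b::real_normed_vector"
  assumes "open_interval J" "\<And>t. t \<in> J \<Longrightarrow> (g has_vector_derivative 0) (at t)" "s \<in> J" "t \<in> J"
  shows "g s = g t"
proof -
  have "convex J" using assms(1) by (simp add: open_interval_def is_interval_convex_1)
  then obtain c where "\<And>x. x \<in> J \<Longrightarrow> g x = c"
    using assms(2) has_vector_derivative_at_within by (metis has_vector_derivative_zero_constant)
  then show ?thesis using assms(3,4) by simp
qed

lemma partial_has_vector_derivative:
  assumes "smooth_on S f" "(s, t) \<in> S"
  shows "((\<lambda>r. f (r, t)) has_vector_derivative Der f (s, t) (1, 0)) (at s)"
    "((\<lambda>r. f (s, r)) has_vector_derivative Der f (s, t) (0, 1)) (at t)"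
proof -
  have "((\<lambda>r. (r, t)) has_vector_derivative (1, 0)) (at s)" "((\<lambda>r. (s, r)) has_vector_derivative (0, 1)) (at t)"
    by (auto intro!: has_vector_derivative_Pair has_vector_derivative_const has_vector_derivative_id)
  then show "((\<lambda>r. f (r, t)) has_vector_derivative Der f (s, t) (1, 0)) (at s)"
    "((\<lambda>r. f (s, r)) has_vector_derivative Der f (s, t) (0, 1)) (at t)"
    using has_vector_derivative_chain[OF assms(1), where \<gamma> = "\<lambda>r. (r, t)"]
      has_vector_derivative_chain[OF assms(1), where \<gamma> = "\<lambda>r. (s, r)"] assms(2) by auto
qed

text \<open>A map whose differential vanishes where that of \<open>\<phi>\<close> does is locally a function of \<open>\<phi>\<close>.\<close>

lemma factor_through:
  fixes \<phi> :: "real \<times> real \<Rightarrow> real" and e :: "real \<times> real \<Rightarrow> 'b::real_normed_vector"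
  assumes W: "open W" and sm: "smooth_on W \<phi>" "smooth_on W e" and q: "q \<in> W"
    and ker: "\<And>x X. x \<in> W \<Longrightarrow> Der \<phi> x X = 0 \<Longrightarrow> Der e x X = 0"
    and nz: "Der \<phi> q X0 \<noteq> 0"
  obtains W' J e' where "open W'" "q \<in> W'" "W' \<subseteq> W" "open_interval J" "\<phi> ` W' = J"
    "smooth_on J e'" "\<And>x. x \<in> W' \<Longrightarrow> e x = e' (\<phi> x)"
proof -
  let ?D = "Der \<phi> q"
  have lin: "linear ?D" by (rule smooth_on_linear_deriv[OF sm(1) q])
  have or: "?D (1, 0) \<noteq> 0 \<or> ?D (0, 1) \<noteq> 0" using nz linear_plane_expand[OF lin, of X0] by auto
  \<comment> \<open>A linear coordinate \<open>w\<close> that completes \<open>\<phi>\<close> to local coordinates; \<open>e\<close> is constant along the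
    \<open>w\<close>-lines.\<close>
  have "\<exists>w :: real \<times> real \<Rightarrow> real. bounded_linear w \<and> w (1, 0) * ?D (0, 1) - w (0, 1) * ?D (1, 0) \<noteq> 0"
  proof (cases "?D (1, 0) = 0")
    case True
    then show ?thesis using or by (intro exI[of _ fst]) (auto intro: bounded_linear_fst)
  next
    case False
    then show ?thesis by (intro exI[of _ snd]) (auto intro: bounded_linear_snd)
  qed
  then obtain w :: "real \<times> real \<Rightarrow> real" where w: "bounded_linear w"
    "w (1, 0) * ?D (0, 1) - w (0, 1) * ?D (1, 0) \<noteq> 0" by blast
  have smw: "smooth_on W w" by (rule smooth_on_bounded_linear[OF W w(1)])
  have Dw: "Der w q = w"
    by (rule frechet_derivative_at[symmetric]) (rule bounded_linear_imp_has_derivative[OF w(1)])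
  obtain I J h where IJ: "open_interval I" "open_interval J" "w q \<in> I" "\<phi> q \<in> J"
    and h: "smooth_on (I \<times> J) h" "h ` (I \<times> J) \<subseteq> W" "open (h ` (I \<times> J))" "h (w q, \<phi> q) = q"
    and hw: "\<And>s t. s \<in> I \<Longrightarrow> t \<in> J \<Longrightarrow> w (h (s, t)) = s"
    and h\<phi>: "\<And>s t. s \<in> I \<Longrightarrow> t \<in> J \<Longrightarrow> \<phi> (h (s, t)) = t"
    using local_coordinates[OF W smw sm(1) q] w(2) Dw by metis
  have op: "open I" "open J" "open (I \<times> J)" using IJ by (auto simp: open_interval_def open_Times)
  define e' where "e' t = e (h (w q, t))" for t
  have "smooth_on J (\<lambda>t. (w q, t))"
    by (intro smooth_on_Pair smooth_on_const op smooth_on_bounded_linear bounded_linear_ident)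
  then have "smooth_on J (\<lambda>t. h (w q, t))"
    by (rule smooth_on_compose[OF op(2,3) _ h(1)]) (use IJ(3) in auto)
  then have sme': "smooth_on J e'"
    unfolding e'_def by (rule smooth_on_compose[OF op(2) W _ sm(2)]) (use h(2) IJ(3) in auto)
  have eq: "e (h (s, t)) = e' t" if st: "s \<in> I" "t \<in> J" for s t
    unfolding e'_def
  proof (rule constant_on_open_interval[OF IJ(1) _ st(1) IJ(3)])
    fix r assume r: "r \<in> I"
    let ?X = "Der h (r, t) (1, 0)"
    have hW: "h (r, t) \<in> W" using h(2) r st(2) by auto
    have dh: "((\<lambda>r. h (r, t)) has_vector_derivative ?X) (at r)"
      by (rule partial_has_vector_derivative[OF h(1)]) (use r st in auto)
    have "((\<lambda>r. \<phi> (h (r, t))) has_vector_derivative Der \<phi> (h (r, t)) ?X) (at r)"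
      by (rule has_vector_derivative_chain[OF sm(1) hW dh])
    moreover have "((\<lambda>r. \<phi> (h (r, t))) has_vector_derivative 0) (at r)"
      by (rule has_vector_derivative_const_on[OF op(1) r, of _ t])
        (simp add: h\<phi> st)
    ultimately have "Der \<phi> (h (r, t)) ?X = 0"
      by (rule vector_derivative_unique_at)
    then have "Der e (h (r, t)) ?X = 0" by (rule ker[OF hW])
    then show "((\<lambda>r. e (h (r, t))) has_vector_derivative 0) (at r)"
      using has_vector_derivative_chain[OF sm(2) hW dh] by simp
  qed
  show ?thesis
  proof (rule that[of "h ` (I \<times> J)" J e'])
    show "q \<in> h ` (I \<times> J)" using h(4) IJ(3,4) by (metis SigmaI image_eqI)
    show "\<phi> ` h ` (I \<times> J) = J" using h\<phi> IJ(3) by force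
    show "e x = e' (\<phi> x)" if "x \<in> h ` (I \<times> J)" for x
      using that eq h\<phi> by auto
  qed (use h IJ sme' in auto)
qed

section \<open>The linear algebra of the form of signature (4,2)\<close>

lemma exhaust_6: "(i::6) = 1 \<or> i = 2 \<or> i = 3 \<or> i = 4 \<or> i = 5 \<or> i = 6"
proof (induct i)
  case (of_int z)
  then have "z = 0 \<or> z = 1 \<or> z = 2 \<or> z = 3 \<or> z = 4 \<or> z = 5" by fastforce
  then show ?case by auto
qed

lemma forall_6: "(\<forall>i::6. P i) \<longleftrightarrow> P 1 \<and> P 2 \<and> P 3 \<and> P 4 \<and> P 5 \<and> P 6"
  by (metis exhaust_6)

lemma UNIV_6: "UNIV = {1, 2, 3, 4, 5, 6 :: 6}"
  using exhaust_6 by auto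

lemma sum_6: "sum f (UNIV :: 6 set) = f 1 + f 2 + f 3 + f 4 + f 5 + f 6"
  unfolding UNIV_6 by (simp add: add.assoc)

interpretation lip: bounded_bilinear lip
  by (rule bilinear_conv_bounded_bilinear[THEN iffD1])
    (auto simp: bilinear_def lip_def algebra_simps intro!: linearI)

lemma lip_commute: "lip x y = lip y x"
  by (simp add: lip_def mult.commute)

lemma lip_nondegenerate: "(\<And>y. lip x y = 0) \<Longrightarrow> x = 0"
proof -
  assume 0: "\<And>y. lip x y = 0"
  have "x $ 1 = 0" using 0[of "axis 1 1"] by (simp add: lip_def axis_def)
  moreover have "x $ 2 = 0" using 0[of "axis 2 1"] by (simp add: lip_def axis_def)
  moreover have "x $ 3 = 0" using 0[of "axis 3 1"] by (simp add: lip_def axis_def)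
  moreover have "x $ 4 = 0" using 0[of "axis 4 1"] by (simp add: lip_def axis_def)
  moreover have "x $ 5 = 0" using 0[of "axis 5 1"] by (simp add: lip_def axis_def)
  moreover have "x $ 6 = 0" using 0[of "axis 6 1"] by (simp add: lip_def axis_def)
  ultimately show "x = 0" by (simp add: vec_eq_iff forall_6)
qed

text \<open>The diagonal of the Gram matrix of \<open>lip\<close> in the standard basis.\<close>

definition lip_sign :: "6 \<Rightarrow> real" where
  "lip_sign i = (if i = 5 \<or> i = 6 then -1 else 1)"

text \<open>The adjoint with respect to \<open>lip\<close>. It is the inverse on \<open>O42\<close> and depends linearly on the
  matrix, so that inversion is a smooth operation on \<open>O42\<close>.\<close>

definition lip_adjoint :: "real^6^6 \<Rightarrow> real^6^6" where
  "lip_adjoint A = (\<chi> i j. lip_sign i * lip_sign j * A $ j $ i)"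

lemma bounded_linear_lip_adjoint: "bounded_linear lip_adjoint"
  by (simp add: linear_conv_bounded_linear[symmetric] lip_adjoint_def linearI vec_eq_iff algebra_simps)

lemma lip_adjoint: "lip (A *v x) y = lip x (lip_adjoint A *v y)"
  by (simp add: lip_def lip_adjoint_def lip_sign_def matrix_vector_mult_def sum_6 algebra_simps)

lemma O42_lip: "A \<in> O42 \<Longrightarrow> lip (A *v x) (A *v y) = lip x y"
  by (simp add: O42_def)

lemma lip_adjoint_inverse:
  assumes "A \<in> O42"
  shows "lip_adjoint A ** A = mat 1" "A ** lip_adjoint A = mat 1"
proof -
  have "lip_adjoint A *v (A *v y) = y" for y
  proof -
    have "lip (lip_adjoint A *v (A *v y) - y) x = 0" for x
      using O42_lip[OF assms, of x y] lip_adjoint[of A x "A *v y"]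
      by (simp add: lip.diff_right lip_commute[of _ x])
    from lip_nondegenerate[OF this] show ?thesis by simp
  qed
  then show 1: "lip_adjoint A ** A = mat 1"
    by (simp add: matrix_eq matrix_vector_mul_assoc[symmetric])
  then show "A ** lip_adjoint A = mat 1" by (simp add: matrix_left_right_inverse)
qed

lemma O42_matrix_inv:
  assumes "A \<in> O42"
  shows "matrix_inv A = lip_adjoint A"
proof -
  have "\<exists>B. A ** B = mat 1 \<and> B ** A = mat 1" using lip_adjoint_inverse[OF assms] by blast
  then have "A ** matrix_inv A = mat 1" "matrix_inv A ** A = mat 1"
    unfolding matrix_inv_def by (metis (mono_tags, lifting) someI_ex)+
  then show ?thesis
    using lip_adjoint_inverse[OF assms] by (metis matrix_mul_assoc matrix_mul_lid matrix_mul_rid)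
qed

lemma O42_inv_mult:
  assumes "A \<in> O42"
  shows "A *v (matrix_inv A *v x) = x" "matrix_inv A *v (A *v x) = x"
  using lip_adjoint_inverse[OF assms]
  by (simp_all add: O42_matrix_inv[OF assms] matrix_vector_mul_assoc)

lemma O42_inv_in:
  assumes "A \<in> O42" shows "matrix_inv A \<in> O42"
proof -
  have "lip (matrix_inv A *v x) (matrix_inv A *v y) = lip x y" for x y
    using O42_lip[OF assms, of "matrix_inv A *v x" "matrix_inv A *v y"]
    by (simp add: O42_inv_mult[OF assms])
  then show ?thesis by (simp add: O42_def)
qed

lemma O42_inj: "A \<in> O42 \<Longrightarrow> A *v x = 0 \<Longrightarrow> x = 0"
  by (metis O42_inv_mult(2) matrix_vector_mult_0_right)

lemma O42_adjoint_in: "A \<in> O42 \<Longrightarrow> lip_adjoint A \<in> O42"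
  using O42_inv_in O42_matrix_inv by metis

lemma lip_adjoint_lip_adjoint: "lip_adjoint (lip_adjoint A) = A"
  by (simp add: lip_adjoint_def lip_sign_def vec_eq_iff forall_6)

interpretation mv: bounded_bilinear "(*v) :: real^6^6 \<Rightarrow> real^6 \<Rightarrow> real^6"
  by (rule bilinear_conv_bounded_bilinear[THEN iffD1])
    (auto simp: bilinear_def matrix_vector_right_distrib matrix_vector_mult_add_rdistrib
      scaleR_matrix_vector_assoc[symmetric] matrix_vector_mult_scaleR intro!: linearI)

lemma subspace_perp: "subspace (perp F)"
  by (auto simp: subspace_def perp_def lip.add_left lip.scaleR_left lip.zero_left)

lemma perpD: "x \<in> perp F \<Longrightarrow> y \<in> F \<Longrightarrow> lip x y = 0"
  by (simp add: perp_def)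

lemma perp_span: "x \<in> perp (span {y}) \<longleftrightarrow> lip x y = 0"
  by (auto simp: perp_def span_singleton lip.scaleR_right)

lemma dim_perp:
  assumes "subspace F" shows "dim (perp F) + dim F = 6"
proof -
  define G :: "R42 \<Rightarrow> R42" where "G x = (\<chi> i. lip_sign i * x $ i)" for x
  have lin: "linear G" by (rule linearI) (auto simp: G_def vec_eq_iff algebra_simps)
  have "inj G" by (auto simp: inj_def G_def vec_eq_iff lip_sign_def split: if_splits)
  then have "dim (G ` F) = dim F" using dim_image_eq[OF lin] inj_on_subset by blast
  moreover have "perp F = {y \<in> UNIV. \<forall>x \<in> G ` F. orthogonal x y}"
    by (auto simp: perp_def orthogonal_def G_def lip_def inner_vec_def sum_6 lip_sign_def algebra_simps)
  moreover have "subspace (G ` F)" using assms lin by (simp add: linear_subspace_image)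
  ultimately show ?thesis
    using dim_subspace_orthogonal_to_vectors[of "G ` F" UNIV] by (simp add: dim_UNIV)
qed

subsection \<open>Isotropic planes\<close>

lemma isotropicD:
  assumes "F \<in> isotropic_planes"
  shows "subspace F" "dim F = 2" "x \<in> F \<Longrightarrow> y \<in> F \<Longrightarrow> lip x y = 0"
  using assms by (auto simp: isotropic_planes_def)

lemma isotropic_subset_perp: "F \<in> isotropic_planes \<Longrightarrow> F \<subseteq> perp F"
  by (auto simp: perp_def isotropicD)

lemma spacelike_part_nonneg:
  assumes "x $ 5 = 0" "x $ 6 = 0"
  shows "lip x x \<ge> 0" "lip x x = 0 \<Longrightarrow> x = 0"
  using assms
  by (auto simp: lip_def vec_eq_iff forall_6 add_nonneg_eq_0_iff)

text \<open>The two timelike coordinates restrict to an isomorphism of an isotropic plane with \<open>\<real>\<^sup>2\<close>: a null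
  vector without timelike part vanishes.\<close>

lemma isotropic_ex1:
  assumes F: "F \<in> isotropic_planes"
  shows "\<exists>!x. x \<in> F \<and> x $ 5 = r \<and> x $ 6 = s"
proof -
  define \<pi> where "\<pi> x = (x $ 5, x $ 6)" for x :: R42
  have lin: "linear \<pi>" by (rule linearI) (auto simp: \<pi>_def)
  have sub: "subspace F" by (rule isotropicD[OF F])
  have inj: "x = y" if "x \<in> F" "y \<in> F" "\<pi> x = \<pi> y" for x y
  proof -
    have "x - y \<in> F" using that sub by (simp add: subspace_diff)
    then have "lip (x - y) (x - y) = 0" using isotropicD(3)[OF F] by blast
    then have "x - y = 0" using that(3) by (intro spacelike_part_nonneg) (auto simp: \<pi>_def)
    then show ?thesis by simp
  qed
  have "inj_on \<pi> (span F)" using inj sub by (auto simp: inj_on_def span_eq_iff[THEN iffD2])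
  then have "dim (\<pi> ` F) = 2" using dim_image_eq[OF lin] isotropicD(2)[OF F] by simp
  then have "\<pi> ` F = UNIV"
    using dim_eq_full[of "\<pi> ` F"] linear_subspace_image[OF lin sub] by (simp add: span_eq_iff[THEN iffD2])
  then obtain x where "x \<in> F" "\<pi> x = (r, s)" by (metis UNIV_I imageE)
  then show ?thesis using inj by (intro ex1I[of _ x]) (auto simp: \<pi>_def)
qed

text \<open>The vector of the isotropic plane \<open>F\<close> with timelike coordinates \<open>r\<close> and \<open>s\<close>. The lifts of the
  standard basis form a canonical frame of \<open>F\<close>. Derivatives of lifts have no timelike part, so they
  lie in the space on which \<open>lip\<close> is positive definite, and meet \<open>F\<close> in 0 only.\<close>

definition timelike_lift :: "R42 set \<Rightarrow> real \<Rightarrow> real \<Rightarrow> R42" where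
  "timelike_lift F r s = (THE x. x \<in> F \<and> x $ 5 = r \<and> x $ 6 = s)"

lemma timelike_lift:
  assumes "F \<in> isotropic_planes"
  shows "timelike_lift F r s \<in> F" "timelike_lift F r s $ 5 = r" "timelike_lift F r s $ 6 = s"
  using theI'[OF isotropic_ex1[OF assms, of r s]] by (auto simp: timelike_lift_def)

lemma timelike_lift_eq:
  "F \<in> isotropic_planes \<Longrightarrow> x \<in> F \<Longrightarrow> timelike_lift F (x $ 5) (x $ 6) = x"
  using isotropic_ex1[of F "x $ 5" "x $ 6"] timelike_lift[of F "x $ 5" "x $ 6"] by blast

lemma timelike_lift_expand:
  assumes F: "F \<in> isotropic_planes" and x: "x \<in> F"
  shows "x = (x $ 5) *\<^sub>R timelike_lift F 1 0 + (x $ 6) *\<^sub>R timelike_lift F 0 1"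
proof -
  let ?y = "(x $ 5) *\<^sub>R timelike_lift F 1 0 + (x $ 6) *\<^sub>R timelike_lift F 0 1"
  have "?y \<in> F" using F by (simp add: isotropicD(1) subspace_add subspace_scale timelike_lift)
  from timelike_lift_eq[OF F this] timelike_lift_eq[OF F x] show ?thesis
    by (simp add: timelike_lift[OF F])
qed

lemma isotropic_timelike_zero:
  "F \<in> isotropic_planes \<Longrightarrow> x \<in> F \<Longrightarrow> x $ 5 = 0 \<Longrightarrow> x $ 6 = 0 \<Longrightarrow> x = 0"
  using timelike_lift_expand[of F x] by simp

text \<open>The form is positive definite on \<open>F\<^sup>\<bottom>/F\<close>, which is a plane. Hence the part of \<open>F\<^sup>\<bottom>\<close> orthogonal to
  a further spacelike vector of \<open>F\<^sup>\<bottom>\<close> is only a line modulo \<open>F\<close>.\<close>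

lemma perp_dependent:
  assumes F: "F \<in> isotropic_planes" and l: "l \<in> perp F" "lip l l > 0"
    and a: "a \<in> perp F" "lip l a = 0" and b: "b \<in> perp F" "lip l b = 0"
  shows "\<exists>y z. (y \<noteq> 0 \<or> z \<noteq> 0) \<and> y *\<^sub>R a + z *\<^sub>R b \<in> F"
proof (cases "a \<in> F")
  case True
  then show ?thesis by (intro exI[of _ 1] exI[of _ 0]) auto
next
  case aF: False
  have spF: "span F = F" using isotropicD(1)[OF F] by (simp add: span_eq_iff[THEN iffD2])
  show ?thesis
  proof (cases "b \<in> span (insert a F)")
    case True
    then obtain k where "b - k *\<^sub>R a \<in> F" by (auto simp: span_breakdown_eq spF)
    then show ?thesis by (intro exI[of _ "-k"] exI[of _ 1]) auto
  next
    case bF: False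
    have "l \<notin> span (insert b (insert a F))"
    proof
      assume "l \<in> span (insert b (insert a F))"
      then obtain k m where "l - k *\<^sub>R b - m *\<^sub>R a \<in> F"
        unfolding span_breakdown_eq spF by blast
      then have "lip l (l - k *\<^sub>R b - m *\<^sub>R a) = 0" by (rule perpD[OF l(1)])
      then show False using a b l by (simp add: lip.diff_right lip.scaleR_right)
    qed
    then have "dim (insert l (insert b (insert a F))) = 5"
      using aF bF isotropicD(2)[OF F] by (simp add: dim_insert spF del: span_eq_iff)
    moreover have "insert l (insert b (insert a F)) \<subseteq> perp F"
      using l a b isotropic_subset_perp[OF F] by auto
    ultimately have "5 \<le> dim (perp F)" by (metis dim_subset)
    then show ?thesis using dim_perp[OF isotropicD(1)[OF F]] isotropicD(2)[OF F] by simp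
  qed
qed

text \<open>Vectors of \<open>F\<^sup>\<bottom>\<close> that are dependent modulo \<open>F\<close> have vanishing wedge product modulo \<open>F\<close>.\<close>

lemma wedge_dependent:
  assumes F: "subspace F" and yz: "y \<noteq> 0 \<or> z \<noteq> 0" "y *\<^sub>R a + z *\<^sub>R b \<in> F" and c: "c \<in> perp F"
  shows "wedge a b c \<in> F"
proof -
  have lip0: "y * lip a c + z * lip b c = 0"
    using perpD[OF c yz(2)] by (simp add: lip.add_right lip.scaleR_right lip_commute[of c])
  have "y *\<^sub>R wedge a b c = - lip b c *\<^sub>R (y *\<^sub>R a + z *\<^sub>R b) + (y * lip a c + z * lip b c) *\<^sub>R b"
    by (simp add: wedge_def algebra_simps)
  then have "y *\<^sub>R wedge a b c \<in> F" using F yz(2) lip0 by (simp add: subspace_scale subspace_neg)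
  moreover have "z *\<^sub>R wedge a b c = lip a c *\<^sub>R (y *\<^sub>R a + z *\<^sub>R b) - (y * lip a c + z * lip b c) *\<^sub>R a"
    by (simp add: wedge_def algebra_simps)
  then have "z *\<^sub>R wedge a b c \<in> F" using F yz(2) lip0 by (simp add: subspace_scale)
  moreover have "w \<in> F" if "k *\<^sub>R w \<in> F" "k \<noteq> 0" for k w
    using subspace_scale[OF F that(1), of "inverse k"] that(2) by simp
  ultimately show ?thesis using yz(1) by blast
qed

section \<open>Smooth families of isotropic planes and spacelike lines\<close>

lemma subspace_derivative:
  fixes g :: "real \<Rightarrow> 'a::euclidean_space"
  assumes V: "subspace V" and op: "open S" "t \<in> S" and g: "\<And>s. s \<in> S \<Longrightarrow> g s \<in> V"
    and der: "(g has_vector_derivative g') (at t)"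
  shows "g' \<in> V"
proof -
  have "y \<bullet> g' = 0" if y: "y \<in> V\<^sup>\<bottom>" for y
  proof -
    have "((\<lambda>s. y \<bullet> g s) has_vector_derivative y \<bullet> g') (at t)"
      by (rule bounded_linear.has_vector_derivative[OF bounded_linear_inner_right der])
    moreover have "((\<lambda>s. y \<bullet> g s) has_vector_derivative 0) (at t)"
      by (rule has_vector_derivative_const_on[OF op, of _ 0])
        (use g y in \<open>auto simp: orthogonal_comp_def orthogonal_def inner_commute\<close>)
    ultimately show ?thesis by (rule vector_derivative_unique_at)
  qed
  then have "g' \<in> (V\<^sup>\<bottom>)\<^sup>\<bottom>" by (auto simp: orthogonal_comp_def orthogonal_def)
  then show ?thesis by (simp add: orthogonal_comp_self[OF V])
qed

lemma subbundle_frame: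
  assumes "subbundle k S F" "x \<in> S"
  obtains U e where "open U" "x \<in> U" "U \<subseteq> S" "\<And>i. i < k \<Longrightarrow> smooth_on U (e i)"
    "\<And>y. y \<in> U \<Longrightarrow> F y = span ((\<lambda>i. e i y) ` {..<k})"
proof -
  have "\<exists>U e. open U \<and> x \<in> U \<and> U \<subseteq> S \<and> (\<forall>i<k. smooth_on U (e i)) \<and>
      (\<forall>y\<in>U. F y = span ((\<lambda>i. e i y) ` {..<k}))"
    using assms by (simp add: subbundle_def)
  then show ?thesis by (elim exE conjE) (rule that, auto)
qed

lemma subspace_subbundle: "subbundle k S F \<Longrightarrow> x \<in> S \<Longrightarrow> subspace (F x)"
  and dim_subbundle: "subbundle k S F \<Longrightarrow> x \<in> S \<Longrightarrow> dim (F x) = k"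
  by (simp_all add: subbundle_def)

lemma smooth_on_timelike_lift:
  assumes sb: "subbundle 2 S f" and iso: "\<And>x. x \<in> S \<Longrightarrow> f x \<in> isotropic_planes"
  shows "smooth_on S (\<lambda>x. timelike_lift (f x) r s)"
proof (rule smooth_on_local)
  fix x assume "x \<in> S"
  then obtain U e where U: "open U" "x \<in> U" "U \<subseteq> S" and e: "\<And>i. i < 2 \<Longrightarrow> smooth_on U (e i)"
    and f: "\<And>y. y \<in> U \<Longrightarrow> f y = span ((\<lambda>i. e i y) ` {..<2::nat})"
    using subbundle_frame[OF sb] by metis
  have f': "f y = span {e 0 y, e 1 y}" if "y \<in> U" for y
    using f[OF that] by (simp add: lessThan_Suc numeral_2_eq_2 insert_commute)
  \<comment> \<open>The lift solves a linear system with determinant \<open>D\<close>, whence Cramer's rule in \<open>g\<close> below.\<close>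
  define D where "D y = e 0 y $ 5 * e 1 y $ 6 - e 0 y $ 6 * e 1 y $ 5" for y
  have D: "D y \<noteq> 0" if y: "y \<in> U" for y
  proof -
    have F: "f y \<in> isotropic_planes" using iso y U by blast
    have "\<exists>k m. z = k *\<^sub>R e 0 y + m *\<^sub>R e 1 y" if "z \<in> f y" for z
      using that unfolding f'[OF y] span_breakdown_eq span_empty
      by (metis add.commute add_diff_cancel_left' diff_add_cancel eq_iff_diff_eq_0 singletonD)
    then obtain k m k' m' where "timelike_lift (f y) 1 0 = k *\<^sub>R e 0 y + m *\<^sub>R e 1 y"
      "timelike_lift (f y) 0 1 = k' *\<^sub>R e 0 y + m' *\<^sub>R e 1 y"
      using timelike_lift(1)[OF F] by metis
    then have "k * e 0 y $ 5 + m * e 1 y $ 5 = 1" "k * e 0 y $ 6 + m * e 1 y $ 6 = 0"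
      "k' * e 0 y $ 5 + m' * e 1 y $ 5 = 0" "k' * e 0 y $ 6 + m' * e 1 y $ 6 = 1"
      using timelike_lift(2,3)[OF F, of 1 0] timelike_lift(2,3)[OF F, of 0 1] by auto
    then have "(k * m' - m * k') * D y = 1" unfolding D_def by algebra
    then show ?thesis by auto
  qed
  define g where "g y = inverse (D y) *\<^sub>R ((r * e 1 y $ 6 - s * e 1 y $ 5) *\<^sub>R e 0 y +
      (s * e 0 y $ 5 - r * e 0 y $ 6) *\<^sub>R e 1 y)" for y
  have smc: "smooth_on U (\<lambda>y. e i y $ j)" if "i < 2" for i j
    by (rule smooth_on_linear[OF U(1) bounded_linear_vec_nth e[OF that]])
  have "smooth_on U g"
    unfolding g_def D_def using D unfolding D_def
    by (intro smooth_on_scaleR smooth_on_add smooth_on_diff smooth_on_mult smooth_on_inverse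
        smooth_on_const smc e U) auto
  moreover have "g y = timelike_lift (f y) r s" if y: "y \<in> U" for y
  proof -
    have F: "f y \<in> isotropic_planes" using iso y U by blast
    have "g y \<in> f y"
      unfolding f'[OF y] g_def by (intro span_scale span_add) (auto intro: span_base span_scale)
    moreover have "g y $ 5 = r" "g y $ 6 = s"
      using D[OF y] by (simp_all add: g_def field_simps) (simp_all add: D_def algebra_simps)
    ultimately show ?thesis using timelike_lift_eq[OF F, of "g y"] by simp
  qed
  ultimately have "smooth_on U (\<lambda>x. timelike_lift (f x) r s)"
    by (rule smooth_on_cong[OF U(1)])
  then show "\<exists>U. open U \<and> x \<in> U \<and> smooth_on U (\<lambda>x. timelike_lift (f x) r s)" using U by blast
qed

lemma span_singleton_scaleR:
  fixes x :: "'a::real_vector"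
  assumes "c \<noteq> 0" shows "span {c *\<^sub>R x} = span {x}"
  using span_image_scale[of "{x}" "\<lambda>_. c"] assms by simp

lemma unit_section:
  assumes sb: "subbundle 1 S L" and sp: "\<And>x. x \<in> S \<Longrightarrow> L x \<in> spacelike_lines" and x: "x \<in> S"
  obtains U e where "open U" "x \<in> U" "U \<subseteq> S" "smooth_on U e"
    "\<And>y. y \<in> U \<Longrightarrow> lip (e y) (e y) = 1" "\<And>y. y \<in> U \<Longrightarrow> L y = span {e y}"
proof -
  obtain U b where U: "open U" "x \<in> U" "U \<subseteq> S" and b: "smooth_on U (b 0)"
    and L: "\<And>y. y \<in> U \<Longrightarrow> L y = span ((\<lambda>i. b i y) ` {..<1::nat})"
    using subbundle_frame[OF sb x] by (metis less_one)
  have L': "L y = span {b 0 y}" if "y \<in> U" for y using L[OF that] by (simp add: lessThan_Suc)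
  have pos: "lip (b 0 y) (b 0 y) > 0" if y: "y \<in> U" for y
  proof -
    have "L y \<in> spacelike_lines" using sp y U by blast
    moreover from this have "b 0 y \<noteq> 0" using L'[OF y] by (auto simp: spacelike_lines_def)
    ultimately show ?thesis using L'[OF y] span_base[of "b 0 y" "{b 0 y}"]
      by (auto simp: spacelike_lines_def)
  qed
  define e where "e y = inverse (sqrt (lip (b 0 y) (b 0 y))) *\<^sub>R b 0 y" for y
  have "smooth_on U e"
    unfolding e_def
    by (intro smooth_on_scaleR smooth_on_rsqrt smooth_on_bilinear[OF _ lip.bounded_bilinear_axioms] U b pos)
  moreover have "lip (e y) (e y) = 1" if "y \<in> U" for y
    using pos[OF that]
    by (simp add: e_def lip.scaleR_left lip.scaleR_right field_simps)
  moreover have "L y = span {e y}" if "y \<in> U" for y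
    using pos[OF that] L'[OF that] by (simp add: e_def span_singleton_scaleR)
  ultimately show ?thesis using that U by blast
qed

lemma subbundle_pullback:
  fixes h :: "'a::real_normed_vector \<Rightarrow> 'b::euclidean_space" and F :: "'b \<Rightarrow> 'c::euclidean_space set"
  assumes sb: "subbundle k S F" and V: "open V" and h: "smooth_on V h" "h ` V \<subseteq> S"
  shows "subbundle k V (\<lambda>x. F (h x))"
proof -
  have "\<exists>U e. open U \<and> x \<in> U \<and> U \<subseteq> V \<and> (\<forall>i<k. smooth_on U (e i)) \<and>
      (\<forall>y\<in>U. F (h y) = span ((\<lambda>i. e i y) ` {..<k}))" if x: "x \<in> V" for x
  proof -
    have hx: "h x \<in> S" using h(2) x by auto
    obtain U e where U: "open U" "h x \<in> U" "U \<subseteq> S" and e: "\<And>i. i < k \<Longrightarrow> smooth_on U (e i)"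
      and F: "\<And>y. y \<in> U \<Longrightarrow> F y = span ((\<lambda>i. e i y) ` {..<k})"
      using subbundle_frame[OF sb hx] by metis
    have op: "open (V \<inter> h -` U)" by (rule smooth_on_open_vimage[OF V h(1) U(1)])
    have "smooth_on (V \<inter> h -` U) (\<lambda>y. e i (h y))" if "i < k" for i
      by (rule smooth_on_compose[OF op U(1) smooth_on_subset[OF h(1)] e[OF that]]) auto
    then show ?thesis using op U x F
      by (intro exI[of _ "V \<inter> h -` U"] exI[of _ "\<lambda>i y. e i (h y)"]) auto
  qed
  moreover have "subspace (F (h x)) \<and> dim (F (h x)) = k" if "x \<in> V" for x
    using sb h(2) that by (auto simp: subbundle_def)
  ultimately show ?thesis by (simp add: subbundle_def)
qed

lemma O42_inj_on: "A \<in> O42 \<Longrightarrow> inj_on (\<lambda>c. A *v c) S"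
  by (metis O42_inv_mult(2) inj_onI)

lemma subbundle_image:
  fixes F :: "'a::real_normed_vector \<Rightarrow> R42 set" and M :: "'a \<Rightarrow> real^6^6"
  assumes sb: "subbundle k S F" and S: "open S" and M: "smooth_on S M" "\<And>x. x \<in> S \<Longrightarrow> M x \<in> O42"
  shows "subbundle k S (\<lambda>x. (\<lambda>c. M x *v c) ` F x)"
proof -
  have lin: "linear (\<lambda>c. M x *v c)" for x by simp
  have "\<exists>U e. open U \<and> x \<in> U \<and> U \<subseteq> S \<and> (\<forall>i<k. smooth_on U (e i)) \<and>
      (\<forall>y\<in>U. (\<lambda>c. M y *v c) ` F y = span ((\<lambda>i. e i y) ` {..<k}))" if x: "x \<in> S" for x
  proof -
    obtain U e where U: "open U" "x \<in> U" "U \<subseteq> S" and e: "\<And>i. i < k \<Longrightarrow> smooth_on U (e i)"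
      and F: "\<And>y. y \<in> U \<Longrightarrow> F y = span ((\<lambda>i. e i y) ` {..<k})"
      using subbundle_frame[OF sb x] by metis
    have "smooth_on U (\<lambda>y. M y *v e i y)" if "i < k" for i
      by (rule smooth_on_bilinear[OF U(1) mv.bounded_bilinear_axioms smooth_on_subset[OF M(1) U(3)] e[OF that]])
    moreover have "(\<lambda>c. M y *v c) ` F y = span ((\<lambda>i. M y *v e i y) ` {..<k})" if "y \<in> U" for y
      using linear_span_image[OF lin, of y "(\<lambda>i. e i y) ` {..<k}"] by (simp add: F[OF that] image_image)
    ultimately show ?thesis using U by (intro exI[of _ U] exI[of _ "\<lambda>i y. M y *v e i y"]) auto
  qed
  moreover have "subspace ((\<lambda>c. M x *v c) ` F x)" if "x \<in> S" for x
    by (rule linear_subspace_image[OF lin subspace_subbundle[OF sb that]])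
  moreover have "dim ((\<lambda>c. M x *v c) ` F x) = k" if "x \<in> S" for x
    using dim_image_eq[OF lin O42_inj_on[OF M(2)[OF that]]] dim_subbundle[OF sb that] by simp
  ultimately show ?thesis by (simp add: subbundle_def)
qed

lemma O42_image_isotropic:
  assumes A: "A \<in> O42" and F: "F \<in> isotropic_planes"
  shows "(\<lambda>c. A *v c) ` F \<in> isotropic_planes"
proof -
  have lin: "linear (\<lambda>c. A *v c)" by simp
  have "dim ((\<lambda>c. A *v c) ` F) = 2"
    using dim_image_eq[OF lin O42_inj_on[OF A]] isotropicD(2)[OF F] by simp
  moreover have "subspace ((\<lambda>c. A *v c) ` F)" by (rule linear_subspace_image[OF lin isotropicD(1)[OF F]])
  ultimately show ?thesis
    using isotropicD(3)[OF F] by (auto simp: isotropic_planes_def O42_lip[OF A])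
qed

lemma smooth_on_fst: "open S \<Longrightarrow> smooth_on S fst" and smooth_on_snd: "open S \<Longrightarrow> smooth_on S snd"
  by (auto intro: smooth_on_bounded_linear bounded_linear_fst bounded_linear_snd)

section \<open>The splitting of the trivial connection\<close>

lemma lproj_span_unit:
  assumes "lip e e = 1" shows "lproj (span {e}) x = lip e x *\<^sub>R e"
  unfolding lproj_def
proof (rule the_equality)
  show "lip e x *\<^sub>R e \<in> span {e} \<and> x - lip e x *\<^sub>R e \<in> perp (span {e})"
    using assms by (simp add: perp_span lip.diff_left lip.scaleR_left lip_commute[of x] span_scale span_base)
next
  fix y assume y: "y \<in> span {e} \<and> x - y \<in> perp (span {e})"
  then obtain k where "y = k *\<^sub>R e" by (auto simp: span_singleton)
  with y assms show "y = lip e x *\<^sub>R e"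
    by (simp add: perp_span lip.diff_left lip.scaleR_left lip_commute[of x])
qed

lemma lip_unit_derivative:
  assumes "open U" "smooth_on U e" "\<And>y. y \<in> U \<Longrightarrow> lip (e y) (e y) = 1" "x \<in> U"
  shows "lip (e x) (Der e x X) = 0"
proof -
  have "Der (\<lambda>y. lip (e y) (e y)) x X = 0"
    by (rule Der_const_on[OF assms(1,3,4)])
  then show ?thesis
    using Der_bilinear[OF lip.bounded_bilinear_axioms assms(2,2,4), of X]
    by (simp add: lip_commute)
qed

lemma lip_unit_vector_derivative:
  fixes e :: "real \<Rightarrow> R42"
  assumes "open U" "smooth_on U e" "\<And>y. y \<in> U \<Longrightarrow> lip (e y) (e y) = 1" "t \<in> U"
  shows "lip (e t) (vector_derivative e (at t)) = 0"
  using lip_unit_derivative[OF assms, of 1] Der_eq_vector_derivative[OF assms(2,4), of 1] by simp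

text \<open>For a unit section \<open>e\<close> of \<open>L\<close>, the tensor \<open>\<N>\<^sup>L\<close> is \<open>e \<and> e'\<close>.\<close>

lemma conn_D_unit:
  assumes U: "open U" "smooth_on U e" "\<And>y. y \<in> U \<Longrightarrow> lip (e y) (e y) = 1" "t \<in> U"
    and L: "\<And>y. y \<in> U \<Longrightarrow> L y = span {e y}"
    and \<sigma>: "(\<sigma> has_vector_derivative \<sigma>') (at t)"
  shows "conn_D L \<sigma> t = \<sigma>' - wedge (e t) (vector_derivative e (at t)) (\<sigma> t)"
proof -
  let ?e' = "vector_derivative e (at t)"
  have ee': "lip (e t) ?e' = 0" by (rule lip_unit_vector_derivative[OF U])
  have unit: "lip (e t) (e t) = 1" using U by simp
  define k where "k = lip (e t) \<sigma>' + lip ?e' (\<sigma> t)"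
  have e': "(e has_vector_derivative ?e') (at t)" by (rule smooth_on_has_vector_derivative[OF U(2,4)])
  have "((\<lambda>s. lip (e s) (\<sigma> s) *\<^sub>R e s) has_vector_derivative
      lip (e t) (\<sigma> t) *\<^sub>R ?e' + k *\<^sub>R e t) (at t)"
    unfolding k_def
    by (intro bounded_bilinear.has_vector_derivative[OF bounded_bilinear_scaleR]
        lip.has_vector_derivative e' \<sigma>)
  then have 1: "((\<lambda>s. lproj (L s) (\<sigma> s)) has_vector_derivative
      lip (e t) (\<sigma> t) *\<^sub>R ?e' + k *\<^sub>R e t) (at t)"
    by (rule has_vector_derivative_transform_within_open[OF _ U(1,4)])
      (simp add: L lproj_span_unit U)
  have 2: "((\<lambda>s. \<sigma> s - lproj (L s) (\<sigma> s)) has_vector_derivative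
      \<sigma>' - (lip (e t) (\<sigma> t) *\<^sub>R ?e' + k *\<^sub>R e t)) (at t)"
    by (rule has_vector_derivative_diff[OF \<sigma> 1])
  have pr: "lproj (L t) x = lip (e t) x *\<^sub>R e t" for x
    using U L by (simp add: lproj_span_unit)
  show ?thesis
    unfolding conn_D_def Let_def vector_derivative_at[OF 1] vector_derivative_at[OF 2] pr
    using ee' unit
    by (simp add: lip.add_right lip.diff_right lip.scaleR_right wedge_def k_def algebra_simps)
qed

lemma conn_N_unit:
  assumes U: "open U" "smooth_on U e" "\<And>y. y \<in> U \<Longrightarrow> lip (e y) (e y) = 1" "t \<in> U"
    and L: "\<And>y. y \<in> U \<Longrightarrow> L y = span {e y}"
  shows "conn_N L t w = wedge (e t) (vector_derivative e (at t)) w"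
  unfolding conn_N_def
  by (simp add: conn_D_unit[OF U L has_vector_derivative_const] vector_derivative_const_at)

lemma wedge_unit_orthogonal:
  assumes "lip e w = 0" shows "wedge e e' w = (- lip e' w) *\<^sub>R e"
  using assms by (simp add: wedge_def)

section \<open>Spherical evolution of Legendre curves\<close>

lemma dependent_mod_line:
  assumes F: "subspace F" and "a - k *\<^sub>R l \<in> F" "b - m *\<^sub>R l \<in> F"
  shows "\<exists>y z. (y \<noteq> 0 \<or> z \<noteq> 0) \<and> y *\<^sub>R a + z *\<^sub>R b \<in> (F :: R42 set)"
proof (cases "k = 0")
  case True
  then show ?thesis using assms by (intro exI[of _ 1] exI[of _ 0]) auto
next
  case False
  have "m *\<^sub>R (a - k *\<^sub>R l) - k *\<^sub>R (b - m *\<^sub>R l) \<in> F"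
    by (rule subspace_diff[OF F subspace_scale[OF F assms(2)] subspace_scale[OF F assms(3)]])
  moreover have "m *\<^sub>R (a - k *\<^sub>R l) - k *\<^sub>R (b - m *\<^sub>R l) = m *\<^sub>R a + (- k) *\<^sub>R b"
    by (simp add: algebra_simps)
  ultimately show ?thesis using False by (intro exI[of _ m] exI[of _ "-k"]) auto
qed

lemma open_slices:
  assumes "open U" shows "open {r. (r, t) \<in> U}" "open {r. (s, r) \<in> U}"
proof -
  have "open ((\<lambda>r. (r, t)) -` U)" "open ((\<lambda>r. (s, r)) -` U)"
    using assms by (auto intro!: open_vimage continuous_intros)
  then show "open {r. (r, t) \<in> U}" "open {r. (s, r) \<in> U}" by (simp_all add: vimage_def)
qed

lemma section_derivative_expand:
  assumes \<sigma>: "\<sigma> \<in> sections_at S g x"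
  shows "Der \<sigma> x (a, b) =
    a *\<^sub>R Der \<sigma> x (1, 0) + b *\<^sub>R Der \<sigma> (x :: real \<times> real) (0, 1)"
proof -
  obtain U where "x \<in> U" "smooth_on U \<sigma>" using \<sigma> by (auto simp: sections_at_def)
  then have lin: "linear (Der \<sigma> x)" by (metis smooth_on_linear_deriv)
  show ?thesis using linear_plane_expand[OF lin, of "(a, b)"] by simp
qed

lemma section_value:
  "\<sigma> \<in> sections_at S g x \<Longrightarrow> \<sigma> x \<in> g x"
  by (auto simp: sections_at_def)

text \<open>The data of the direct construction. Transport by \<open>A\<^sup>-\<^sup>1\<close> is written \<open>B\<close> and the evolved map is
  \<open>f\<close>.\<close>

locale spherical_evolution =
  fixes I J :: "real set" and L :: "real \<Rightarrow> R42 set" and v0 :: real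
    and A :: "real \<Rightarrow> real^6^6" and C :: "real \<Rightarrow> R42 set"
  assumes data: "evolution_data I J L v0 A C"
begin

abbreviation B :: "real \<Rightarrow> real^6^6" where "B v \<equiv> matrix_inv (A v)"

abbreviation f :: "real \<times> real \<Rightarrow> R42 set" where "f \<equiv> evolved A C"

lemma intervals: "open I" "open J" "connected J" "open (I \<times> J)" "v0 \<in> J"
  using data by (auto simp: evolution_data_def open_interval_def open_Times is_interval_connected)

lemma L_subbundle: "subbundle 1 J L" and L_spacelike: "v \<in> J \<Longrightarrow> L v \<in> spacelike_lines"
  using data by (auto simp: evolution_data_def immersion_into_spacelike_lines_def)

lemma A_O42: "v \<in> J \<Longrightarrow> A v \<in> O42" and A_smooth: "smooth_on J A"
  using data by (auto simp: evolution_data_def spherical_evolution_map_def)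

lemma A_gauge:
  "smooth_on J \<sigma> \<Longrightarrow> v \<in> J \<Longrightarrow> A v *v conn_D L (\<lambda>t. B t *v \<sigma> t) v = vector_derivative \<sigma> (at v)"
  using data by (auto simp: evolution_data_def spherical_evolution_map_def)

lemma A_base: "A v0 = mat 1"
  using data by (auto simp: evolution_data_def spherical_evolution_map_def)

lemma C_subbundle: "subbundle 2 I C"
  and C_isotropic: "u \<in> I \<Longrightarrow> C u \<in> isotropic_planes"
  and C_perp: "u \<in> I \<Longrightarrow> C u \<subseteq> perp (L v0)"
  and C_immersed: "immersed I C"
  using data by (auto simp: evolution_data_def legendre_curve_def legendre_in_def)

lemma C_derived:
  assumes "u \<in> I" "\<sigma> \<in> sections_at I C u"
  shows "Der \<sigma> u X \<in> perp (C u) \<inter> perp (L v0)"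
proof -
  have "Der \<sigma> u X \<in> derived_bundle I C u"
    using assms(2) by (auto simp: derived_bundle_def)
  then show ?thesis
    using data assms(1) by (auto simp: evolution_data_def legendre_curve_def legendre_in_def)
qed

lemma AB: "v \<in> J \<Longrightarrow> A v *v (B v *v x) = x" and BA: "v \<in> J \<Longrightarrow> B v *v (A v *v x) = x"
  using O42_inv_mult A_O42 by auto

lemma B_lip: "v \<in> J \<Longrightarrow> lip (B v *v x) (B v *v y) = lip x y"
  by (rule O42_lip[OF O42_inv_in[OF A_O42]])

lemma B_smooth: "smooth_on J B"
  by (rule smooth_on_cong[OF intervals(2) smooth_on_linear[OF intervals(2) bounded_linear_lip_adjoint A_smooth]])
    (simp add: O42_matrix_inv A_O42)

lemma f_eq: "f (u, v) = (\<lambda>c. B v *v c) ` C u"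
  by (simp add: evolved_def)

text \<open>The gauge condition makes \<open>A\<^sup>-\<^sup>1 w\<close> a parallel section of \<open>\<D>\<^sup>L\<close> for each constant \<open>w\<close>.\<close>

lemma transport:
  assumes "v \<in> J"
  shows "((\<lambda>t. B t *v w) has_vector_derivative conn_N L v (B v *v w)) (at v)"
proof -
  obtain U e where U: "open U" "v \<in> U" "U \<subseteq> J" "smooth_on U e"
    "\<And>y. y \<in> U \<Longrightarrow> lip (e y) (e y) = 1" "\<And>y. y \<in> U \<Longrightarrow> L y = span {e y}"
    using unit_section[OF L_subbundle L_spacelike assms] by metis
  have der: "((\<lambda>t. B t *v w) has_vector_derivative vector_derivative (\<lambda>t. B t *v w) (at v)) (at v)"
    by (rule smooth_on_has_vector_derivative[OF smooth_on_bilinear[OF intervals(2)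
            mv.bounded_bilinear_axioms B_smooth smooth_on_const] assms])
  have "A v *v conn_D L (\<lambda>t. B t *v w) v = 0"
    using A_gauge[OF smooth_on_const assms] by (simp add: vector_derivative_const_at)
  then have "conn_D L (\<lambda>t. B t *v w) v = 0" by (rule O42_inj[OF A_O42[OF assms]])
  then show ?thesis
    using conn_D_unit[OF U(1,4,5,2,6) der] conn_N_unit[OF U(1,4,5,2,6)] der by simp
qed

text \<open>As \<open>\<D>\<^sup>L\<close> preserves \<open>L\<^sup>\<bottom>\<close>, parallel transport maps \<open>L(v\<^sub>0)\<^sup>\<bottom>\<close> into \<open>L(v)\<^sup>\<bottom>\<close>.\<close>

lemma B_perp:
  assumes w: "w \<in> perp (L v0)" and v: "v \<in> J"
  shows "B v *v w \<in> perp (L v)"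
proof (rule connected_induction_simple[OF intervals(3,5) v])
  show "B v0 *v w \<in> perp (L v0)"
    using w BA[OF intervals(5), of w] by (simp add: A_base)
next
  fix a assume "a \<in> J"
  then obtain U e where U: "open U" "a \<in> U" "U \<subseteq> J" "smooth_on U e"
    "\<And>y. y \<in> U \<Longrightarrow> lip (e y) (e y) = 1" "\<And>y. y \<in> U \<Longrightarrow> L y = span {e y}"
    using unit_section[OF L_subbundle L_spacelike] by metis
  obtain r where r: "r > 0" "ball a r \<subseteq> U" using U open_contains_ball by blast
  have const: "lip (e x) (B x *v w) = lip (e y) (B y *v w)" if "x \<in> ball a r" "y \<in> ball a r" for x y
  proof (rule constant_on_open_interval[OF _ _ that])
    show "open_interval (ball a r)" using r by (auto simp: open_interval_def is_interval_ball_real)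
    fix t assume "t \<in> ball a r"
    then have t: "t \<in> U" "t \<in> J" using r U by auto
    let ?e' = "vector_derivative e (at t)"
    have "((\<lambda>s. lip (e s) (B s *v w)) has_vector_derivative
        lip (e t) (conn_N L t (B t *v w)) + lip ?e' (B t *v w)) (at t)"
      by (intro lip.has_vector_derivative transport smooth_on_has_vector_derivative[OF U(4)] t)
    moreover have "lip (e t) (conn_N L t (B t *v w)) + lip ?e' (B t *v w) = 0"
      using lip_unit_vector_derivative[OF U(1,4,5) t(1)] U(5)[OF t(1)]
        conn_N_unit[OF U(1,4,5) t(1) U(6), of "B t *v w"]
      by (simp add: lip.diff_right lip.scaleR_right wedge_def)
    ultimately show "((\<lambda>s. lip (e s) (B s *v w)) has_vector_derivative 0) (at t)" by simp
  qed
  have "B y *v w \<in> perp (L y)" if "x \<in> ball a r" "y \<in> ball a r" "B x *v w \<in> perp (L x)" for x y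
    using const[OF that(1,2)] that r(2) by (auto simp: U(6) subset_iff perp_span lip_commute)
  moreover have "openin (top_of_set J) (ball a r)"
    using r U intervals(2) by (auto simp: openin_open_eq)
  ultimately show "\<exists>T. openin (top_of_set J) T \<and> a \<in> T \<and>
      (\<forall>x\<in>T. \<forall>y\<in>T. B x *v w \<in> perp (L x) \<longrightarrow> B y *v w \<in> perp (L y))"
    using r(1) by (metis centre_in_ball)
qed

lemma conn_N_in_L:
  assumes "v \<in> J" "w \<in> perp (L v)"
  shows "conn_N L v w \<in> L v"
proof -
  obtain U e where U: "open U" "v \<in> U" "U \<subseteq> J" "smooth_on U e"
    "\<And>y. y \<in> U \<Longrightarrow> lip (e y) (e y) = 1" "\<And>y. y \<in> U \<Longrightarrow> L y = span {e y}"
    using unit_section[OF L_subbundle L_spacelike assms(1)] by metis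
  have "lip (e v) w = 0" using assms(2) U(6)[OF U(2)] by (simp add: perp_span lip_commute)
  then have "conn_N L v w = (- lip (vector_derivative e (at v)) w) *\<^sub>R e v"
    using conn_N_unit[OF U(1,4,5,2,6), of w] by (simp add: wedge_unit_orthogonal)
  then show ?thesis
    unfolding U(6)[OF U(2)] by (simp only: span_scale span_base singletonI)
qed

lemma f_isotropic: "u \<in> I \<Longrightarrow> v \<in> J \<Longrightarrow> f (u, v) \<in> isotropic_planes"
  unfolding f_eq by (intro O42_image_isotropic O42_inv_in A_O42 C_isotropic)

lemma f_perp_L: "u \<in> I \<Longrightarrow> v \<in> J \<Longrightarrow> f (u, v) \<subseteq> perp (L v)"
  using C_perp B_perp by (auto simp: f_eq)

lemma L_perp_f: "u \<in> I \<Longrightarrow> v \<in> J \<Longrightarrow> L v \<subseteq> perp (f (u, v))"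
  using f_perp_L by (fastforce simp: perp_def lip_commute)

lemma B_perp_f:
  assumes "p \<in> perp (C u)" "v \<in> J" shows "B v *v p \<in> perp (f (u, v))"
  using assms by (auto simp: perp_def f_eq B_lip)

text \<open>The \<open>u\<close>-derivative of a section of \<open>f\<close> is the transported derivative of a section of \<open>C\<close>, hence
  orthogonal to \<open>L\<close>. Modulo \<open>f\<close>, the \<open>v\<close>-derivative is the value of \<open>\<N>\<^sup>L\<close>, hence in \<open>L\<close>.\<close>

lemma section_derivatives:
  assumes \<sigma>: "\<sigma> \<in> sections_at (I \<times> J) f (u, v)" and u: "u \<in> I" and v: "v \<in> J"
  obtains p q where "p \<in> perp (C u)" "p \<in> perp (L v0)" "q \<in> C u"
    "Der \<sigma> (u, v) (1, 0) = B v *v p"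
    "Der \<sigma> (u, v) (0, 1) = B v *v q + conn_N L v (\<sigma> (u, v))"
proof -
  obtain U where U: "open U" "(u, v) \<in> U" "U \<subseteq> I \<times> J" "smooth_on U \<sigma>" "\<And>x. x \<in> U \<Longrightarrow> \<sigma> x \<in> f x"
    using \<sigma> by (auto simp: sections_at_def)
  have A\<sigma>: "A t *v \<sigma> (s, t) \<in> C s" if "(s, t) \<in> U" for s t
  proof -
    have "\<sigma> (s, t) \<in> f (s, t)" "t \<in> J" using U that by auto
    then show ?thesis by (auto simp: f_eq AB)
  qed
  note der = partial_has_vector_derivative[OF U(4,2)]
  define c where "c s = A v *v \<sigma> (s, v)" for s
  have slice: "open {s. (s, v) \<in> U}" "open {s. (u, s) \<in> U}" using open_slices[OF U(1)] .
  have "smooth_on {s. (s, v) \<in> U} (\<lambda>s. (s, v))"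
    by (intro smooth_on_Pair smooth_on_const slice smooth_on_bounded_linear bounded_linear_ident)
  then have "smooth_on {s. (s, v) \<in> U} (\<lambda>s. \<sigma> (s, v))"
    by (rule smooth_on_compose[OF slice(1) U(1) _ U(4)]) auto
  then have smc: "smooth_on {s. (s, v) \<in> U} c"
    unfolding c_def by (rule smooth_on_linear[OF slice(1) mv.bounded_linear_right])
  then have "c \<in> sections_at I C u"
    unfolding sections_at_def using slice U(2,3) A\<sigma> by (auto simp: c_def intro!: exI[of _ "{s. (s, v) \<in> U}"])
  then have p: "Der c u 1 \<in> perp (C u) \<inter> perp (L v0)" by (rule C_derived[OF u])
  have "(c has_vector_derivative A v *v Der \<sigma> (u, v) (1, 0)) (at u)"
    unfolding c_def by (rule bounded_linear.has_vector_derivative[OF mv.bounded_linear_right der(1)])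
  then have "Der c u 1 = A v *v Der \<sigma> (u, v) (1, 0)"
    using Der_eq_vector_derivative[OF smc, of u 1] U(2) by (simp add: vector_derivative_at)
  then have p': "Der \<sigma> (u, v) (1, 0) = B v *v Der c u 1"
    by (simp add: BA[OF v])
  \<comment> \<open>Transported back, \<open>\<sigma>(u, \<cdot>)\<close> is a curve in the fixed plane \<open>C u\<close>.\<close>
  define \<tau> where "\<tau> t = A t *v \<sigma> (u, t)" for t
  have A': "(A has_vector_derivative vector_derivative A (at v)) (at v)"
    by (rule smooth_on_has_vector_derivative[OF A_smooth v])
  have B': "(B has_vector_derivative vector_derivative B (at v)) (at v)"
    by (rule smooth_on_has_vector_derivative[OF B_smooth v])
  obtain q where q: "(\<tau> has_vector_derivative q) (at v)"
    unfolding \<tau>_def using mv.has_vector_derivative[OF A' der(2)] by blast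
  have qC: "q \<in> C u"
  proof (rule subspace_derivative[OF _ slice(2) _ _ q])
    show "subspace (C u)" by (rule isotropicD(1)[OF C_isotropic[OF u]])
    show "\<tau> s \<in> C u" if "s \<in> {s. (u, s) \<in> U}" for s using that A\<sigma> by (simp add: \<tau>_def)
  qed (use U(2) in simp)
  have Bt: "B t *v \<tau> t = \<sigma> (u, t)" if "(u, t) \<in> U" for t
    using that U(3) by (auto simp: \<tau>_def BA)
  have B'w: "vector_derivative B (at v) *v w = conn_N L v (B v *v w)" for w
    using mv.has_vector_derivative[OF B' has_vector_derivative_const[of w]] transport[OF v, of w]
    by (simp add: vector_derivative_unique_at mv.zero_right)
  have "((\<lambda>t. B t *v \<tau> t) has_vector_derivative B v *v q + vector_derivative B (at v) *v \<tau> v) (at v)"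
    by (rule mv.has_vector_derivative[OF B' q])
  then have "((\<lambda>t. \<sigma> (u, t)) has_vector_derivative B v *v q + vector_derivative B (at v) *v \<tau> v) (at v)"
    by (rule has_vector_derivative_transform_within_open[OF _ slice(2)]) (use Bt U(2) in auto)
  then have "Der \<sigma> (u, v) (0, 1) = B v *v q + vector_derivative B (at v) *v \<tau> v"
    using der(2) vector_derivative_unique_at by blast
  then have q': "Der \<sigma> (u, v) (0, 1) = B v *v q + conn_N L v (\<sigma> (u, v))"
    using B'w[of "\<tau> v"] Bt[OF U(2)] by simp
  show ?thesis using that[of "Der c u 1" q] p p' q' qC by blast
qed

lemma transported_section:
  assumes c: "c \<in> sections_at I C u" and u: "u \<in> I" and v: "v \<in> J"
  shows "(\<lambda>x. B (snd x) *v c (fst x)) \<in> sections_at (I \<times> J) f (u, v)"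
    "Der (\<lambda>x. B (snd x) *v c (fst x)) (u, v) (1, 0) = B v *v Der c u 1"
    "Der (\<lambda>x. B (snd x) *v c (fst x)) (u, v) (0, 1) = conn_N L v (B v *v c u)"
proof -
  let ?\<sigma> = "\<lambda>x. B (snd x) *v c (fst x)"
  obtain U where U: "open U" "u \<in> U" "U \<subseteq> I" "smooth_on U c" "\<And>x. x \<in> U \<Longrightarrow> c x \<in> C x"
    using c by (auto simp: sections_at_def)
  have op: "open (U \<times> J)" using U intervals by (simp add: open_Times)
  have sm: "smooth_on (U \<times> J) ?\<sigma>"
    using intervals(2) U
    by (intro smooth_on_bilinear[OF op mv.bounded_bilinear_axioms]
        smooth_on_compose[OF op intervals(2) smooth_on_snd[OF op] B_smooth]
        smooth_on_compose[OF op U(1) smooth_on_fst[OF op] U(4)]) auto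
  then show "?\<sigma> \<in> sections_at (I \<times> J) f (u, v)"
    unfolding sections_at_def using U op v by (auto simp: f_eq intro!: exI[of _ "U \<times> J"])
  have uv: "(u, v) \<in> U \<times> J" using U v by simp
  note der = partial_has_vector_derivative[OF sm uv, simplified]
  have "(c has_vector_derivative Der c u 1) (at u)"
    using smooth_on_has_vector_derivative[OF U(4,2)] Der_eq_vector_derivative[OF U(4,2), of 1] by simp
  from bounded_linear.has_vector_derivative[OF mv.bounded_linear_right this, of "B v"]
  show "Der ?\<sigma> (u, v) (1, 0) = B v *v Der c u 1"
    using der(1) vector_derivative_unique_at by blast
  show "Der ?\<sigma> (u, v) (0, 1) = conn_N L v (B v *v c u)"
    using der(2) transport[OF v, of "c u"] vector_derivative_unique_at by blast
qed

lemma f_subbundle: "subbundle 2 (I \<times> J) f"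
proof -
  have "subbundle 2 (I \<times> J) (\<lambda>x. C (fst x))"
    by (rule subbundle_pullback[OF C_subbundle intervals(4) smooth_on_fst[OF intervals(4)]]) auto
  moreover have "smooth_on (I \<times> J) (\<lambda>x. B (snd x))"
    by (rule smooth_on_compose[OF intervals(4,2) smooth_on_snd[OF intervals(4)] B_smooth]) auto
  ultimately have "subbundle 2 (I \<times> J) (\<lambda>x. (\<lambda>c. B (snd x) *v c) ` C (fst x))"
    by (rule subbundle_image[OF _ intervals(4)]) (auto simp: O42_inv_in A_O42)
  then show ?thesis by (simp add: evolved_def case_prod_beta')
qed

lemma f_immersed: "immersed (I \<times> J) f"
  unfolding immersed_def
proof (intro ballI allI impI)
  fix x X assume x: "x \<in> I \<times> J"
    and tang: "\<forall>\<sigma>\<in>sections_at (I \<times> J) f x. Der \<sigma> x X \<in> f x"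
  obtain u v where uv: "x = (u, v)" "u \<in> I" "v \<in> J" using x by auto
  obtain a b where X: "X = (a, b)" by (cases X)
  have tang': "a *\<^sub>R (B v *v Der c u 1) + b *\<^sub>R conn_N L v (B v *v c u) \<in> f (u, v)"
    if "c \<in> sections_at I C u" for c
    using bspec[OF tang[unfolded uv X] transported_section(1)[OF that uv(2,3)]]
      section_derivative_expand[OF transported_section(1)[OF that uv(2,3)], of a b]
    by (simp add: transported_section(2,3)[OF that uv(2,3)])
  \<comment> \<open>The component in \<open>L\<close> is \<open>b\<close> times a value of \<open>\<N>\<^sup>L\<close>, which is nonzero for a suitable section.\<close>
  have b0: "b = 0"
  proof -
    obtain c0 where c0: "c0 \<in> C u" "A v *v conn_N L v (B v *v c0) \<noteq> 0"
      using data uv by (auto simp: evolution_data_def Ad_N_nowhere_zero_on_def)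
    define c where "c s = timelike_lift (C s) (c0 $ 5) (c0 $ 6)" for s
    have "smooth_on I c" unfolding c_def by (rule smooth_on_timelike_lift[OF C_subbundle C_isotropic])
    then have c: "c \<in> sections_at I C u"
      using intervals uv timelike_lift(1)[OF C_isotropic]
      by (auto simp: sections_at_def c_def intro!: exI[of _ I])
    have cu: "c u = c0" using timelike_lift_eq[OF C_isotropic c0(1)] uv by (simp add: c_def)
    let ?n = "conn_N L v (B v *v c0)"
    have n: "?n \<in> L v" "?n \<noteq> 0"
      using conn_N_in_L[OF uv(3) B_perp[OF _ uv(3)], of c0] c0 C_perp[OF uv(2)] by auto
    have "lip (a *\<^sub>R (B v *v Der c u 1) + b *\<^sub>R ?n) ?n = 0"
      using tang'[OF c] cu f_perp_L[OF uv(2,3)] n(1) by (auto simp: perp_def)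
    moreover have "lip (B v *v Der c u 1) ?n = 0"
      using B_perp[OF _ uv(3)] C_derived[OF uv(2) c] n(1) by (auto simp: perp_def)
    moreover have "lip ?n ?n > 0" using L_spacelike[OF uv(3)] n by (auto simp: spacelike_lines_def)
    ultimately show "b = 0" by (simp add: lip.add_left lip.scaleR_left)
  qed
  have "Der c u a \<in> C u" if c: "c \<in> sections_at I C u" for c
  proof -
    obtain U where U: "u \<in> U" "smooth_on U c" using c by (auto simp: sections_at_def)
    have "a *\<^sub>R (B v *v Der c u 1) \<in> f (u, v)" using tang'[OF c] b0 by simp
    moreover have "a *\<^sub>R (B v *v Der c u 1) = B v *v Der c u a"
      unfolding Der_eq_vector_derivative[OF U(2,1)] by (simp add: mv.scaleR_right)
    ultimately obtain c1 where "c1 \<in> C u" "B v *v Der c u a = B v *v c1"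
      by (auto simp: f_eq)
    then show ?thesis using AB[OF uv(3)] by metis
  qed
  then have "a = 0" using C_immersed uv(2) by (auto simp: immersed_def)
  then show "X = 0" using b0 X by (simp add: zero_prod_def)
qed

lemma f_legendre: "legendre_map (I \<times> J) f"
proof -
  have "derived_bundle (I \<times> J) f x \<subseteq> perp (f x)" if "x \<in> I \<times> J" for x
  proof -
    from that obtain u v where x: "x = (u, v)" "u \<in> I" "v \<in> J" by (rule SigmaE)
    have iso: "f x \<subseteq> perp (f x)" using isotropic_subset_perp[OF f_isotropic] x by simp
    have "Der \<sigma> x X \<in> perp (f x)" if \<sigma>: "\<sigma> \<in> sections_at (I \<times> J) f x" for \<sigma> X
    proof -
      obtain a b where X: "X = (a, b)" by (cases X)
      obtain p q where pq: "p \<in> perp (C u)" "p \<in> perp (L v0)" "q \<in> C u"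
        "Der \<sigma> (u, v) (1, 0) = B v *v p"
        "Der \<sigma> (u, v) (0, 1) = B v *v q + conn_N L v (\<sigma> (u, v))"
        using section_derivatives[OF \<sigma>[unfolded x(1)] x(2,3)] by metis
      have "\<sigma> x \<in> perp (L v)" using section_value[OF \<sigma>] f_perp_L x by auto
      then have "conn_N L v (\<sigma> x) \<in> perp (f x)"
        using subsetD[OF L_perp_f[OF x(2,3)] conn_N_in_L[OF x(3)]] x(1) by simp
      moreover have "B v *v q \<in> perp (f x)" using pq(3) iso x by (auto simp: f_eq)
      moreover have "B v *v p \<in> perp (f x)" using B_perp_f pq(1) x by simp
      ultimately show ?thesis
        using section_derivative_expand[OF \<sigma>, of a b] pq x X subspace_perp[of "f x"]
        by (simp add: subspace_add subspace_scale)
    qed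
    moreover have "\<sigma> x \<in> perp (f x)" if "\<sigma> \<in> sections_at (I \<times> J) f x" for \<sigma>
      using section_value[OF that] iso by auto
    ultimately show ?thesis by (auto simp: derived_bundle_def)
  qed
  then show ?thesis
    using f_subbundle f_immersed f_isotropic by (auto simp: legendre_map_def legendre_in_def)
qed

lemma unit_normal:
  assumes "v \<in> J" obtains e where "lip e e = 1" "L v = span {e}"
  using unit_section[OF L_subbundle L_spacelike assms] by metis

text \<open>The form \<open>\<B>\<close> takes its values in the second exterior power of the plane \<open>f\<^sup>\<bottom>/f\<close>, so it vanishes
  on a direction along which all derivatives of sections are dependent modulo \<open>f\<close>.\<close>

lemma curvature_linesI:
  assumes "\<And>u v X Y \<sigma>1 \<sigma>2. u \<in> I \<Longrightarrow> v \<in> J \<Longrightarrow> X \<in> T (u, v) \<Longrightarrow> Y \<in> T (u, v) \<Longrightarrow>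
      \<sigma>1 \<in> sections_at (I \<times> J) f (u, v) \<Longrightarrow> \<sigma>2 \<in> sections_at (I \<times> J) f (u, v) \<Longrightarrow>
      \<exists>y z. (y \<noteq> 0 \<or> z \<noteq> 0) \<and>
        y *\<^sub>R Der \<sigma>1 (u, v) X + z *\<^sub>R Der \<sigma>2 (u, v) Y \<in> f (u, v)"
  shows "curvature_lines (I \<times> J) f T"
  unfolding curvature_lines_def
proof (intro ballI)
  fix x X Y \<sigma>1 \<sigma>2 c
  assume x: "x \<in> I \<times> J" and XY: "X \<in> T x" "Y \<in> T x"
    and \<sigma>: "\<sigma>1 \<in> sections_at (I \<times> J) f x" "\<sigma>2 \<in> sections_at (I \<times> J) f x" and c: "c \<in> perp (f x)"
  obtain u v where uv: "x = (u, v)" "u \<in> I" "v \<in> J" using x by auto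
  have F: "subspace (f x)" using isotropicD(1)[OF f_isotropic] uv by simp
  have "wedge (Der \<sigma>1 x X) (Der \<sigma>2 x Y) c \<in> f x"
    "wedge (Der \<sigma>1 x Y) (Der \<sigma>2 x X) c \<in> f x"
    using assms[OF uv(2,3) XY[unfolded uv] \<sigma>[unfolded uv]] assms[OF uv(2,3) XY(2,1)[unfolded uv] \<sigma>[unfolded uv]]
      wedge_dependent[OF F _ _ c] unfolding uv by blast+
  then show "curvature_form x X Y \<sigma>1 \<sigma>2 c \<in> f x"
    unfolding curvature_form_def using F by (intro subspace_scale subspace_add)
qed

lemma u_lines_curvature: "curvature_lines (I \<times> J) f u_lines"
proof (rule curvature_linesI)
  fix u v X Y \<sigma>1 \<sigma>2
  assume uv: "u \<in> I" "v \<in> J" and XY: "X \<in> u_lines (u, v)" "Y \<in> u_lines (u, v)"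
    and \<sigma>: "\<sigma>1 \<in> sections_at (I \<times> J) f (u, v)" "\<sigma>2 \<in> sections_at (I \<times> J) f (u, v)"
  obtain e where e: "lip e e = 1" "L v = span {e}" using unit_normal[OF uv(2)] .
  have eL: "e \<in> L v" by (simp add: e(2) span_base)
  have *: "Der \<sigma> (u, v) X \<in> perp (f (u, v)) \<and> lip e (Der \<sigma> (u, v) X) = 0"
    if X: "X \<in> u_lines (u, v)" and \<sigma>: "\<sigma> \<in> sections_at (I \<times> J) f (u, v)" for X \<sigma>
  proof -
    obtain a where "X = (a, 0)" using X by (auto simp: u_lines_def span_singleton)
    moreover obtain p where p: "p \<in> perp (C u)" "p \<in> perp (L v0)"
        "Der \<sigma> (u, v) (1, 0) = B v *v p"
      using section_derivatives[OF \<sigma> uv] by metis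
    ultimately have D: "Der \<sigma> (u, v) X = a *\<^sub>R (B v *v p)"
      using section_derivative_expand[OF \<sigma>, of a 0] by simp
    have "lip e (B v *v p) = 0"
      using perpD[OF B_perp[OF p(2) uv(2)] eL] by (simp add: lip_commute)
    then show ?thesis
      unfolding D using B_perp_f[OF p(1) uv(2)] subspace_perp by (simp add: subspace_scale lip.scaleR_right)
  qed
  have "e \<in> perp (f (u, v))" using L_perp_f[OF uv] eL by auto
  then show "\<exists>y z. (y \<noteq> 0 \<or> z \<noteq> 0) \<and>
        y *\<^sub>R Der \<sigma>1 (u, v) X + z *\<^sub>R Der \<sigma>2 (u, v) Y \<in> f (u, v)"
    using *[OF XY(1) \<sigma>(1)] *[OF XY(2) \<sigma>(2)] e(1)
    by (intro perp_dependent[OF f_isotropic[OF uv], of e]) auto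
qed

lemma v_lines_curvature: "curvature_lines (I \<times> J) f v_lines"
proof (rule curvature_linesI)
  fix u v X Y \<sigma>1 \<sigma>2
  assume uv: "u \<in> I" "v \<in> J" and XY: "X \<in> v_lines (u, v)" "Y \<in> v_lines (u, v)"
    and \<sigma>: "\<sigma>1 \<in> sections_at (I \<times> J) f (u, v)" "\<sigma>2 \<in> sections_at (I \<times> J) f (u, v)"
  obtain e where e: "lip e e = 1" "L v = span {e}" using unit_normal[OF uv(2)] .
  have F: "subspace (f (u, v))" by (rule isotropicD(1)[OF f_isotropic[OF uv]])
  have *: "\<exists>k. Der \<sigma> (u, v) X - k *\<^sub>R e \<in> f (u, v)"
    if X: "X \<in> v_lines (u, v)" and \<sigma>: "\<sigma> \<in> sections_at (I \<times> J) f (u, v)" for X \<sigma>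
  proof -
    obtain b where X': "X = (0, b)" using X by (auto simp: v_lines_def span_singleton)
    obtain q where q: "q \<in> C u"
        "Der \<sigma> (u, v) (0, 1) = B v *v q + conn_N L v (\<sigma> (u, v))"
      using section_derivatives[OF \<sigma> uv] by metis
    have "conn_N L v (\<sigma> (u, v)) \<in> L v"
      using conn_N_in_L[OF uv(2)] section_value[OF \<sigma>] f_perp_L[OF uv] by auto
    then obtain k where k: "conn_N L v (\<sigma> (u, v)) = k *\<^sub>R e" by (auto simp: e(2) span_singleton)
    have "b *\<^sub>R (B v *v q) \<in> f (u, v)" using F q(1) by (intro subspace_scale) (auto simp: f_eq)
    then show ?thesis
      using section_derivative_expand[OF \<sigma>, of 0 b] q(2) k X'
      by (intro exI[of _ "b * k"]) (simp add: scaleR_add_right)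
  qed
  show "\<exists>y z. (y \<noteq> 0 \<or> z \<noteq> 0) \<and>
        y *\<^sub>R Der \<sigma>1 (u, v) X + z *\<^sub>R Der \<sigma>2 (u, v) Y \<in> f (u, v)"
    using *[OF XY(1) \<sigma>(1)] *[OF XY(2) \<sigma>(2)] dependent_mod_line[OF F] by blast
qed

lemma u_lines_spherical: "spherical_curvature_lines (I \<times> J) f u_lines"
proof -
  have "subbundle 1 (I \<times> J) (\<lambda>x. L (snd x))"
    by (rule subbundle_pullback[OF L_subbundle intervals(4) smooth_on_snd[OF intervals(4)]]) auto
  moreover have "L (snd (\<gamma> s)) = L (snd (\<gamma> t))"
    if "integral_curve (I \<times> J) u_lines K \<gamma>" "s \<in> K" "t \<in> K" for K \<gamma> s t
  proof -
    have "snd (\<gamma> s) = snd (\<gamma> t)"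
    proof (rule constant_on_open_interval[OF _ _ that(2,3)])
      show "open_interval K" using that(1) by (simp add: integral_curve_def)
      fix r assume "r \<in> K"
      with that(1) obtain X where X: "(\<gamma> has_vector_derivative X) (at r)" "X \<in> u_lines (\<gamma> r)"
        unfolding integral_curve_def by blast
      have "((\<lambda>s. snd (\<gamma> s)) has_vector_derivative snd X) (at r)"
        by (rule bounded_linear.has_vector_derivative[OF bounded_linear_snd X(1)])
      moreover have "snd X = 0" using X(2) by (auto simp: u_lines_def span_singleton)
      ultimately show "((\<lambda>s. snd (\<gamma> s)) has_vector_derivative 0) (at r)" by simp
    qed
    then show ?thesis by simp
  qed
  moreover have "L (snd x) \<in> spacelike_lines \<and> L (snd x) \<subseteq> perp (f x)" if "x \<in> I \<times> J" for x
    using L_spacelike L_perp_f[of "fst x" "snd x"] that by (simp add: mem_Times_iff)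
  ultimately have "spherical_bundle (I \<times> J) f u_lines (\<lambda>x. L (snd x))"
    unfolding spherical_bundle_def by blast
  then show ?thesis using u_lines_curvature unfolding spherical_curvature_lines_def by blast
qed

end

section \<open>Linear algebra in the parameter plane\<close>

lemma plane_kernel_unique:
  fixes \<phi> :: "real \<times> real \<Rightarrow> real"
  assumes lin: "linear \<phi>" and "\<phi> Y \<noteq> 0" "t \<noteq> 0" "\<phi> t = 0" "\<phi> X = 0"
  shows "X \<in> span {t}"
proof -
  note expand = linear_plane_expand[OF lin, simplified]
  have "\<phi> (1, 0) \<noteq> 0 \<or> \<phi> (0, 1) \<noteq> 0" using assms(2) expand[of Y] by auto
  moreover have "\<phi> (1, 0) * (fst X * snd t - snd X * fst t) = 0"
    "\<phi> (0, 1) * (fst X * snd t - snd X * fst t) = 0"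
    using assms(4,5) expand[of X] expand[of t] by algebra+
  ultimately have eq: "fst X * snd t = snd X * fst t" by auto
  have "fst t \<noteq> 0 \<or> snd t \<noteq> 0" using assms(3) by (auto simp: prod_eq_iff)
  then have "X = (fst X / fst t) *\<^sub>R t \<or> X = (snd X / snd t) *\<^sub>R t"
    using eq by (auto simp: prod_eq_iff field_simps)
  then show ?thesis unfolding span_singleton by blast
qed

lemma plane_det_nonzero:
  fixes a b :: "real \<times> real \<Rightarrow> real"
  assumes "linear a" "linear b" and "b X = 0" "a X \<noteq> 0" "b Y \<noteq> 0"
  shows "a (1, 0) * b (0, 1) - a (0, 1) * b (1, 0) \<noteq> 0"
proof
  assume "a (1, 0) * b (0, 1) - a (0, 1) * b (1, 0) = 0"
  then have "b (0, 1) * a X = 0" "b (1, 0) * a X = 0"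
    using assms(3) linear_plane_expand[OF assms(1), of X, simplified]
      linear_plane_expand[OF assms(2), of X, simplified] by algebra+
  then show False using assms(4,5) linear_plane_expand[OF assms(2), of Y] by simp
qed

lemma plane_kernel_exists:
  fixes a :: "real \<times> real \<Rightarrow> 'b::real_vector"
  assumes lin: "linear a" and dep: "\<And>X Y. \<exists>y z. (y \<noteq> 0 \<or> z \<noteq> 0) \<and> y *\<^sub>R a X + z *\<^sub>R a Y = 0"
  shows "\<exists>X. X \<noteq> 0 \<and> a X = 0"
proof -
  obtain y z where yz: "y \<noteq> 0 \<or> z \<noteq> 0" "y *\<^sub>R a (1, 0) + z *\<^sub>R a (0, 1) = 0" using dep by blast
  have "a (y *\<^sub>R (1, 0) + z *\<^sub>R (0, 1)) = 0" using yz(2) by (simp only: linear_add[OF lin] linear_cmul[OF lin])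
  then show ?thesis using yz(1) by (intro exI[of _ "(y, z)"]) (auto simp: zero_prod_def)
qed

section \<open>Legendre maps and their timelike frames\<close>

lemma sections_at_restrict:
  assumes "open W" "W \<subseteq> V" "x \<in> W"
  shows "sections_at W F x = sections_at V F x"
proof (intro equalityI subsetI)
  fix \<sigma> assume "\<sigma> \<in> sections_at W F x"
  then show "\<sigma> \<in> sections_at V F x" using assms by (auto simp: sections_at_def)
next
  fix \<sigma> assume "\<sigma> \<in> sections_at V F x"
  then obtain U where "open U" "x \<in> U" "U \<subseteq> V" "smooth_on U \<sigma>" "\<forall>y\<in>U. \<sigma> y \<in> F y"
    by (auto simp: sections_at_def)
  then show "\<sigma> \<in> sections_at W F x"
    using assms by (auto simp: sections_at_def intro!: exI[of _ "U \<inter> W"] intro: smooth_on_subset)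
qed

lemma subbundle_restrict:
  assumes sb: "subbundle k V F" and W: "open W" "W \<subseteq> V"
  shows "subbundle k W F"
proof -
  have "\<exists>U e. open U \<and> x \<in> U \<and> U \<subseteq> W \<and> (\<forall>i<k. smooth_on U (e i)) \<and>
      (\<forall>y\<in>U. F y = span ((\<lambda>i. e i y) ` {..<k}))" if x: "x \<in> W" for x
  proof -
    obtain U e where "open U" "x \<in> U" "U \<subseteq> V" "\<And>i. i < k \<Longrightarrow> smooth_on U (e i)"
      "\<And>y. y \<in> U \<Longrightarrow> F y = span ((\<lambda>i. e i y) ` {..<k})"
      using subbundle_frame[OF sb, of x] x W by blast
    then show ?thesis using x W
      by (intro exI[of _ "U \<inter> W"] exI[of _ e]) (auto intro: smooth_on_subset)
  qed
  then show ?thesis using sb W by (auto simp: subbundle_def)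
qed

lemma legendre_mapD:
  assumes "legendre_map V F"
  shows "subbundle 2 V F" "x \<in> V \<Longrightarrow> F x \<in> isotropic_planes"
    "x \<in> V \<Longrightarrow> \<sigma> \<in> sections_at V F x \<Longrightarrow> Der \<sigma> x X \<in> perp (F x)"
    "x \<in> V \<Longrightarrow> (\<And>\<sigma>. \<sigma> \<in> sections_at V F x \<Longrightarrow> Der \<sigma> x X \<in> F x) \<Longrightarrow> X = 0"
  using assms unfolding legendre_map_def legendre_in_def immersed_def derived_bundle_def by blast+

lemma legendre_map_restrict:
  assumes leg: "legendre_map V F" and W: "open W" "W \<subseteq> V"
  shows "legendre_map W F"
proof -
  have "derived_bundle W F x \<subseteq> perp (F x)" if "x \<in> W" for x
  proof -
    have "derived_bundle W F x = derived_bundle V F x"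
      by (simp add: derived_bundle_def sections_at_restrict[OF W that])
    then show ?thesis using leg W that by (auto simp: legendre_map_def legendre_in_def)
  qed
  moreover have "immersed W F"
    unfolding immersed_def
  proof (intro ballI allI impI)
    fix x X assume "x \<in> W" "\<forall>\<sigma>\<in>sections_at W F x. Der \<sigma> x X \<in> F x"
    then show "X = 0"
      using legendre_mapD(4)[OF leg subsetD[OF W(2)], of x X] by (simp add: sections_at_restrict[OF W])
  qed
  ultimately show ?thesis
    using leg subbundle_restrict[of 2 V F W] W
    by (auto simp: legendre_map_def legendre_in_def)
qed

text \<open>The contact condition makes \<open>(d\<sigma>\<^sub>1(X), d\<sigma>\<^sub>2(Y))\<close> symmetric in \<open>X\<close> and \<open>Y\<close>.\<close>

lemma contact_symmetric:
  fixes \<sigma>1 \<sigma>2 :: "'a::real_normed_vector \<Rightarrow> R42"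
  assumes U: "open U" "x \<in> U" and sm: "smooth_on U \<sigma>1" "smooth_on U \<sigma>2"
    and ct: "\<And>y X. y \<in> U \<Longrightarrow> lip (Der \<sigma>1 y X) (\<sigma>2 y) = 0"
  shows "lip (Der \<sigma>1 x X) (Der \<sigma>2 x Y) =
    lip (Der \<sigma>1 x Y) (Der \<sigma>2 x X)"
proof -
  have *: "lip (Der \<sigma>1 x X) (Der \<sigma>2 x Y) +
      lip (Der (\<lambda>y. Der \<sigma>1 y X) x Y) (\<sigma>2 x) = 0" for X Y
  proof -
    have "Der (\<lambda>y. lip (Der \<sigma>1 y X) (\<sigma>2 y)) x Y = 0"
      by (rule Der_const_on[OF U(1) ct U(2)])
    then show ?thesis
      using Der_bilinear[OF lip.bounded_bilinear_axioms smooth_on_deriv[OF sm(1)] sm(2) U(2)]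
      by simp
  qed
  show ?thesis
    using *[of X Y] *[of Y X] second_derivative_symmetric[OF U(1) sm(1) U(2), of X Y] by simp
qed

lemma timelike_lift_derivative:
  fixes F :: "'a::real_normed_vector \<Rightarrow> R42 set"
  assumes W: "open W" "x \<in> W" and sb: "subbundle 2 W F" and iso: "\<And>x. x \<in> W \<Longrightarrow> F x \<in> isotropic_planes"
  shows "Der (\<lambda>x. timelike_lift (F x) r s) x X $ 5 = 0"
    "Der (\<lambda>x. timelike_lift (F x) r s) x X $ 6 = 0"
proof -
  have sm: "smooth_on W (\<lambda>x. timelike_lift (F x) r s)" by (rule smooth_on_timelike_lift[OF sb iso])
  have "Der (\<lambda>x. timelike_lift (F x) r s $ i) x X = 0" if "i = 5 \<or> i = 6" for i
    using that timelike_lift[OF iso]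
    by (intro Der_const_on[OF W(1) _ W(2), of _ "if i = 5 then r else s"]) auto
  then show "Der (\<lambda>x. timelike_lift (F x) r s) x X $ 5 = 0"
    "Der (\<lambda>x. timelike_lift (F x) r s) x X $ 6 = 0"
    by (simp_all add: Der_linear[OF bounded_linear_vec_nth sm W(2)])
qed

text \<open>A section is determined by its timelike coordinates, so it is tangent to the family in a
  direction that is tangent for the timelike frame.\<close>

lemma section_derivative_in_plane:
  fixes F :: "'a::real_normed_vector \<Rightarrow> R42 set"
  assumes sb: "subbundle 2 W F" and iso: "\<And>x. x \<in> W \<Longrightarrow> F x \<in> isotropic_planes" and x: "x \<in> W"
    and \<sigma>: "\<sigma> \<in> sections_at W F x"
    and z: "Der (\<lambda>x. timelike_lift (F x) 1 0) x X = 0"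
      "Der (\<lambda>x. timelike_lift (F x) 0 1) x X = 0"
  shows "Der \<sigma> x X \<in> F x"
proof -
  obtain U where U: "open U" "x \<in> U" "U \<subseteq> W" "smooth_on U \<sigma>" "\<And>y. y \<in> U \<Longrightarrow> \<sigma> y \<in> F y"
    using \<sigma> by (auto simp: sections_at_def)
  let ?s0 = "\<lambda>x. timelike_lift (F x) 1 0" and ?s1 = "\<lambda>x. timelike_lift (F x) 0 1"
  have sm: "smooth_on U (\<lambda>x. timelike_lift (F x) r s)" for r s
    by (rule smooth_on_subset[OF smooth_on_timelike_lift[OF sb iso] U(3)])
  have smc: "smooth_on U (\<lambda>y. \<sigma> y $ i)" for i
    by (rule smooth_on_linear[OF U(1) bounded_linear_vec_nth U(4)])
  have sm0: "smooth_on U (\<lambda>y. (\<sigma> y $ 5) *\<^sub>R ?s0 y)" and sm1: "smooth_on U (\<lambda>y. (\<sigma> y $ 6) *\<^sub>R ?s1 y)"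
    by (intro smooth_on_scaleR U(1) smc sm)+
  have eq: "(\<sigma> y $ 5) *\<^sub>R ?s0 y + (\<sigma> y $ 6) *\<^sub>R ?s1 y = \<sigma> y" if "y \<in> U" for y
    using timelike_lift_expand[OF iso U(5)[OF that]] that U(3) by auto
  have "((\<lambda>y. (\<sigma> y $ 5) *\<^sub>R ?s0 y + (\<sigma> y $ 6) *\<^sub>R ?s1 y) has_derivative
      (\<lambda>X. Der (\<lambda>y. (\<sigma> y $ 5) *\<^sub>R ?s0 y) x X +
           Der (\<lambda>y. (\<sigma> y $ 6) *\<^sub>R ?s1 y) x X)) (at x)"
    by (intro has_derivative_add smooth_on_has_derivative[OF sm0 U(2)] smooth_on_has_derivative[OF sm1 U(2)])
  then have "(\<sigma> has_derivative
      (\<lambda>X. Der (\<lambda>y. (\<sigma> y $ 5) *\<^sub>R ?s0 y) x X +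
           Der (\<lambda>y. (\<sigma> y $ 6) *\<^sub>R ?s1 y) x X)) (at x)"
    by (rule has_derivative_transform_within_open[OF _ U(1,2)]) (rule eq)
  then have "Der \<sigma> x X =
      Der (\<lambda>y. (\<sigma> y $ 5) *\<^sub>R ?s0 y) x X + Der (\<lambda>y. (\<sigma> y $ 6) *\<^sub>R ?s1 y) x X"
    by (simp add: frechet_derivative_at[symmetric])
  also have "\<dots> = Der (\<lambda>y. \<sigma> y $ 5) x X *\<^sub>R ?s0 x + Der (\<lambda>y. \<sigma> y $ 6) x X *\<^sub>R ?s1 x"
    using z by (simp add: Der_bilinear[OF bounded_bilinear_scaleR smc sm U(2)])
  also have "\<dots> \<in> F x"
    using isotropicD(1)[OF iso[OF x]] timelike_lift(1)[OF iso[OF x]] by (intro subspace_add subspace_scale)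
  finally show ?thesis .
qed

text \<open>Let \<open>a\<close> and \<open>b\<close> take their values in the vectors without timelike part of \<open>F\<^sup>\<bottom>\<close> orthogonal to
  \<open>l\<close>, which form a spacelike line. If \<open>(a X, b Y)\<close> is symmetric in \<open>X\<close> and \<open>Y\<close> and \<open>a\<close> does not
  vanish identically, then the zeros of \<open>a\<close> are zeros of \<open>b\<close>.\<close>

lemma common_kernel:
  assumes F: "F \<in> isotropic_planes" and l: "l \<in> perp F" "lip l l > 0"
    and a: "\<And>X. a X \<in> perp F" "\<And>X. lip l (a X) = 0" "\<And>X. a X $ 5 = 0" "\<And>X. a X $ 6 = 0"
    and b: "\<And>X. b X \<in> perp F" "\<And>X. lip l (b X) = 0" "\<And>X. b X $ 5 = 0" "\<And>X. b X $ 6 = 0"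
    and sym: "\<And>X Y. lip (a X) (b Y) = lip (a Y) (b X)"
    and XY: "a X = 0" "a Y \<noteq> 0"
  shows "b X = 0"
proof -
  obtain y z where yz: "y \<noteq> 0 \<or> z \<noteq> 0" "y *\<^sub>R a Y + z *\<^sub>R b X \<in> F"
    using perp_dependent[OF F l a(1,2)[of Y] b(1,2)[of X]] by blast
  then have eq: "y *\<^sub>R a Y + z *\<^sub>R b X = 0"
    using isotropic_timelike_zero[OF F] a b by simp
  have "lip (a Y) (b X) = 0" using sym[of X Y] XY(1) by (simp add: lip.zero_left)
  then have "y * lip (a Y) (a Y) = 0" "z * lip (b X) (b X) = 0"
    using arg_cong[OF eq, of "lip (a Y)"] arg_cong[OF eq, of "lip (b X)"]
    by (simp_all add: lip.add_right lip.scaleR_right lip.zero_right lip.zero_left lip_commute)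
  moreover have "lip (a Y) (a Y) \<noteq> 0" using spacelike_part_nonneg(2)[of "a Y"] a XY(2) by auto
  ultimately have "lip (b X) (b X) = 0" using yz(1) by auto
  then show ?thesis using spacelike_part_nonneg(2)[of "b X"] b by auto
qed

lemma line_dependent:
  assumes F: "F \<in> isotropic_planes" and l: "l \<in> perp F" "lip l l > 0"
    and a: "a \<in> perp F" "lip l a = 0" "a $ 5 = 0" "a $ 6 = 0"
    and b: "b \<in> perp F" "lip l b = 0" "b $ 5 = 0" "b $ 6 = 0"
  shows "\<exists>y z. (y \<noteq> 0 \<or> z \<noteq> 0) \<and> y *\<^sub>R a + z *\<^sub>R b = 0"
proof -
  obtain y z where yz: "y \<noteq> 0 \<or> z \<noteq> 0" "y *\<^sub>R a + z *\<^sub>R b \<in> F"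
    using perp_dependent[OF F l a(1,2) b(1,2)] by blast
  then have "y *\<^sub>R a + z *\<^sub>R b = 0" using isotropic_timelike_zero[OF F] a b by simp
  then show ?thesis using yz(1) by blast
qed

section \<open>Spherical bundles along curvature lines\<close>

text \<open>Constancy along integral curves becomes \<open>de(T) = 0\<close> for a unit section \<open>e\<close>, since there is an
  integral curve through each point.\<close>

lemma integral_curve_through:
  assumes sb: "subbundle 1 V T" and U: "open U" "U \<subseteq> V" and b: "smooth_on U b" and x: "x \<in> U"
    and T: "\<And>y. y \<in> U \<Longrightarrow> T y = span {b y}"
  obtains d \<gamma> where "d > 0" "\<gamma> 0 = x" "integral_curve V T {-d<..<d} \<gamma>" "\<gamma> ` {-d<..<d} \<subseteq> U"
    "(\<gamma> has_vector_derivative b x) (at 0)"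
proof -
  obtain d \<gamma> where d: "d > 0" "\<gamma> 0 = x"
    "\<And>t. t \<in> {-d<..<d} \<Longrightarrow> \<gamma> t \<in> U \<and> (\<gamma> has_vector_derivative b (\<gamma> t)) (at t)"
    using integral_curve_exists[OF U(1) b x] by blast
  have "b y \<noteq> 0" if "y \<in> U" for y
    using dim_subbundle[OF sb subsetD[OF U(2) that]] T[OF that] by auto
  then have "\<exists>X. (\<gamma> has_vector_derivative X) (at t) \<and> X \<in> T (\<gamma> t) \<and> X \<noteq> 0" if "t \<in> {-d<..<d}" for t
    using d(3)[OF that] T span_base[of "b (\<gamma> t)" "{b (\<gamma> t)}"] by (intro exI[of _ "b (\<gamma> t)"]) auto
  moreover have "open_interval {-d<..<d}" using d(1) by (simp add: open_interval_def is_interval_convex_1)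
  ultimately have "integral_curve V T {-d<..<d} \<gamma>"
    unfolding integral_curve_def using d(3) U(2) by blast
  then show ?thesis using that[of d \<gamma>] d by (force simp: image_subset_iff)
qed

lemma spherical_bundle_constant:
  assumes T: "subbundle 1 V T" and sp: "spherical_bundle V F T E"
    and U: "open U" "U \<subseteq> V" "x \<in> U" and e: "smooth_on U e" "\<And>y. y \<in> U \<Longrightarrow> lip (e y) (e y) = 1"
      "\<And>y. y \<in> U \<Longrightarrow> E y = span {e y}"
    and X: "X \<in> T x"
  shows "Der e x X = 0"
proof -
  have xV: "x \<in> V" using U by auto
  obtain U1 b where U1: "open U1" "x \<in> U1" "U1 \<subseteq> V" and b: "smooth_on U1 (b 0)"
    and Tb: "\<And>y. y \<in> U1 \<Longrightarrow> T y = span ((\<lambda>i. b i y) ` {..<1::nat})"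
    using subbundle_frame[OF T xV] by (metis less_one)
  have Tb': "T y = span {b 0 y}" if "y \<in> U1" for y using Tb[OF that] by (simp add: lessThan_Suc)
  have op: "open (U \<inter> U1)" "U \<inter> U1 \<subseteq> V" "x \<in> U \<inter> U1" "smooth_on (U \<inter> U1) (b 0)"
    using U U1 b by (auto intro: smooth_on_subset)
  obtain d \<gamma> where \<gamma>: "d > 0" "\<gamma> 0 = x" "integral_curve V T {-d<..<d} \<gamma>" "\<gamma> ` {-d<..<d} \<subseteq> U \<inter> U1"
    "(\<gamma> has_vector_derivative b 0 x) (at 0)"
    using integral_curve_through[OF T op(1,2,4,3)] Tb' by (metis IntD2)
  have 0: "0 \<in> {-d<..<d}" using \<gamma>(1) by simp
  have E: "E (\<gamma> t) = E x" if "t \<in> {-d<..<d}" for t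
    using sp \<gamma>(2,3) that 0 unfolding spherical_bundle_def by metis
  have "((\<lambda>t. e (\<gamma> t)) has_vector_derivative Der e x (b 0 x)) (at 0)"
    using has_vector_derivative_chain[OF e(1), of \<gamma> 0] \<gamma>(2,5) U(3) by simp
  then have "Der e x (b 0 x) \<in> E x"
  proof (rule subspace_derivative[OF _ open_greaterThanLessThan 0, rotated 2])
    show "subspace (E x)" unfolding e(3)[OF U(3)] by simp
    show "e (\<gamma> s) \<in> E x" if s: "s \<in> {-d<..<d}" for s
    proof -
      have "\<gamma> s \<in> U" using \<gamma>(4) s by auto
      then show ?thesis using E[OF s] e(3)[of "\<gamma> s"] by (metis insertI1 span_base)
    qed
  qed
  then obtain k where k: "Der e x (b 0 x) = k *\<^sub>R e x"
    by (auto simp: e(3)[OF U(3)] span_singleton)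
  have "k = 0"
    using lip_unit_derivative[OF U(1) e(1,2) U(3), of "b 0 x"] e(2)[OF U(3)]
    by (simp add: k lip.scaleR_right)
  moreover obtain m where "X = m *\<^sub>R b 0 x" using X by (auto simp: Tb'[OF U1(2)] span_singleton)
  ultimately show ?thesis
    using k linear_cmul[OF smooth_on_linear_deriv[OF e(1) U(3)]] by simp
qed

text \<open>If the differential of the unit section vanished at a point, all of \<open>df\<close> would take its values
  in a line modulo \<open>f\<close> there; by symmetry its kernel would be nonzero.\<close>

lemma spherical_bundle_immersed:
  assumes V: "open V" and leg: "legendre_map V F"
    and U: "open U" "U \<subseteq> V" "x \<in> U" and e: "smooth_on U e" "\<And>y. y \<in> U \<Longrightarrow> lip (e y) (e y) = 1"
      "\<And>y. y \<in> U \<Longrightarrow> F y \<subseteq> perp (span {e y})"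
  shows "\<exists>Y. Der e x Y \<noteq> 0"
proof (rule ccontr)
  assume "\<not> ?thesis"
  then have de: "Der e x Y = 0" for Y by blast
  note leg = legendre_map_restrict[OF leg U(1,2)]
  note sb = legendre_mapD(1)[OF leg] and iso = legendre_mapD(2)[OF leg]
  \<comment> \<open>\<open>s True\<close> and \<open>s False\<close> are the two members of the timelike frame.\<close>
  define s where "s i y = timelike_lift (F y) (if i then 1 else 0) (if i then 0 else 1)" for i y
  have sm: "smooth_on U (s i)" for i unfolding s_def by (rule smooth_on_timelike_lift[OF sb iso])
  have sec: "s i \<in> sections_at U F y" if "y \<in> U" for i y
    using that U(1) sm[of i] timelike_lift(1)[OF iso] by (auto simp: sections_at_def s_def intro!: exI[of _ U])
  have sF: "s i y \<in> F y" if "y \<in> U" for i y using timelike_lift(1)[OF iso[OF that]] by (simp add: s_def)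
  let ?a = "\<lambda>i. Der (s i) x"
  have lin: "linear (?a i)" for i by (rule smooth_on_linear_deriv[OF sm U(3)])
  have a1: "?a i X \<in> perp (F x)" for i X by (rule legendre_mapD(3)[OF leg U(3) sec[OF U(3)]])
  have a2: "lip (e x) (?a i X) = 0" for i X
  proof -
    have "lip (e y) (s i y) = 0" if "y \<in> U" for y
      using e(3)[OF that] sF[OF that] by (auto simp: perp_span lip_commute[of "e y"] subset_iff)
    then have "Der (\<lambda>y. lip (e y) (s i y)) x X = 0"
      by (rule Der_const_on[OF U(1) _ U(3)])
    then show ?thesis
      using Der_bilinear[OF lip.bounded_bilinear_axioms e(1) sm U(3)] de
      by (simp add: lip.zero_left)
  qed
  have a3: "?a i X $ 5 = 0" "?a i X $ 6 = 0" for i X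
    unfolding s_def using timelike_lift_derivative[OF U(1,3) sb iso] by auto
  have ct: "lip (Der (s i) y X) (s j y) = 0" if "y \<in> U" for i j y X
    using perpD[OF legendre_mapD(3)[OF leg that sec[OF that]] sF[OF that]] .
  have sym: "lip (?a i X) (?a j Y) = lip (?a i Y) (?a j X)" for i j X Y
    by (rule contact_symmetric[OF U(1,3) sm sm ct])
  have l: "e x \<in> perp (F x)" "lip (e x) (e x) > 0"
    using e(2,3)[OF U(3)] by (auto simp: perp_def subset_iff lip_commute span_base)
  have "\<exists>X. X \<noteq> 0 \<and> ?a True X = 0 \<and> ?a False X = 0"
  proof (cases "\<exists>Y. ?a True Y \<noteq> 0")
    case True
    then obtain Y where Y: "?a True Y \<noteq> 0" by blast
    obtain X where X: "X \<noteq> 0" "?a True X = 0"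
      using plane_kernel_exists[OF lin line_dependent[OF iso[OF U(3)] l a1 a2 a3 a1 a2 a3]] by blast
    have "?a False X = 0"
      by (rule common_kernel[OF iso[OF U(3)] l a1 a2 a3 a1 a2 a3 sym X(2) Y])
    then show ?thesis using X by blast
  next
    case False
    then show ?thesis
      using plane_kernel_exists[OF lin line_dependent[OF iso[OF U(3)] l a1 a2 a3 a1 a2 a3], of False] by blast
  qed
  then obtain X where X: "X \<noteq> 0" "?a True X = 0" "?a False X = 0" by blast
  have "X = 0"
  proof (rule legendre_mapD(4)[OF leg U(3)])
    fix \<sigma> assume "\<sigma> \<in> sections_at U F x"
    from section_derivative_in_plane[OF sb _ U(3) this, of X] iso X
    show "Der \<sigma> x X \<in> F x" by (simp add: s_def[abs_def])
  qed
  then show False using X(1) by simp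
qed

section \<open>Existence of spherical evolution\<close>

text \<open>The matrix of the skew endomorphism \<open>a \<and> b\<close>.\<close>

definition wedge_matrix :: "R42 \<Rightarrow> R42 \<Rightarrow> real^6^6" where
  "wedge_matrix a b = matrix (wedge a b)"

lemma wedge_matrix_apply: "wedge_matrix a b *v c = wedge a b c"
proof -
  have "linear (wedge a b)"
    by (rule linearI) (simp_all add: wedge_def lip.add_right lip.scaleR_right algebra_simps)
  then show ?thesis by (simp add: wedge_matrix_def matrix_works)
qed

lemma bounded_bilinear_wedge_matrix: "bounded_bilinear wedge_matrix"
  by (rule bilinear_conv_bounded_bilinear[THEN iffD1])
    (auto simp: bilinear_def wedge_matrix_def matrix_def wedge_def vec_eq_iff lip.add_left
      lip.scaleR_left algebra_simps intro!: linearI)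

lemma bounded_bilinear_matrix_mult: "bounded_bilinear ((**) :: real^6^6 \<Rightarrow> real^6^6 \<Rightarrow> real^6^6)"
  by (rule bilinear_conv_bounded_bilinear[THEN iffD1])
    (auto simp: bilinear_def matrix_matrix_mult_def vec_eq_iff sum.distrib sum_distrib_left algebra_simps
      intro!: linearI)

lemma lip_wedge_skew: "lip (wedge a b x) y + lip x (wedge a b y) = 0"
  by (simp add: wedge_def lip.diff_left lip.diff_right lip.scaleR_left lip.scaleR_right lip_commute)

text \<open>The inverse \<open>B\<close> of the spherical evolution map solves \<open>B' = (\<epsilon> \<and> \<epsilon>') B\<close>. The equation is made
  autonomous by adding \<open>v\<close> to the unknowns; its solutions are orthogonal because \<open>\<epsilon> \<and> \<epsilon>'\<close> is skew.\<close>

lemma linear_transport_exists: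
  fixes \<epsilon> :: "real \<Rightarrow> R42"
  assumes J: "open J" "v0 \<in> J" and sm: "smooth_on J \<epsilon>"
  obtains K B where "open_interval K" "v0 \<in> K" "K \<subseteq> J" "smooth_on K B" "B v0 = mat 1"
    "\<And>v. v \<in> K \<Longrightarrow> B v \<in> O42"
    "\<And>v w. v \<in> K \<Longrightarrow> ((\<lambda>t. B t *v w) has_vector_derivative
      wedge (\<epsilon> v) (vector_derivative \<epsilon> (at v)) (B v *v w)) (at v)"
proof -
  define M where "M v = wedge_matrix (\<epsilon> v) (vector_derivative \<epsilon> (at v))" for v
  have smM: "smooth_on J M"
    unfolding M_def
    by (rule smooth_on_bilinear[OF J(1) bounded_bilinear_wedge_matrix sm smooth_on_vector_derivative[OF J(1) sm]])
  define S where "S = J \<times> (UNIV :: (real^6^6) set)"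
  define F where "F x = (1 :: real, M (fst x) ** snd x)" for x :: "real \<times> (real^6^6)"
  have opS: "open S" using J by (simp add: S_def open_Times)
  have sms: "smooth_on S snd" by (rule smooth_on_bounded_linear[OF opS bounded_linear_snd])
  have smf: "smooth_on S (\<lambda>x. M (fst x))"
    by (rule smooth_on_compose[OF opS J(1) smooth_on_bounded_linear[OF opS bounded_linear_fst] smM])
      (auto simp: S_def)
  have smF: "smooth_on S F"
    unfolding F_def
    by (rule smooth_on_Pair[OF opS smooth_on_const smooth_on_bilinear[OF opS bounded_bilinear_matrix_mult smf sms]])
  have "(v0, mat 1) \<in> S" using J by (simp add: S_def)
  then obtain d \<gamma> where d: "d > 0" "\<gamma> 0 = (v0, mat 1)"
    "\<And>t. t \<in> {-d<..<d} \<Longrightarrow> \<gamma> t \<in> S \<and> (\<gamma> has_vector_derivative F (\<gamma> t)) (at t)"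
    using integral_curve_exists[OF opS smF] by blast
  have oi: "open_interval {-d<..<d}" using d(1) by (simp add: open_interval_def is_interval_convex_1)
  have fst\<gamma>: "fst (\<gamma> t) = v0 + t" if t: "t \<in> {-d<..<d}" for t
  proof -
    have "((\<lambda>t. fst (\<gamma> t) - t) has_vector_derivative 0) (at t)" if "t \<in> {-d<..<d}" for t
    proof -
      have "((\<lambda>t. fst (\<gamma> t)) has_vector_derivative fst (F (\<gamma> t))) (at t)"
        by (rule bounded_linear.has_vector_derivative[OF bounded_linear_fst]) (use d(3)[OF that] in blast)
      from has_vector_derivative_diff[OF this has_vector_derivative_id] show ?thesis by (simp add: F_def)
    qed
    from constant_on_open_interval[OF oi this t, of 0] show ?thesis using d(1,2) by simp
  qed
  define K where "K = {v0 - d<..<v0 + d}"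
  define B where "B v = snd (\<gamma> (v - v0))" for v
  have K: "open_interval K" "v0 \<in> K" using d(1) by (auto simp: K_def open_interval_def is_interval_convex_1)
  have opK: "open K" by (simp add: K_def)
  have KJ: "K \<subseteq> J"
  proof
    fix v assume "v \<in> K"
    then have "v - v0 \<in> {-d<..<d}" by (auto simp: K_def)
    then show "v \<in> J" using d(3)[of "v - v0"] fst\<gamma>[of "v - v0"] by (auto simp: S_def mem_Times_iff)
  qed
  have B': "(B has_vector_derivative M v ** B v) (at v)" if "v \<in> K" for v
  proof -
    have v: "v - v0 \<in> {-d<..<d}" using that by (auto simp: K_def)
    have "((\<lambda>t. snd (\<gamma> t)) has_vector_derivative snd (F (\<gamma> (v - v0)))) (at (v - v0))"
      by (rule bounded_linear.has_vector_derivative[OF bounded_linear_snd]) (use d(3)[OF v] in blast)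
    then have "((\<lambda>t. snd (\<gamma> t)) \<circ> (\<lambda>t. t - v0) has_vector_derivative 1 *\<^sub>R snd (F (\<gamma> (v - v0)))) (at v)"
      by (intro vector_diff_chain_at) (auto intro!: derivative_eq_intros)
    then show ?thesis using fst\<gamma>[OF v] by (simp add: B_def[abs_def] o_def F_def)
  qed
  have smB: "Ck_on k K B" for k
  proof (induction k)
    case 0
    show ?case
      using B' by (auto intro!: continuous_at_imp_continuous_on dest: has_vector_derivative_continuous)
  next
    case (Suc k)
    show ?case
    proof (rule Ck_on_SucI[OF opK])
      show "(B has_derivative (\<lambda>X. X *\<^sub>R (M v ** B v))) (at v)" if "v \<in> K" for v
        using B'[OF that] by (simp add: has_vector_derivative_def)
      have "Ck_on k K M" using smM KJ by (auto simp: smooth_on_def intro: Ck_on_subset)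
      then have "Ck_on k K (\<lambda>v. M v ** B v)"
        by (rule Ck_on_bilinear[OF opK bounded_bilinear_matrix_mult _ Suc])
      then show "Ck_on k K (\<lambda>v. X *\<^sub>R (M v ** B v))" for X
        by (rule Ck_on_linear[OF opK bounded_linear_scaleR_right])
    qed
  qed
  have Bw: "((\<lambda>t. B t *v w) has_vector_derivative
      wedge (\<epsilon> v) (vector_derivative \<epsilon> (at v)) (B v *v w)) (at v)" if "v \<in> K" for v w
    using bounded_linear.has_vector_derivative[OF mv.bounded_linear_left B'[OF that], of w]
    by (simp add: matrix_vector_mul_assoc[symmetric] wedge_matrix_apply M_def)
  have B0: "B v0 = mat 1" by (simp add: B_def d(2))
  have "B v \<in> O42" if v: "v \<in> K" for v
  proof -
    have "lip (B v *v x) (B v *v y) = lip (B v0 *v x) (B v0 *v y)" for x y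
    proof (rule constant_on_open_interval[OF K(1) _ v K(2)])
      fix t assume t: "t \<in> K"
      show "((\<lambda>t. lip (B t *v x) (B t *v y)) has_vector_derivative 0) (at t)"
        using lip.has_vector_derivative[OF Bw[OF t, of x] Bw[OF t, of y]] lip_wedge_skew
        by (simp add: add.commute)
    qed
    then show ?thesis by (simp add: O42_def B0)
  qed
  then show ?thesis using that[OF K KJ _ B0 _ Bw] smB by (simp add: smooth_on_def)
qed

section \<open>Rolling a Legendre map with spherical curvature lines onto a Legendre curve\<close>

text \<open>A Legendre map \<open>F\<close> that is orthogonal to the spacelike line spanned by the unit vector \<open>\<epsilon>(\<phi>)\<close>,
  together with a solution \<open>B\<close> of the transport equation along \<open>\<epsilon>\<close>. The level lines of \<open>\<phi>\<close> are the
  spherical curvature lines.\<close>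

locale spherical_family =
  fixes W :: "(real \<times> real) set" and F :: "real \<times> real \<Rightarrow> R42 set"
    and \<phi> :: "real \<times> real \<Rightarrow> real" and J :: "real set" and v0 :: real
    and \<epsilon> :: "real \<Rightarrow> R42" and B :: "real \<Rightarrow> real^6^6"
  assumes W: "open W" and leg: "legendre_map W F"
    and J: "open_interval J" "v0 \<in> J"
    and \<phi>: "smooth_on W \<phi>" "\<phi> ` W \<subseteq> J"
    and \<epsilon>: "smooth_on J \<epsilon>" "\<And>v. v \<in> J \<Longrightarrow> lip (\<epsilon> v) (\<epsilon> v) = 1"
    and F_perp: "\<And>x. x \<in> W \<Longrightarrow> F x \<subseteq> perp (span {\<epsilon> (\<phi> x)})"
    and B: "smooth_on J B" "\<And>v. v \<in> J \<Longrightarrow> B v \<in> O42" "B v0 = mat 1"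
    and B': "\<And>v w. v \<in> J \<Longrightarrow> ((\<lambda>t. B t *v w) has_vector_derivative
      wedge (\<epsilon> v) (vector_derivative \<epsilon> (at v)) (B v *v w)) (at v)"
begin

abbreviation \<epsilon>' :: "real \<Rightarrow> R42" where "\<epsilon>' v \<equiv> vector_derivative \<epsilon> (at v)"

text \<open>The spherical evolution map, the line it belongs to, and the map \<open>G = A F\<close> into the isotropic
  planes of \<open>L(v\<^sub>0)\<^sup>\<bottom>\<close>.\<close>

definition A :: "real \<Rightarrow> real^6^6" where "A v = lip_adjoint (B v)"

definition L :: "real \<Rightarrow> R42 set" where "L v = span {\<epsilon> v}"

definition G :: "real \<times> real \<Rightarrow> R42 set" where "G x = (\<lambda>c. A (\<phi> x) *v c) ` F x"

lemma opJ: "open J" using J by (simp add: open_interval_def)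

lemma \<phi>J: "x \<in> W \<Longrightarrow> \<phi> x \<in> J" using \<phi>(2) by auto

lemma A_O42: "v \<in> J \<Longrightarrow> A v \<in> O42" by (simp add: A_def O42_adjoint_in B)

lemma inv_A: "v \<in> J \<Longrightarrow> matrix_inv (A v) = B v"
  using O42_matrix_inv[OF A_O42, of v] by (simp add: A_def lip_adjoint_lip_adjoint)

lemma AB: "v \<in> J \<Longrightarrow> A v *v (B v *v x) = x" and BA: "v \<in> J \<Longrightarrow> B v *v (A v *v x) = x"
  using O42_inv_mult[OF A_O42] by (simp_all add: inv_A)

lemma A_smooth: "smooth_on J A"
  unfolding A_def by (rule smooth_on_linear[OF opJ bounded_linear_lip_adjoint B(1)])

lemma B_lip: "v \<in> J \<Longrightarrow> lip (B v *v x) (B v *v y) = lip x y"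
  by (rule O42_lip[OF B(2)])

lemma F_subbundle: "subbundle 2 W F" and F_isotropic: "x \<in> W \<Longrightarrow> F x \<in> isotropic_planes"
  using legendre_mapD[OF leg] by auto

lemma \<epsilon>_orth: "v \<in> J \<Longrightarrow> lip (\<epsilon> v) (\<epsilon>' v) = 0"
  by (rule lip_unit_vector_derivative[OF opJ \<epsilon>])

lemma \<epsilon>_parallel:
  assumes "v \<in> J" shows "lip (\<epsilon> v) (B v *v w) = lip (\<epsilon> v0) w"
proof -
  have "lip (\<epsilon> v) (B v *v w) = lip (\<epsilon> v0) (B v0 *v w)"
  proof (rule constant_on_open_interval[OF J(1) _ assms J(2)])
    fix t assume t: "t \<in> J"
    have "((\<lambda>s. lip (\<epsilon> s) (B s *v w)) has_vector_derivative
        lip (\<epsilon> t) (wedge (\<epsilon> t) (\<epsilon>' t) (B t *v w)) + lip (\<epsilon>' t) (B t *v w)) (at t)"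
      by (intro lip.has_vector_derivative B' smooth_on_has_vector_derivative[OF \<epsilon>(1)] t)
    moreover have "lip (\<epsilon> t) (wedge (\<epsilon> t) (\<epsilon>' t) (B t *v w)) + lip (\<epsilon>' t) (B t *v w) = 0"
      using \<epsilon>_orth[OF t] \<epsilon>(2)[OF t] by (simp add: wedge_def lip.diff_right lip.scaleR_right)
    ultimately show "((\<lambda>s. lip (\<epsilon> s) (B s *v w)) has_vector_derivative 0) (at t)" by simp
  qed
  then show ?thesis by (simp add: B(3))
qed

lemma F_orth: "x \<in> W \<Longrightarrow> w \<in> F x \<Longrightarrow> lip (\<epsilon> (\<phi> x)) w = 0"
  using F_perp[of x] by (auto simp: perp_span lip_commute[of "\<epsilon> (\<phi> x)"] subset_iff)

lemma BG: "x \<in> W \<Longrightarrow> w \<in> G x \<Longrightarrow> B (\<phi> x) *v w \<in> F x"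
  by (auto simp: G_def BA \<phi>J)

lemma F_eq_BG: "x \<in> W \<Longrightarrow> F x = (\<lambda>c. B (\<phi> x) *v c) ` G x"
  by (simp add: G_def image_image BA \<phi>J)

lemma G_orth: "x \<in> W \<Longrightarrow> w \<in> G x \<Longrightarrow> lip (\<epsilon> v0) w = 0"
  using \<epsilon>_parallel[OF \<phi>J] F_orth BG by metis

lemma G_isotropic: "x \<in> W \<Longrightarrow> G x \<in> isotropic_planes"
  unfolding G_def by (intro O42_image_isotropic A_O42 \<phi>J F_isotropic)

lemma G_subbundle: "subbundle 2 W G"
  unfolding G_def
  by (rule subbundle_image[OF F_subbundle W smooth_on_compose[OF W opJ \<phi>(1) A_smooth \<phi>(2)] A_O42[OF \<phi>J]])

lemma B'_apply: "v \<in> J \<Longrightarrow> vector_derivative B (at v) *v w = wedge (\<epsilon> v) (\<epsilon>' v) (B v *v w)"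
  using bounded_linear.has_vector_derivative[OF mv.bounded_linear_left smooth_on_has_vector_derivative[OF B(1)]]
    B' vector_derivative_unique_at by blast

text \<open>A section \<open>\<tau>\<close> of \<open>G\<close> and the corresponding section \<open>B \<tau>\<close> of \<open>F\<close>.\<close>

lemma transported_section:
  assumes \<tau>: "\<tau> \<in> sections_at W G x" and x: "x \<in> W"
  shows "(\<lambda>y. B (\<phi> y) *v \<tau> y) \<in> sections_at W F x"
    "Der (\<lambda>y. B (\<phi> y) *v \<tau> y) x X = B (\<phi> x) *v Der \<tau> x X +
      Der \<phi> x X *\<^sub>R wedge (\<epsilon> (\<phi> x)) (\<epsilon>' (\<phi> x)) (B (\<phi> x) *v \<tau> x)"
proof -
  obtain U where U: "open U" "x \<in> U" "U \<subseteq> W" "smooth_on U \<tau>" "\<And>y. y \<in> U \<Longrightarrow> \<tau> y \<in> G y"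
    using \<tau> by (auto simp: sections_at_def)
  have sm\<phi>: "smooth_on U \<phi>" by (rule smooth_on_subset[OF \<phi>(1) U(3)])
  have smB: "smooth_on U (\<lambda>y. B (\<phi> y))"
    by (rule smooth_on_compose[OF U(1) opJ sm\<phi> B(1)]) (use \<phi>J U(3) in auto)
  have "smooth_on U (\<lambda>y. B (\<phi> y) *v \<tau> y)"
    by (rule smooth_on_bilinear[OF U(1) mv.bounded_bilinear_axioms smB U(4)])
  then show "(\<lambda>y. B (\<phi> y) *v \<tau> y) \<in> sections_at W F x"
    unfolding sections_at_def using U BG by blast
  have xJ: "\<phi> x \<in> J" by (rule \<phi>J[OF x])
  have DB: "Der (\<lambda>y. B (\<phi> y)) x X =
      Der \<phi> x X *\<^sub>R vector_derivative B (at (\<phi> x))"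
    using Der_chain[OF B(1) xJ sm\<phi> U(2)] Der_eq_vector_derivative[OF B(1) xJ] by simp
  show "Der (\<lambda>y. B (\<phi> y) *v \<tau> y) x X = B (\<phi> x) *v Der \<tau> x X +
      Der \<phi> x X *\<^sub>R wedge (\<epsilon> (\<phi> x)) (\<epsilon>' (\<phi> x)) (B (\<phi> x) *v \<tau> x)"
    using Der_bilinear[OF mv.bounded_bilinear_axioms smB U(4,2), of X]
    by (simp add: DB mv.scaleR_left B'_apply[OF xJ])
qed

lemma section_untransported:
  assumes \<sigma>: "\<sigma> \<in> sections_at W F x" and x: "x \<in> W"
  obtains \<tau> where "\<tau> \<in> sections_at W G x" "\<sigma> x = B (\<phi> x) *v \<tau> x"
    "\<And>X. Der \<sigma> x X = Der (\<lambda>y. B (\<phi> y) *v \<tau> y) x X"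
proof -
  obtain U where U: "open U" "x \<in> U" "U \<subseteq> W" "smooth_on U \<sigma>" "\<And>y. y \<in> U \<Longrightarrow> \<sigma> y \<in> F y"
    using \<sigma> by (auto simp: sections_at_def)
  define \<tau> where "\<tau> y = A (\<phi> y) *v \<sigma> y" for y
  have sm\<phi>: "smooth_on U \<phi>" by (rule smooth_on_subset[OF \<phi>(1) U(3)])
  have smA: "smooth_on U (\<lambda>y. A (\<phi> y))"
    by (rule smooth_on_compose[OF U(1) opJ sm\<phi> A_smooth]) (use \<phi>J U(3) in auto)
  have "smooth_on U \<tau>"
    unfolding \<tau>_def by (rule smooth_on_bilinear[OF U(1) mv.bounded_bilinear_axioms smA U(4)])
  then have "\<tau> \<in> sections_at W G x"
    unfolding sections_at_def using U by (auto simp: \<tau>_def G_def)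
  moreover have eq: "\<sigma> y = B (\<phi> y) *v \<tau> y" if "y \<in> U" for y
    using BA[OF \<phi>J[OF subsetD[OF U(3) that]]] by (simp add: \<tau>_def)
  moreover have "Der (\<lambda>y. B (\<phi> y) *v \<tau> y) x = Der \<sigma> x"
    by (rule Der_cong[OF U(1,4) _ U(2)]) (rule eq)
  ultimately show ?thesis using that U(2) by simp
qed

text \<open>\<open>G\<close> satisfies the contact condition within \<open>L(v\<^sub>0)\<^sup>\<bottom>\<close>: the additional term in the derivative is a
  multiple of \<open>\<epsilon>\<close>, to which \<open>F\<close> is orthogonal.\<close>

lemma G_contact:
  assumes \<tau>: "\<tau> \<in> sections_at W G x" and x: "x \<in> W"
  shows "Der \<tau> x X \<in> perp (G x)" "lip (\<epsilon> v0) (Der \<tau> x X) = 0"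
proof -
  obtain U where U: "open U" "x \<in> U" "U \<subseteq> W" "smooth_on U \<tau>" "\<And>y. y \<in> U \<Longrightarrow> \<tau> y \<in> G y"
    using \<tau> by (auto simp: sections_at_def)
  have "lip (Der \<tau> x X) w = 0" if w: "w \<in> G x" for w
  proof -
    let ?Bw = "B (\<phi> x) *v w" and ?\<sigma> = "B (\<phi> x) *v \<tau> x"
    have Bw: "?Bw \<in> F x" "?\<sigma> \<in> F x" using BG[OF x] w U by auto
    have "lip (Der (\<lambda>y. B (\<phi> y) *v \<tau> y) x X) ?Bw = 0"
      by (rule perpD[OF legendre_mapD(3)[OF leg x transported_section(1)[OF \<tau> x]] Bw(1)])
    moreover have "wedge (\<epsilon> (\<phi> x)) (\<epsilon>' (\<phi> x)) ?\<sigma> = (- lip (\<epsilon>' (\<phi> x)) ?\<sigma>) *\<^sub>R \<epsilon> (\<phi> x)"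
      by (rule wedge_unit_orthogonal[OF F_orth[OF x Bw(2)]])
    ultimately have "lip (B (\<phi> x) *v Der \<tau> x X) ?Bw = 0"
      using F_orth[OF x Bw(1)] by (simp add: transported_section(2)[OF \<tau> x] lip.add_left lip.diff_left lip.scaleR_left)
    then show ?thesis by (simp add: B_lip[OF \<phi>J[OF x]])
  qed
  then show "Der \<tau> x X \<in> perp (G x)" by (simp add: perp_def)
  have "Der (\<lambda>y. lip (\<epsilon> v0) (\<tau> y)) x X = 0"
    by (rule Der_const_on[OF U(1) G_orth[OF subsetD[OF U(3)] U(5)] U(2)])
  then show "lip (\<epsilon> v0) (Der \<tau> x X) = 0"
    by (simp add: Der_linear[OF lip.bounded_linear_right U(4,2)])
qed

text \<open>The timelike frame of \<open>G\<close>, indexed by truth values.\<close>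

definition s :: "bool \<Rightarrow> real \<times> real \<Rightarrow> R42" where
  "s i x = timelike_lift (G x) (if i then 1 else 0) (if i then 0 else 1)"

lemma s_smooth: "smooth_on W (s i)"
  unfolding s_def by (rule smooth_on_timelike_lift[OF G_subbundle G_isotropic])

lemma s_in: "x \<in> W \<Longrightarrow> s i x \<in> G x"
  unfolding s_def by (rule timelike_lift(1)[OF G_isotropic])

lemma s_section: "x \<in> W \<Longrightarrow> s i \<in> sections_at W G x"
  using W s_smooth s_in by (auto simp: sections_at_def)

lemma s_derivative:
  assumes "x \<in> W"
  shows "Der (s i) x X \<in> perp (G x)"
    "lip (\<epsilon> v0) (Der (s i) x X) = 0"
    "Der (s i) x X $ 5 = 0" "Der (s i) x X $ 6 = 0"
  using G_contact[OF s_section[OF assms] assms]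
    timelike_lift_derivative[OF W assms G_subbundle G_isotropic] by (simp_all add: s_def[abs_def])

lemma s_symmetric:
  assumes "x \<in> W"
  shows "lip (Der (s i) x X) (Der (s j) x Y) =
    lip (Der (s i) x Y) (Der (s j) x X)"
  by (rule contact_symmetric[OF W assms s_smooth s_smooth])
    (rule perpD[OF s_derivative(1) s_in])

lemma normal: "x \<in> W \<Longrightarrow> \<epsilon> v0 \<in> perp (G x)" "lip (\<epsilon> v0) (\<epsilon> v0) > 0"
  using G_orth \<epsilon>(2)[OF J(2)] by (auto simp: perp_def)

lemma s_common_kernel:
  assumes x: "x \<in> W" and "Der (s i) x X = 0" "Der (s i) x Y \<noteq> 0"
  shows "Der (s j) x X = 0"
  by (rule common_kernel[OF G_isotropic[OF x] normal(1)[OF x] normal(2) s_derivative[OF x]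
        s_derivative[OF x] s_symmetric[OF x] assms(2,3)])

lemma G_span: "x \<in> W \<Longrightarrow> G x = span {s True x, s False x}"
proof
  assume x: "x \<in> W"
  show "span {s True x, s False x} \<subseteq> G x"
    using isotropicD(1)[OF G_isotropic[OF x]] s_in[OF x] by (simp add: span_minimal)
  show "G x \<subseteq> span {s True x, s False x}"
  proof
    fix w assume "w \<in> G x"
    from timelike_lift_expand[OF G_isotropic[OF x] this]
    have "w = (w $ 5) *\<^sub>R s True x + (w $ 6) *\<^sub>R s False x" by (simp add: s_def)
    moreover have "(w $ 5) *\<^sub>R s True x + (w $ 6) *\<^sub>R s False x \<in> span {s True x, s False x}"
      by (intro span_add span_scale span_base) simp_all
    ultimately show "w \<in> span {s True x, s False x}" by simp
  qed
qed

text \<open>In a direction where \<open>G\<close> is stationary, \<open>F\<close> only moves by the infinitesimal transport.\<close>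

lemma tangent_modulo_L:
  assumes x: "x \<in> W" and X: "\<And>i. Der (s i) x X = 0"
    and \<sigma>: "\<sigma> \<in> sections_at W F x"
  shows "Der \<sigma> x X -
    Der \<phi> x X *\<^sub>R wedge (\<epsilon> (\<phi> x)) (\<epsilon>' (\<phi> x)) (\<sigma> x) \<in> F x"
proof -
  obtain \<tau> where \<tau>: "\<tau> \<in> sections_at W G x" "\<sigma> x = B (\<phi> x) *v \<tau> x"
    "\<And>X. Der \<sigma> x X = Der (\<lambda>y. B (\<phi> y) *v \<tau> y) x X"
    using section_untransported[OF \<sigma> x] by blast
  have "Der \<tau> x X \<in> G x"
    using section_derivative_in_plane[OF G_subbundle _ x \<tau>(1), of X] G_isotropic X[of True] X[of False]
    by (simp add: s_def[abs_def])
  then have "B (\<phi> x) *v Der \<tau> x X \<in> F x" by (rule BG[OF x])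
  then show ?thesis by (simp add: \<tau>(2,3) transported_section(2)[OF \<tau>(1) x])
qed

lemma immersed_on_kernel:
  assumes x: "x \<in> W" and "Der \<phi> x X = 0" "\<And>i. Der (s i) x X = 0"
  shows "X = 0"
  using legendre_mapD(4)[OF leg x] tangent_modulo_L[OF x assms(3)] assms(2) by simp

text \<open>\<open>G\<close> has rank one, so it is locally a function of a single component \<open>\<mu>\<close> of its frame. As \<open>F\<close> is
  immersed, this component can be chosen to have nonzero derivative along the kernel of \<open>d\<phi>\<close>.\<close>

lemma profile_curve:
  assumes q: "q \<in> W" and X0: "X0 \<noteq> 0" "Der \<phi> q X0 = 0"
  obtains W' I \<mu> i k c where "open W'" "q \<in> W'" "W' \<subseteq> W" "open_interval I" "\<mu> ` W' = I"
    "smooth_on W' \<mu>" "Der \<mu> q X0 \<noteq> 0" "\<And>x. \<mu> x = s i x \<bullet> k"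
    "\<And>j. smooth_on I (c j)" "\<And>j x. x \<in> W' \<Longrightarrow> s j x = c j (\<mu> x)"
proof -
  obtain i where i: "Der (s i) q X0 \<noteq> 0"
    using immersed_on_kernel[OF q X0(2)] X0(1) by blast
  define k where "k = Der (s i) q X0"
  define \<mu> where "\<mu> x = s i x \<bullet> k" for x
  have sm: "smooth_on W \<mu>"
    unfolding \<mu>_def by (rule smooth_on_linear[OF W bounded_linear_inner_left s_smooth])
  have D\<mu>: "Der \<mu> x X = Der (s i) x X \<bullet> k" if "x \<in> W" for x X
    unfolding \<mu>_def by (rule Der_linear[OF bounded_linear_inner_left s_smooth that])
  have nz: "Der \<mu> q X0 \<noteq> 0" using i by (simp add: D\<mu>[OF q] k_def)
  define W1 where "W1 = W \<inter> (\<lambda>x. Der \<mu> x X0) -` (- {0})"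
  have W1: "open W1"
    unfolding W1_def by (rule smooth_on_open_vimage[OF W smooth_on_deriv[OF sm]]) (simp add: open_Compl)
  have q1: "q \<in> W1" "W1 \<subseteq> W" using q nz by (auto simp: W1_def)
  define S where "S x = (s True x, s False x)" for x
  have smS: "smooth_on W1 S"
    unfolding S_def by (intro smooth_on_Pair W1 smooth_on_subset[OF s_smooth q1(2)])
  have ker: "Der S x X = 0" if x: "x \<in> W1" and X: "Der \<mu> x X = 0" for x X
  proof -
    have xW: "x \<in> W" and x0: "Der \<mu> x X0 \<noteq> 0" using x by (auto simp: W1_def)
    obtain y z where yz: "y \<noteq> 0 \<or> z \<noteq> 0"
      "y *\<^sub>R Der (s i) x X + z *\<^sub>R Der (s i) x X0 = 0"
      using line_dependent[OF G_isotropic[OF xW] normal(1)[OF xW] normal(2) s_derivative[OF xW] s_derivative[OF xW]]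
      by blast
    have "y * Der \<mu> x X + z * Der \<mu> x X0 = 0"
      using arg_cong[OF yz(2), of "\<lambda>w. w \<bullet> k"] by (simp add: D\<mu>[OF xW] inner_add_left)
    then have "z = 0" "y \<noteq> 0" using X x0 yz(1) by auto
    then have "Der (s i) x X = 0" using yz(2) by simp
    moreover have "Der (s i) x X0 \<noteq> 0" using x0 by (auto simp: D\<mu>[OF xW])
    ultimately have sX: "Der (s j) x X = 0" for j by (rule s_common_kernel[OF xW])
    have "(S has_derivative (\<lambda>X. (Der (s True) x X, Der (s False) x X))) (at x)"
      unfolding S_def by (intro has_derivative_Pair smooth_on_has_derivative[OF s_smooth xW])
    then show ?thesis using sX by (simp add: frechet_derivative_at[symmetric] zero_prod_def)
  qed
  obtain W' I c where W': "open W'" "q \<in> W'" "W' \<subseteq> W1" "open_interval I" "\<mu> ` W' = I"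
    and c: "smooth_on I c" "\<And>x. x \<in> W' \<Longrightarrow> S x = c (\<mu> x)"
    using factor_through[OF W1 smooth_on_subset[OF sm q1(2)] smS q1(1) ker nz] by metis
  have opI: "open I" using W'(4) by (simp add: open_interval_def)
  show ?thesis
  proof (rule that[of W' I \<mu> i k "\<lambda>j t. if j then fst (c t) else snd (c t)"])
    show "smooth_on I (\<lambda>t. if j then fst (c t) else snd (c t))" for j
      using smooth_on_linear[OF opI bounded_linear_fst c(1)] smooth_on_linear[OF opI bounded_linear_snd c(1)]
      by (cases j) simp_all
    show "s j x = (if j then fst (c (\<mu> x)) else snd (c (\<mu> x)))" if "x \<in> W'" for j x
      using c(2)[OF that] by (cases j) (auto simp: S_def prod_eq_iff)
    show "smooth_on W' \<mu>" using sm W'(3) q1(2) by (blast intro: smooth_on_subset)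
  qed (use W' q1 nz in \<open>auto simp: \<mu>_def\<close>)
qed

text \<open>The hypothesis says that \<open>v\<close> itself is a component of \<open>\<epsilon>(v)\<close>, so \<open>\<epsilon>'\<close> has no zeros.\<close>

lemma L_immersion:
  assumes l: "\<And>v. v \<in> J \<Longrightarrow> \<epsilon> v \<bullet> l = v" and K: "open K" "K \<subseteq> J"
  shows "immersion_into_spacelike_lines K L"
proof -
  have "subbundle 1 K L"
    unfolding subbundle_def
  proof (intro conjI ballI)
    fix v assume v: "v \<in> K"
    have "\<epsilon> v \<noteq> 0" using \<epsilon>(2)[of v] v K by (auto simp: lip.zero_left)
    then show "subspace (L v)" "dim (L v) = 1" by (simp_all add: L_def)
    show "\<exists>U e. open U \<and> v \<in> U \<and> U \<subseteq> K \<and> (\<forall>i<1. smooth_on U (e i)) \<and>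
        (\<forall>y\<in>U. L y = span ((\<lambda>i. e i y) ` {..<1::nat}))"
      using v K smooth_on_subset[OF \<epsilon>(1) K(2)]
      by (intro exI[of _ K] exI[of _ "\<lambda>i. \<epsilon>"]) (auto simp: L_def lessThan_Suc)
  qed
  moreover have "L v \<in> spacelike_lines" if "v \<in> K" for v
  proof -
    have unit: "lip (\<epsilon> v) (\<epsilon> v) = 1" using \<epsilon>(2) that K by blast
    then have "\<epsilon> v \<noteq> 0" by (auto simp: lip.zero_left)
    moreover have "lip w w > 0" if "w \<in> L v" "w \<noteq> 0" for w
      using that unit by (auto simp: L_def span_singleton lip.scaleR_left lip.scaleR_right
          zero_less_mult_iff linorder_neq_iff)
    moreover have "subspace (L v)" "dim (L v) = 1"
      using \<open>\<epsilon> v \<noteq> 0\<close> by (simp_all add: L_def)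
    ultimately show ?thesis by (simp add: spacelike_lines_def)
  qed
  moreover have "immersed K L"
    unfolding immersed_def
  proof (intro ballI allI impI)
    fix v X assume v: "v \<in> K" and X: "\<forall>\<sigma>\<in>sections_at K L v. Der \<sigma> v X \<in> L v"
    have vJ: "v \<in> J" using v K by blast
    have "\<epsilon> \<in> sections_at K L v"
      using v K smooth_on_subset[OF \<epsilon>(1) K(2)] by (auto simp: sections_at_def L_def span_base intro!: exI[of _ K])
    then have "X *\<^sub>R \<epsilon>' v \<in> L v" using X Der_eq_vector_derivative[OF \<epsilon>(1) vJ] by metis
    then obtain k where k: "X *\<^sub>R \<epsilon>' v = k *\<^sub>R \<epsilon> v" by (auto simp: L_def span_singleton)
    have "k = 0"
      using arg_cong[OF k, of "lip (\<epsilon> v)"] \<epsilon>_orth[OF vJ] \<epsilon>(2)[OF vJ] by (simp add: lip.scaleR_right)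
    have "((\<lambda>t. \<epsilon> t \<bullet> l) has_vector_derivative \<epsilon>' v \<bullet> l) (at v)"
      by (rule bounded_linear.has_vector_derivative[OF bounded_linear_inner_left
            smooth_on_has_vector_derivative[OF \<epsilon>(1) vJ]])
    moreover have "((\<lambda>t. \<epsilon> t \<bullet> l) has_vector_derivative 1) (at v)"
      by (rule has_vector_derivative_id_on[OF opJ vJ]) (simp add: l)
    ultimately have "\<epsilon>' v \<bullet> l = 1" by (rule vector_derivative_unique_at)
    then have "\<epsilon>' v \<noteq> 0" by auto
    then show "X = 0" using k \<open>k = 0\<close> by simp
  qed
  ultimately show ?thesis by (simp add: immersion_into_spacelike_lines_def)
qed

lemma A_spherical_evolution:
  assumes K: "open K" "K \<subseteq> J" "v0 \<in> K"
  shows "spherical_evolution_map K L v0 A"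
  unfolding spherical_evolution_map_def
proof (intro conjI ballI allI impI)
  show "smooth_on K A" by (rule smooth_on_subset[OF A_smooth K(2)])
  show "A v \<in> O42" if "v \<in> K" for v using A_O42 K that by blast
  show "A v0 = mat 1"
    using AB[OF J(2)] by (simp add: B(3) matrix_eq)
  fix \<sigma> :: "real \<Rightarrow> R42" and v assume \<sigma>: "smooth_on K \<sigma>" and v: "v \<in> K"
  have vJ: "v \<in> J" using v K by blast
  let ?\<sigma>' = "vector_derivative \<sigma> (at v)"
  have \<sigma>': "(\<sigma> has_vector_derivative ?\<sigma>') (at v)" by (rule smooth_on_has_vector_derivative[OF \<sigma> v])
  have vB: "(B has_vector_derivative vector_derivative B (at v)) (at v)"
    by (rule smooth_on_has_vector_derivative[OF B(1) vJ])
  have "((\<lambda>t. B t *v \<sigma> t) has_vector_derivative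
      B v *v ?\<sigma>' + wedge (\<epsilon> v) (\<epsilon>' v) (B v *v \<sigma> v)) (at v)"
    using mv.has_vector_derivative[OF vB \<sigma>'] by (simp add: B'_apply[OF vJ])
  then have der: "((\<lambda>t. matrix_inv (A t) *v \<sigma> t) has_vector_derivative
      B v *v ?\<sigma>' + wedge (\<epsilon> v) (\<epsilon>' v) (B v *v \<sigma> v)) (at v)"
    by (rule has_vector_derivative_transform_within_open[OF _ opJ vJ]) (simp add: inv_A)
  have "conn_D L (\<lambda>t. matrix_inv (A t) *v \<sigma> t) v = B v *v ?\<sigma>'"
    using conn_D_unit[OF opJ \<epsilon> vJ _ der, of L] by (simp add: L_def inv_A[OF vJ])
  then show "A v *v conn_D L (\<lambda>t. matrix_inv (A t) *v \<sigma> t) v = ?\<sigma>'" by (simp add: AB[OF vJ])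
qed

lemma conn_N_eq: "v \<in> J \<Longrightarrow> conn_N L v w = wedge (\<epsilon> v) (\<epsilon>' v) w"
  by (rule conn_N_unit[OF opJ \<epsilon>]) (simp_all add: L_def)

text \<open>In the coordinates \<open>(\<mu>, \<phi>)\<close> the map \<open>G\<close> depends on the first coordinate only, and it is the
  required Legendre curve. The map \<open>h\<close> is the inverse of these coordinates.\<close>

lemma normal_form:
  assumes q: "q \<in> W" "\<phi> q = v0" and l: "\<And>v. v \<in> J \<Longrightarrow> \<epsilon> v \<bullet> l = v"
    and X0: "X0 \<noteq> 0" "Der \<phi> q X0 = 0" and Y0: "Der \<phi> q Y0 \<noteq> 0"
  obtains I K C h \<Phi> where "evolution_data I K L v0 A C"
    "smooth_on (I \<times> K) h" "h ` (I \<times> K) \<subseteq> W" "open (h ` (I \<times> K))" "q \<in> h ` (I \<times> K)"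
    "smooth_on (h ` (I \<times> K)) \<Phi>" "\<And>y. y \<in> I \<times> K \<Longrightarrow> \<Phi> (h y) = y"
    "\<And>y. y \<in> I \<times> K \<Longrightarrow> Der \<phi> (h y) (Der h y (1, 0)) = 0"
    "\<And>y. y \<in> I \<times> K \<Longrightarrow> F (h y) = evolved A C y"
proof -
  obtain W' I1 \<mu> i k c where W': "open W'" "q \<in> W'" "W' \<subseteq> W" "open_interval I1" "\<mu> ` W' = I1"
    and \<mu>: "smooth_on W' \<mu>" "Der \<mu> q X0 \<noteq> 0" "\<And>x. \<mu> x = s i x \<bullet> k"
    and c: "\<And>j. smooth_on I1 (c j)" "\<And>j x. x \<in> W' \<Longrightarrow> s j x = c j (\<mu> x)"
    by (rule profile_curve[OF q(1) X0]) (rule that; assumption)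
  have sm\<phi>: "smooth_on W' \<phi>" by (rule smooth_on_subset[OF \<phi>(1) W'(3)])
  have det: "Der \<mu> q (1, 0) * Der \<phi> q (0, 1) -
      Der \<mu> q (0, 1) * Der \<phi> q (1, 0) \<noteq> 0"
    by (rule plane_det_nonzero[OF smooth_on_linear_deriv[OF \<mu>(1) W'(2)] smooth_on_linear_deriv[OF sm\<phi> W'(2)]
          X0(2) \<mu>(2) Y0])
  obtain I K h where IK: "open_interval I" "open_interval K" "\<mu> q \<in> I" "\<phi> q \<in> K"
    and h: "smooth_on (I \<times> K) h" "h ` (I \<times> K) \<subseteq> W'" "open (h ` (I \<times> K))" "h (\<mu> q, \<phi> q) = q"
    and h\<mu>: "\<And>s t. s \<in> I \<Longrightarrow> t \<in> K \<Longrightarrow> \<mu> (h (s, t)) = s"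
    and h\<phi>: "\<And>s t. s \<in> I \<Longrightarrow> t \<in> K \<Longrightarrow> \<phi> (h (s, t)) = t"
    by (rule local_coordinates[OF W'(1) \<mu>(1) sm\<phi> W'(2) det]) (rule that; assumption)
  have op: "open I" "open K" using IK by (auto simp: open_interval_def)
  have v0K: "v0 \<in> K" using IK(4) q(2) by simp
  have hW': "h (u, v) \<in> W'" and hW: "h (u, v) \<in> W" if "u \<in> I" "v \<in> K" for u v
    using h(2) W'(3) that by auto
  have II1: "I \<subseteq> I1" using hW' h\<mu> v0K W'(5) by (metis imageI subsetI)
  have KJ: "K \<subseteq> J" using hW h\<phi> IK(3) \<phi>J by (metis subsetI)
  define C where "C u = span {c True u, c False u}" for u
  have GC: "G x = C (\<mu> x)" if "x \<in> W'" for x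
    using G_span[of x] c(2)[OF that] W'(3) that by (auto simp: C_def)
  have C_iso: "C u \<in> isotropic_planes" if "u \<in> I" for u
    using G_isotropic[OF hW[OF that v0K]] GC[OF hW'[OF that v0K]] h\<mu>[OF that v0K] by simp
  have C_perp: "C u \<subseteq> perp (L v0)" if "u \<in> I" for u
    using G_orth[OF hW[OF that v0K]] GC[OF hW'[OF that v0K]] h\<mu>[OF that v0K]
    by (auto simp: L_def perp_span lip_commute[of _ "\<epsilon> v0"])
  have F_evolved: "F (h (u, v)) = evolved A C (u, v)" if uv: "u \<in> I" "v \<in> K" for u v
    using F_eq_BG[OF hW[OF uv]] GC[OF hW'[OF uv]] h\<mu>[OF uv] h\<phi>[OF uv] inv_A[of v] uv KJ
    by (auto simp: evolved_def)
  have D: "Der \<mu> (h (u, v)) (Der h (u, v) (1, 0)) = 1"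
    "Der \<phi> (h (u, v)) (Der h (u, v) (1, 0)) = 0"
    "Der \<mu> (h (u, v)) (Der h (u, v) (0, 1)) = 0"
    "Der \<phi> (h (u, v)) (Der h (u, v) (0, 1)) = 1"
    if uv: "u \<in> I" "v \<in> K" for u v
  proof -
    note der = partial_has_vector_derivative[OF h(1), of u v]
    have "((\<lambda>r. \<mu> (h (r, v))) has_vector_derivative 1) (at u)" "((\<lambda>r. \<phi> (h (r, v))) has_vector_derivative 0) (at u)"
      by (rule has_vector_derivative_id_on[OF op(1) uv(1)], simp add: h\<mu> uv)
        (rule has_vector_derivative_const_on[OF op(1) uv(1), of _ v], simp add: h\<phi> uv)
    moreover have "((\<lambda>r. \<mu> (h (u, r))) has_vector_derivative 0) (at v)" "((\<lambda>r. \<phi> (h (u, r))) has_vector_derivative 1) (at v)"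
      by (rule has_vector_derivative_const_on[OF op(2) uv(2), of _ u], simp add: h\<mu> uv)
        (rule has_vector_derivative_id_on[OF op(2) uv(2)], simp add: h\<phi> uv)
    moreover note has_vector_derivative_chain[OF \<mu>(1) hW'[OF uv] der(1)]
      has_vector_derivative_chain[OF sm\<phi> hW'[OF uv] der(1)]
      has_vector_derivative_chain[OF \<mu>(1) hW'[OF uv] der(2)]
      has_vector_derivative_chain[OF sm\<phi> hW'[OF uv] der(2)]
    ultimately show "Der \<mu> (h (u, v)) (Der h (u, v) (1, 0)) = 1"
      "Der \<phi> (h (u, v)) (Der h (u, v) (1, 0)) = 0"
      "Der \<mu> (h (u, v)) (Der h (u, v) (0, 1)) = 0"
      "Der \<phi> (h (u, v)) (Der h (u, v) (0, 1)) = 1"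
      using uv vector_derivative_unique_at by blast+
  qed
  have C_sub: "subbundle 2 I C"
    unfolding subbundle_def
  proof (intro conjI ballI)
    fix u assume u: "u \<in> I"
    show "subspace (C u)" "dim (C u) = 2" using isotropicD[OF C_iso[OF u]] by auto
    show "\<exists>U e. open U \<and> u \<in> U \<and> U \<subseteq> I \<and> (\<forall>i<2. smooth_on U (e i)) \<and>
        (\<forall>y\<in>U. C y = span ((\<lambda>i. e i y) ` {..<2::nat}))"
      using u op smooth_on_subset[OF c(1) II1]
      by (intro exI[of _ I] exI[of _ "\<lambda>i. c (i = 0)"])
        (auto simp: C_def numeral_2_eq_2 lessThan_Suc insert_commute)
  qed
  have C_der: "Der \<sigma> u X \<in> perp (C u) \<inter> perp (L v0)"
    if u: "u \<in> I" and \<sigma>: "\<sigma> \<in> sections_at I C u" for u \<sigma> X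
  proof -
    obtain U where U: "open U" "u \<in> U" "U \<subseteq> I" "smooth_on U \<sigma>" "\<And>t. t \<in> U \<Longrightarrow> \<sigma> t \<in> C t"
      using \<sigma> by (auto simp: sections_at_def)
    \<comment> \<open>\<open>\<sigma> \<circ> \<mu>\<close> is a section of \<open>G\<close>, to which the contact condition of \<open>G\<close> applies.\<close>
    let ?x = "h (u, v0)" and ?N = "W' \<inter> \<mu> -` U"
    have N: "open ?N" by (rule smooth_on_open_vimage[OF W'(1) \<mu>(1) U(1)])
    have x: "?x \<in> W" "?x \<in> W'" "?x \<in> ?N" "\<mu> ?x = u"
      using hW[OF u v0K] hW'[OF u v0K] h\<mu>[OF u v0K] U(2) by auto
    have sm: "smooth_on ?N (\<lambda>y. \<sigma> (\<mu> y))"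
      by (rule smooth_on_compose[OF N U(1) smooth_on_subset[OF \<mu>(1)] U(4)]) auto
    then have "(\<lambda>y. \<sigma> (\<mu> y)) \<in> sections_at W G ?x"
      unfolding sections_at_def using N x W'(3) U(5) by (auto simp: GC intro!: exI[of _ ?N])
    note ct = G_contact[OF this x(1)]
    let ?Z = "X *\<^sub>R Der h (u, v0) (1, 0)"
    have lin: "linear (Der \<mu> ?x)" by (rule smooth_on_linear_deriv[OF \<mu>(1) x(2)])
    have "Der (\<lambda>y. \<sigma> (\<mu> y)) ?x ?Z = Der \<sigma> u X"
      using Der_chain[OF U(4) _ \<mu>(1) x(2), of ?Z] x(4) U(2) D(1)[OF u v0K]
      by (simp add: linear_cmul[OF lin])
    then show ?thesis
      using ct[of ?Z] GC[OF x(2)] x(4) by (simp add: L_def perp_span lip_commute[of _ "\<epsilon> v0"])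
  qed
  have C_imm: "immersed I C"
    unfolding immersed_def
  proof (intro ballI allI impI)
    fix u X assume u: "u \<in> I" and X: "\<forall>\<sigma>\<in>sections_at I C u. Der \<sigma> u X \<in> C u"
    have smc: "smooth_on I (c i)" by (rule smooth_on_subset[OF c(1) II1])
    have c_eq: "c i t = s i (h (t, v0))" if "t \<in> I" for t
      using c(2)[OF hW'[OF that v0K], of i] h\<mu>[OF that v0K] by simp
    have "c i \<in> sections_at I C u"
      using op u smc by (auto simp: sections_at_def C_def intro!: exI[of _ I] span_base) (cases i; simp)
    then have in_C: "X *\<^sub>R vector_derivative (c i) (at u) \<in> C u"
      using X Der_eq_vector_derivative[OF smc u] by metis
    note der = smooth_on_has_vector_derivative[OF smc u]
    have coord: "vector_derivative (c i) (at u) $ j = 0" if j: "j = 5 \<or> j = 6" for j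
    proof -
      obtain r where r: "\<And>x. x \<in> W \<Longrightarrow> s i x $ j = r"
        using timelike_lift(2,3)[OF G_isotropic] j unfolding s_def by metis
      have "((\<lambda>t. c i t $ j) has_vector_derivative vector_derivative (c i) (at u) $ j) (at u)"
        by (rule bounded_linear.has_vector_derivative[OF bounded_linear_vec_nth der])
      moreover have "((\<lambda>t. c i t $ j) has_vector_derivative 0) (at u)"
        by (rule has_vector_derivative_const_on[OF op(1) u, of _ r])
          (simp add: c_eq r hW v0K)
      ultimately show ?thesis by (rule vector_derivative_unique_at)
    qed
    have "((\<lambda>t. c i t \<bullet> k) has_vector_derivative vector_derivative (c i) (at u) \<bullet> k) (at u)"
      by (rule bounded_linear.has_vector_derivative[OF bounded_linear_inner_left der])
    moreover have "((\<lambda>t. c i t \<bullet> k) has_vector_derivative 1) (at u)"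
      by (rule has_vector_derivative_id_on[OF op(1) u])
        (simp add: c_eq \<mu>(3)[symmetric] h\<mu> v0K)
    ultimately have "vector_derivative (c i) (at u) \<bullet> k = 1" by (rule vector_derivative_unique_at)
    then have "vector_derivative (c i) (at u) \<noteq> 0" by auto
    moreover have "X *\<^sub>R vector_derivative (c i) (at u) = 0"
      by (rule isotropic_timelike_zero[OF C_iso[OF u] in_C]) (simp_all add: coord)
    ultimately show "X = 0" by simp
  qed
  have leg_C: "legendre_curve (perp (L v0)) I C"
    using C_sub C_iso C_perp C_der C_imm isotropic_subset_perp
    unfolding legendre_curve_def legendre_in_def derived_bundle_def
    by (auto simp: subset_iff) (auto simp: sections_at_def subset_iff)
  have AdN: "Ad_N_nowhere_zero_on I K L A C"
    unfolding Ad_N_nowhere_zero_on_def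
  proof (intro ballI, rule ccontr)
    fix u v assume u: "u \<in> I" and v: "v \<in> K"
      and "\<not> (\<exists>c\<in>C u. A v *v conn_N L v (matrix_inv (A v) *v c) \<noteq> 0)"
    moreover have vJ: "v \<in> J" using v KJ by blast
    ultimately have N0: "wedge (\<epsilon> v) (\<epsilon>' v) (B v *v c) = 0" if "c \<in> C u" for c
      using that O42_inj[OF A_O42[OF vJ]] by (auto simp: inv_A conn_N_eq)
    \<comment> \<open>Along the \<open>v\<close>-lines \<open>G\<close> is stationary; if \<open>\<N>\<^sup>L\<close> vanished on \<open>F\<close> as well, \<open>F\<close> would not be
      immersed.\<close>
    let ?x = "h (u, v)" and ?Z = "Der h (u, v) (0, 1)"
    have x: "?x \<in> W" "?x \<in> W'" "\<phi> ?x = v" "\<mu> ?x = u"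
      using hW[OF u v] hW'[OF u v] h\<phi>[OF u v] h\<mu>[OF u v] by auto
    have s0: "Der (s j) ?x ?Z = 0" for j
    proof -
      have uI1: "u \<in> I1" using u II1 by blast
      have "Der (s j) ?x ?Z = Der (\<lambda>y. c j (\<mu> y)) ?x ?Z"
        by (rule fun_cong, rule Der_cong[OF W'(1) smooth_on_subset[OF s_smooth W'(3)] c(2) x(2), symmetric])
      also have "\<dots> = Der (c j) u (Der \<mu> ?x ?Z)"
        using Der_chain[OF c(1) _ \<mu>(1) x(2), of j ?Z] x(4) uI1 by simp
      also have "\<dots> = 0" using D(3)[OF u v] linear_0[OF smooth_on_linear_deriv[OF c(1) uI1]] by simp
      finally show ?thesis .
    qed
    have "?Z = 0"
    proof (rule legendre_mapD(4)[OF leg x(1)])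
      fix \<sigma> assume \<sigma>: "\<sigma> \<in> sections_at W F ?x"
      have "\<sigma> ?x \<in> (\<lambda>c. B v *v c) ` C u"
        using section_value[OF \<sigma>] F_eq_BG[OF x(1)] GC[OF x(2)] x(3,4) by simp
      then have "wedge (\<epsilon> v) (\<epsilon>' v) (\<sigma> ?x) = 0" using N0 by auto
      then show "Der \<sigma> ?x ?Z \<in> F ?x"
        using tangent_modulo_L[OF x(1) s0 \<sigma>] x(3) by simp
    qed
    then show False
      using D(4)[OF u v] linear_0[OF smooth_on_linear_deriv[OF \<phi>(1) x(1)]] by simp
  qed
  have data: "evolution_data I K L v0 A C"
    unfolding evolution_data_def
    using IK(1,2) L_immersion[OF l op(2) KJ] v0K A_spherical_evolution[OF op(2) KJ v0K] leg_C AdN by blast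
  show ?thesis
  proof (rule that[OF data h(1) _ h(3), of "\<lambda>x. (\<mu> x, \<phi> x)"])
    show "h ` (I \<times> K) \<subseteq> W" using h(2) W'(3) by blast
    show "q \<in> h ` (I \<times> K)" using h(4) IK(3,4) by (metis SigmaI image_eqI)
    show "smooth_on (h ` (I \<times> K)) (\<lambda>x. (\<mu> x, \<phi> x))"
      by (rule smooth_on_Pair[OF h(3) smooth_on_subset[OF \<mu>(1) h(2)] smooth_on_subset[OF sm\<phi> h(2)]])
  qed (use h\<mu> h\<phi> D(2) F_evolved in auto)
qed

end

text \<open>A component \<open>\<phi>\<close> of the unit section \<open>e\<close> of \<open>E\<close> with \<open>d\<phi> \<noteq> 0\<close> has the leaves of \<open>T\<close> as its
  level lines. Hence \<open>e\<close> is a function of \<open>\<phi>\<close>, and the leaves need not be straightened by a flow.\<close>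

lemma local_normal_form:
  assumes V: "open V" and leg: "legendre_map V F" and T: "subbundle 1 V T"
    and sp: "spherical_bundle V F T E" and q: "q \<in> V"
  obtains I J L v0 A C h \<Phi> where "evolution_data I J L v0 A C"
    "smooth_on (I \<times> J) h" "h ` (I \<times> J) \<subseteq> V" "open (h ` (I \<times> J))" "q \<in> h ` (I \<times> J)"
    "smooth_on (h ` (I \<times> J)) \<Phi>" "\<And>y. y \<in> I \<times> J \<Longrightarrow> \<Phi> (h y) = y"
    "\<And>y. y \<in> I \<times> J \<Longrightarrow> Der h y (1, 0) \<in> T (h y)"
    "\<And>y. y \<in> I \<times> J \<Longrightarrow> F (h y) = evolved A C y"
proof -
  have E: "subbundle 1 V E" "\<And>x. x \<in> V \<Longrightarrow> E x \<in> spacelike_lines" "\<And>x. x \<in> V \<Longrightarrow> E x \<subseteq> perp (F x)"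
    using sp by (auto simp: spherical_bundle_def)
  obtain U e where U: "open U" "q \<in> U" "U \<subseteq> V" and e: "smooth_on U e"
    "\<And>y. y \<in> U \<Longrightarrow> lip (e y) (e y) = 1" "\<And>y. y \<in> U \<Longrightarrow> E y = span {e y}"
    using unit_section[OF E(1,2) q] by metis
  have F_perp: "F y \<subseteq> perp (span {e y})" if "y \<in> U" for y
    using E(3)[of y] e(3)[OF that] U(3) that by (fastforce simp: perp_def lip_commute)
  have const: "Der e x X = 0" if "x \<in> U" "X \<in> T x" for x X
    by (rule spherical_bundle_constant[OF T sp U(1,3) that(1) e that(2)])
  obtain Y0 where Y0: "Der e q Y0 \<noteq> 0"
    using spherical_bundle_immersed[OF V leg U(1,3,2) e(1,2) F_perp] by blast
  define l where "l = Der e q Y0"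
  define \<phi> where "\<phi> x = e x \<bullet> l" for x
  have sm\<phi>: "smooth_on U \<phi>"
    unfolding \<phi>_def by (rule smooth_on_linear[OF U(1) bounded_linear_inner_left e(1)])
  have D\<phi>: "Der \<phi> x X = Der e x X \<bullet> l" if "x \<in> U" for x X
    unfolding \<phi>_def by (rule Der_linear[OF bounded_linear_inner_left e(1) that])
  define U1 where "U1 = U \<inter> (\<lambda>x. Der \<phi> x Y0) -` (- {0})"
  have U1: "open U1"
    unfolding U1_def by (rule smooth_on_open_vimage[OF U(1) smooth_on_deriv[OF sm\<phi>]]) (simp add: open_Compl)
  have "U1 \<subseteq> U" by (auto simp: U1_def)
  note U1 = U1 this subset_trans[OF this U(3)]
  have qU1: "q \<in> U1" using U(2) Y0 by (simp add: U1_def D\<phi> l_def)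
  have T_line: "\<exists>t. t \<noteq> 0 \<and> T x = span {t}" if x: "x \<in> V" for x
  proof -
    obtain b where "T x = span ((\<lambda>i. b i x) ` {..<1::nat})"
      using subbundle_frame[OF T x] by metis
    then have "T x = span {b 0 x}" by (simp add: lessThan_Suc)
    moreover from this have "b 0 x \<noteq> 0" using dim_subbundle[OF T x] by auto
    ultimately show ?thesis by blast
  qed
  have ker: "X \<in> T x" if x: "x \<in> U1" and X: "Der \<phi> x X = 0" for x X
  proof -
    have xU: "x \<in> U" "Der \<phi> x Y0 \<noteq> 0" using x by (auto simp: U1_def)
    obtain t where t: "t \<noteq> 0" "T x = span {t}" using T_line[of x] x U1(3) by blast
    have "Der \<phi> x t = 0"
      using const[OF xU(1), of t] t(2) by (simp add: D\<phi>[OF xU(1)] span_base)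
    from plane_kernel_unique[OF smooth_on_linear_deriv[OF sm\<phi> xU(1)] xU(2) t(1) this X]
    show ?thesis by (simp add: t(2))
  qed
  have ker_e: "Der e x X = 0" if "x \<in> U1" "Der \<phi> x X = 0" for x X
    using const ker[OF that] that(1) U1(2) by blast
  have Y0': "Der \<phi> q Y0 \<noteq> 0" using qU1 by (simp add: U1_def)
  obtain W' J1 \<epsilon> where W': "open W'" "q \<in> W'" "W' \<subseteq> U1" "open_interval J1" "\<phi> ` W' = J1"
    and \<epsilon>: "smooth_on J1 \<epsilon>" "\<And>x. x \<in> W' \<Longrightarrow> e x = \<epsilon> (\<phi> x)"
    using factor_through[OF U1(1) smooth_on_subset[OF sm\<phi> U1(2)] smooth_on_subset[OF e(1) U1(2)] qU1 ker_e Y0']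
    by metis
  have J1: "open J1" "\<phi> q \<in> J1" using W' by (auto simp: open_interval_def)
  have unit: "lip (\<epsilon> v) (\<epsilon> v) = 1" and \<epsilon>l: "\<epsilon> v \<bullet> l = v" if "v \<in> J1" for v
  proof -
    from that obtain x where x: "x \<in> W'" "v = \<phi> x" using W'(5) by blast
    then have xU: "x \<in> U" using W'(3) U1(2) by blast
    have ex: "\<epsilon> v = e x" by (simp only: \<epsilon>(2)[OF x(1)] x(2))
    show "lip (\<epsilon> v) (\<epsilon> v) = 1" unfolding ex by (rule e(2)[OF xU])
    show "\<epsilon> v \<bullet> l = v" unfolding ex by (simp only: x(2) \<phi>_def)
  qed
  obtain K B where K: "open_interval K" "\<phi> q \<in> K" "K \<subseteq> J1"
    and B: "smooth_on K B" "B (\<phi> q) = mat 1" "\<And>v. v \<in> K \<Longrightarrow> B v \<in> O42"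
    "\<And>v w. v \<in> K \<Longrightarrow> ((\<lambda>t. B t *v w) has_vector_derivative
      wedge (\<epsilon> v) (vector_derivative \<epsilon> (at v)) (B v *v w)) (at v)"
    using linear_transport_exists[OF J1 \<epsilon>(1)] by blast
  have opK: "open K" using K(1) by (simp add: open_interval_def)
  have W'U: "W' \<subseteq> U" using W'(3) U1(2) by blast
  define W where "W = W' \<inter> \<phi> -` K"
  have Wsub: "open W" "q \<in> W" "W \<subseteq> W'" "W \<subseteq> V"
    using smooth_on_open_vimage[OF W'(1) smooth_on_subset[OF sm\<phi> W'U] opK] W'(2) K(2) W'U U(3)
    by (auto simp: W_def)
  interpret spherical_family W F \<phi> K "\<phi> q" \<epsilon> B
  proof
    show "F x \<subseteq> perp (span {\<epsilon> (\<phi> x)})" if "x \<in> W" for x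
      using F_perp[OF subsetD[OF W'U subsetD[OF Wsub(3) that]]] \<epsilon>(2)[OF subsetD[OF Wsub(3) that]] by simp
    show "smooth_on W \<phi>" using sm\<phi> Wsub(3) W'U by (blast intro: smooth_on_subset)
  qed (use Wsub K B unit legendre_map_restrict[OF leg Wsub(1,4)] smooth_on_subset[OF \<epsilon>(1) K(3)] in
      \<open>auto simp: W_def\<close>)
  obtain t where t: "t \<noteq> 0" "T q = span {t}" using T_line[OF q] by blast
  have t0: "Der \<phi> q t = 0"
    using const[OF U(2), of t] t(2) by (simp add: D\<phi>[OF U(2)] span_base)
  have \<epsilon>lK: "\<epsilon> v \<bullet> l = v" if "v \<in> K" for v using \<epsilon>l K(3) that by blast
  show ?thesis
  proof (rule normal_form[OF Wsub(2) refl \<epsilon>lK t(1) t0 Y0'])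
    fix I J C h \<Phi>
    assume data: "evolution_data I J L (\<phi> q) A C"
      and h: "smooth_on (I \<times> J) h" "h ` (I \<times> J) \<subseteq> W" "open (h ` (I \<times> J))" "q \<in> h ` (I \<times> J)"
        "smooth_on (h ` (I \<times> J)) \<Phi>" "\<And>y. y \<in> I \<times> J \<Longrightarrow> \<Phi> (h y) = y"
      and D: "\<And>y. y \<in> I \<times> J \<Longrightarrow> Der \<phi> (h y) (Der h y (1, 0)) = 0"
      and ev: "\<And>y. y \<in> I \<times> J \<Longrightarrow> F (h y) = evolved A C y"
    have "Der h y (1, 0) \<in> T (h y)" if "y \<in> I \<times> J" for y
    proof (rule ker[OF _ D[OF that]])
      show "h y \<in> U1" using h(2) Wsub(3) W'(3) that by blast
    qed
    then show thesis
      using that[OF data h(1) _ h(3-5) h(6) _ ev] h(2) Wsub(4) by blast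
  qed
qed

section \<open>Surfaces\<close>

lemma parametrises_homeomorphic:
  "parametrises M (V, \<psi>) \<Longrightarrow> homeomorphic_map (top_of_set V) (subtopology M (\<psi> ` V)) \<psi>"
  by (simp add: parametrises_def embedding_map_def)

lemma parametrises_inj: "parametrises M (V, \<psi>) \<Longrightarrow> inj_on \<psi> V"
  using homeomorphic_imp_injective_map[OF parametrises_homeomorphic] by simp

lemma parametrises_continuous: "parametrises M (V, \<psi>) \<Longrightarrow> continuous_map (top_of_set V) M \<psi>"
  using homeomorphic_imp_continuous_map[OF parametrises_homeomorphic]
  by (simp add: continuous_map_in_subtopology)

lemma open_overlap:
  assumes "parametrises M c" "parametrises M c'"
  shows "open (overlap c c')"
proof -
  obtain V \<psi> V' \<psi>' where c: "c = (V, \<psi>)" "c' = (V', \<psi>')" by (metis surj_pair)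
  have op: "open V" "openin M (\<psi>' ` V')" using assms c by (auto simp: parametrises_def)
  have "openin (top_of_set V) {x \<in> topspace (top_of_set V). \<psi> x \<in> \<psi>' ` V'}"
    by (rule openin_continuous_map_preimage[OF parametrises_continuous[OF assms(1)[unfolded c(1)]] op(2)])
  then have "open {x \<in> V. \<psi> x \<in> \<psi>' ` V'}" using op(1) by (simp add: openin_open_eq)
  then show ?thesis by (simp add: overlap_def c)
qed

lemma transition_eq:
  assumes "parametrises M c'" "y \<in> fst c'" "snd c x = snd c' y"
  shows "transition c c' x = y"
  using assms parametrises_inj[of M "fst c'" "snd c'"] by (simp add: transition_def inv_into_f_f)

text \<open>Reparametrising a chart \<open>(V, \<psi>)\<close> by a diffeomorphism \<open>h\<close> onto an open subset of \<open>V\<close>.\<close>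

lemma reparametrisation:
  assumes c: "parametrises M (V, \<psi>)" and R: "open R" and h: "smooth_on R h" "h ` R \<subseteq> V" "open (h ` R)"
    and \<Phi>: "smooth_on (h ` R) \<Phi>" "\<And>y. y \<in> R \<Longrightarrow> \<Phi> (h y) = y"
  shows "parametrises M (R, \<psi> \<circ> h)"
proof -
  have hom: "homeomorphism R (h ` R) h \<Phi>"
    using smooth_on_continuous_on[OF h(1)] smooth_on_continuous_on[OF \<Phi>(1)] \<Phi>(2)
    by (simp add: homeomorphism_def image_image)
  then have "homeomorphic_map (top_of_set R) (top_of_set (h ` R)) h"
    by (auto simp: homeomorphic_map_maps homeomorphic_maps_def homeomorphism_def intro!: exI[of _ \<Phi>])
  then have "embedding_map (top_of_set R) (top_of_set V) h"
    using h(2) by (simp add: embedding_map_def subtopology_subtopology Int_absorb1)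
  then have emb: "embedding_map (top_of_set R) M (\<psi> \<circ> h)"
    by (rule embedding_map_compose) (use c in \<open>simp add: parametrises_def\<close>)
  have "openin (subtopology M (\<psi> ` V)) (\<psi> ` (h ` R))"
  proof -
    have "homeomorphic_map (top_of_set V) (subtopology M (\<psi> ` V)) \<psi>"
      by (rule parametrises_homeomorphic[OF c])
    moreover have "openin (top_of_set V) (h ` R)" using h(2,3) by (simp add: openin_open_eq parametrises_def open_subset)
    ultimately show ?thesis by (metis homeomorphic_imp_open_map open_map_def)
  qed
  moreover have "openin M (\<psi> ` V)" using c by (simp add: parametrises_def)
  ultimately have "openin M ((\<psi> \<circ> h) ` R)" by (metis image_comp openin_trans_full)
  then show ?thesis using R emb by (simp add: parametrises_def)
qed

lemma local_form_on_surface: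
  fixes M :: "'a topology"
  assumes M: "surface M P" and leg: "legendre_surface P f" and T: "distribution P T"
    and sp: "spherical_curvature_lines_surface P f T" and p: "p \<in> topspace M"
  shows "\<exists>I J L v0 A C h. evolution_data I J L v0 A C \<and>
    adapted_param M P T (I \<times> J, h) \<and> p \<in> h ` (I \<times> J) \<and>
    (\<forall>u\<in>I. \<forall>v\<in>J. f (h (u, v)) = evolved A C (u, v))"
proof -
  have charts: "parametrises M c" if "c \<in> P" for c using M that by (simp add: surface_def)
  have compat: "compatible c c'" if "c \<in> P" "c' \<in> P" for c c' using M that by (simp add: surface_def)
  obtain V \<psi> q where c0: "(V, \<psi>) \<in> P" "q \<in> V" "\<psi> q = p"
  proof -
    have "p \<in> (\<Union>c\<in>P. snd c ` fst c)" using M p by (simp add: surface_def)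
    then obtain c q where "c \<in> P" "q \<in> fst c" "p = snd c q" by blast
    then show ?thesis using that[of "fst c" "snd c" q] by simp
  qed
  let ?c = "(V, \<psi>)"
  obtain E where E: "spherical_bundle V (f \<circ> \<psi>) (T ?c) (E \<circ> \<psi>)"
    using sp c0(1) unfolding spherical_curvature_lines_surface_def by fastforce
  have V: "open V" using charts[OF c0(1)] by (simp add: parametrises_def)
  have leg': "legendre_map V (f \<circ> \<psi>)" using leg c0(1) unfolding legendre_surface_def by blast
  have T': "subbundle 1 V (T ?c)" using T c0(1) unfolding distribution_def by fastforce
  obtain I J L v0 A C h \<Phi> where data: "evolution_data I J L v0 A C"
    and h: "smooth_on (I \<times> J) h" "h ` (I \<times> J) \<subseteq> V" "open (h ` (I \<times> J))" "q \<in> h ` (I \<times> J)"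
      "smooth_on (h ` (I \<times> J)) \<Phi>" "\<And>y. y \<in> I \<times> J \<Longrightarrow> \<Phi> (h y) = y"
      "\<And>y. y \<in> I \<times> J \<Longrightarrow> Der h y (1, 0) \<in> T ?c (h y)"
      "\<And>y. y \<in> I \<times> J \<Longrightarrow> (f \<circ> \<psi>) (h y) = evolved A C y"
    by (rule local_normal_form[OF V leg' T' E c0(2)]) (rule that; assumption)
  have op: "open (I \<times> J)" using data by (auto simp: evolution_data_def open_interval_def open_Times)
  let ?H = "(I \<times> J, \<psi> \<circ> h)"
  have H: "parametrises M ?H" by (rule reparametrisation[OF charts[OF c0(1)] op h(1-3,5,6)])
  have Hc: "h y \<in> overlap ?c c" "transition ?H c y = transition ?c c (h y)" if "y \<in> overlap ?H c" for c y
    using that h(2) by (auto simp: overlap_def transition_def)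
  have smc: "smooth_on (overlap ?c c) (transition ?c c)" "smooth_on (overlap c ?c) (transition c ?c)" if "c \<in> P" for c
    using compat[OF c0(1) that] by (auto simp: compatible_def)
  have overlap_H: "overlap ?H c \<subseteq> I \<times> J" for c by (auto simp: overlap_def)
  have "compatible ?H c" if c: "c \<in> P" for c
    unfolding compatible_def
  proof
    have opH: "open (overlap ?H c)" "open (overlap c ?H)" "open (overlap ?c c)" "open (overlap c ?c)"
      using open_overlap H charts c c0(1) by blast+
    have "smooth_on (overlap ?H c) (\<lambda>y. transition ?c c (h y))"
      by (rule smooth_on_compose[OF opH(1,3) smooth_on_subset[OF h(1) overlap_H] smc(1)[OF c]]) (use Hc in blast)
    then show "smooth_on (overlap ?H c) (transition ?H c)"
      by (rule smooth_on_cong[OF opH(1)]) (simp add: Hc(2))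
    have sub: "overlap c ?H \<subseteq> overlap c ?c" using h(2) by (auto simp: overlap_def)
    have tr: "transition c ?c x \<in> h ` (I \<times> J)" "\<Phi> (transition c ?c x) = transition c ?H x"
      if "x \<in> overlap c ?H" for x
    proof -
      from that have "snd c x \<in> (\<psi> \<circ> h) ` (I \<times> J)" by (simp add: overlap_def)
      then obtain y where y: "y \<in> I \<times> J" "snd c x = \<psi> (h y)" by auto
      have "transition c ?c x = h y" by (rule transition_eq[OF charts[OF c0(1)]]) (use y h(2) in auto)
      moreover have "transition c ?H x = y" by (rule transition_eq[OF H]) (use y in auto)
      ultimately show "transition c ?c x \<in> h ` (I \<times> J)" "\<Phi> (transition c ?c x) = transition c ?H x"
        using y(1) h(6) by auto
    qed
    have "smooth_on (overlap c ?H) (\<lambda>x. \<Phi> (transition c ?c x))"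
      by (rule smooth_on_compose[OF opH(2) h(3) smooth_on_subset[OF smc(2)[OF c] sub] h(5)]) (use tr(1) in blast)
    then show "smooth_on (overlap c ?H) (transition c ?H)"
      by (rule smooth_on_cong[OF opH(2)]) (rule tr(2))
  qed
  moreover have "Der (transition ?H c) y (1, 0) \<in> T c (transition ?H c y)"
    if c: "c \<in> P" and y: "y \<in> overlap ?H c" for c y
  proof -
    have opH: "open (overlap ?H c)" using open_overlap H charts c by blast
    have yR: "y \<in> I \<times> J" using overlap_H y by blast
    let ?X = "Der h y (1, 0)"
    have sm: "smooth_on (overlap ?H c) (\<lambda>y. transition ?c c (h y))"
      by (rule smooth_on_compose[OF opH _ smooth_on_subset[OF h(1) overlap_H] smc(1)[OF c]])
        (use Hc open_overlap charts c c0(1) in blast)+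
    have "Der (transition ?H c) y = Der (\<lambda>y. transition ?c c (h y)) y"
      by (rule Der_cong[OF opH sm _ y]) (simp add: Hc(2))
    then have "Der (transition ?H c) y (1, 0) =
        Der (transition ?c c) (h y) ?X"
      using Der_chain[OF smc(1)[OF c] Hc(1)[OF y] h(1) yR] by simp
    moreover have "T c (transition ?c c (h y)) = Der (transition ?c c) (h y) ` T ?c (h y)"
      using T c c0(1) Hc(1)[OF y] unfolding distribution_def by blast
    ultimately show ?thesis using h(7)[OF yR] Hc(2)[OF y] by simp
  qed
  ultimately have "adapted_param M P T ?H" using H by (simp add: adapted_param_def)
  moreover have "p \<in> (\<psi> \<circ> h) ` (I \<times> J)" using h(4) c0(3) by (metis image_comp imageI)
  moreover have "\<forall>u\<in>I. \<forall>v\<in>J. f ((\<psi> \<circ> h) (u, v)) = evolved A C (u, v)" using h(8) by simp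
  ultimately show ?thesis using data by blast
qed

theorem theorem4p8:
  shows "(\<forall>I J L v0 A C. evolution_data I J L v0 A C \<longrightarrow>
            legendre_map (I \<times> J) (evolved A C) \<and>
            curvature_line_coordinates (I \<times> J) (evolved A C) \<and>
            spherical_curvature_lines (I \<times> J) (evolved A C) u_lines) \<and>
         (\<forall>(M :: 'a topology) P f T p.
            surface M P \<and> legendre_surface P f \<and> distribution P T \<and>
            spherical_curvature_lines_surface P f T \<and> p \<in> topspace M \<longrightarrow>
            (\<exists>I J L v0 A C h. evolution_data I J L v0 A C \<and>
               adapted_param M P T (I \<times> J, h) \<and> p \<in> h ` (I \<times> J) \<and>
               (\<forall>u\<in>I. \<forall>v\<in>J. f (h (u, v)) = evolved A C (u, v))))"
proof (intro conjI allI impI)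
  fix I J L v0 A C assume "evolution_data I J L v0 A C"
  then interpret spherical_evolution I J L v0 A C by unfold_locales
  show "legendre_map (I \<times> J) (evolved A C)" by (rule f_legendre)
  show "curvature_line_coordinates (I \<times> J) (evolved A C)"
    using u_lines_curvature v_lines_curvature by (simp add: curvature_line_coordinates_def)
  show "spherical_curvature_lines (I \<times> J) (evolved A C) u_lines" by (rule u_lines_spherical)
next
  fix M :: "'a topology" and P f T p
  assume "surface M P \<and> legendre_surface P f \<and> distribution P T \<and>
    spherical_curvature_lines_surface P f T \<and> p \<in> topspace M"
  then show "\<exists>I J L v0 A C h. evolution_data I J L v0 A C \<and>
      adapted_param M P T (I \<times> J, h) \<and> p \<in> h ` (I \<times> J) \<and>
      (\<forall>u\<in>I. \<forall>v\<in>J. f (h (u, v)) = evolved A C (u, v))"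
    by (elim conjE) (rule local_form_on_surface)
qed

end
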